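(* Let $X\sim L^n(\boldsymbol\mu,\Sigma,\mathcal X)$ be an $n$-dimensional Lévy process, $T\sim S^n(\mathbf d,\mathcal T)$ an $n$-dimensional subordinator, and let $(T,X\odot T)$ denote a process which is $T$ subordinating $X$ in the weak sense. Then, for $t>0$, $$\mathbb E[T(t)]/t=\mathbf d+\int_{[0,\infty)^n_*}\mathbf t\,\mathcal T(d\mathbf t),\qquad \mathrm{Cov}(T(t))/t=\int_{[0,\infty)^n_*}\mathbf t'\mathbf t\,\mathcal T(d\mathbf t),$$ $$\mathbb E[(X\odot T)(t)]/t=\mathbf d\diamond\boldsymbol\mu+\int_{\mathbb D^C}\mathbf x\,(\mathbf d\diamond\mathcal X)(d\mathbf x)+\int_{[0,\infty)^n_*}\mathbb E[X(\mathbf t)]\,\mathcal T(d\mathbf t),$$ $$\mathrm{Cov}((X\odot T)(t))/t=\mathbf d\diamond\Sigma+\int_{\mathbb R^n_*}\mathbf x'\mathbf x\,(\mathbf d\diamond\mathcal X)(d\mathbf x)+\int_{[0,\infty)^n_*}\mathbb E[X'(\mathbf t)X(\mathbf t)]\,\mathcal T(d\mathbf t),$$ $$\mathrm{Cov}((X\odot T)(t),T(t))/t=\int_{[0,\infty)^n_*}\mathbb E[X'(\mathbf t)]\,\mathbf t\,\mathcal T(d\mathbf t),$$ provided the participating integrals are finite.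
   Context: Basic notation. Elements of $\mathbb R^n$ are row vectors, $'$ denotes transposition (so $\mathbf x'\mathbf x$ is an $n\times n$ matrix, and $X'(\mathbf t)$ is the transpose of $X(\mathbf t)$), $\langle\mathbf x,\mathbf y\rangle=\mathbf x\mathbf y'$, $\|\cdot\|$ is the Euclidean norm, $\|\mathbf x\|_\Sigma^2=\mathbf x\Sigma\mathbf x'$. $\mathrm{Cov}(U,V)=\mathbb E[(U-\mathbb EU)'(V-\mathbb EV)]$ and $\mathrm{Cov}(U)=\mathrm{Cov}(U,U)$. $\mathbb D=\{\|\mathbf x\|\le 1\}$ is the closed Euclidean unit ball (in $\mathbb R^n$ or $\mathbb R^{2n}$ according to context), $\mathbb D^C$ its complement, $A_*=A\setminus\{\mathbf 0\}$, $\boldsymbol\delta_{\mathbf 0}$ is the Dirac measure at $\mathbf 0$. $\mathbf e_1,\dots,\mathbf e_n$ is the canonical basis. For $J\subseteq\{1,\dots,n\}$, $\boldsymbol\pi_J(\mathbf x)=\sum_{j\in J}x_j\mathbf e_j$. For a Borel measure $\mathcal X$ on $\mathbb R^n_*$, $\mathcal X_J$ is the restriction to $\mathbb R^n_*$ of the image under $\boldsymbol\pi_J$ of $\mathcal X$ (extended by $\mathcal X(\{\mathbf 0\})=0$). Lévy processes. $X\sim L^n(\boldsymbol\mu,\Sigma,\mathcal X)$ means that $X$ is an $n$-dimensional Lévy process with $\mathbb E e^{i\langle\boldsymbol\theta,X(t)\rangle}=e^{t\Psi_X(\boldsymbol\theta)}$, $\Psi_X(\boldsymbol\theta)=i\langle\boldsymbol\mu,\boldsymbol\theta\rangle-\frac12\|\boldsymbol\theta\|^2_\Sigma+\int_{\mathbb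 R^n_*}(e^{i\langle\boldsymbol\theta,\mathbf x\rangle}-1-i\langle\boldsymbol\theta,\mathbf x\rangle\mathbf 1_{\mathbb D}(\mathbf x))\mathcal X(d\mathbf x)$. $T\sim S^n(\mathbf d,\mathcal T)$ means that $T$ is an $n$-dimensional subordinator (a Lévy process with nondecreasing components) with drift $\mathbf d\in[0,\infty)^n$ and Lévy measure $\mathcal T$ on $[0,\infty)^n_*$. Multivariate time. For $\mathbf t=(t_1,\dots,t_n)\in[0,\infty)^n$: $X(\mathbf t)=(X_1(t_1),\dots,X_n(t_n))$. Order the components $t_{(1)}\le\dots\le t_{(n)}$ with associated permutation $\langle(1),\dots,(n)\rangle$, $t_{(0)}=0$, $\Delta t_{(k)}=t_{(k)}-t_{(k-1)}$. Put $\mathbf t\diamond\boldsymbol\mu=(t_1\mu_1,\dots,t_n\mu_n)$, $(\mathbf t\diamond\Sigma)_{kl}=\Sigma_{kl}(t_k\wedge t_l)$, $\mathbf t\diamond\mathcal X=\sum_{k=1}^n\Delta t_{(k)}\mathcal X_{\{(k),\dots,(n)\}}$, and $\mathbf c(\mathbf t,\mathcal X)=\sum_{k=2}^n\Delta t_{(k)}\int_{\mathbb D^C}\boldsymbol\pi_{\{(k),\dots,(n)\}}(\mathbf x)\mathbf 1_{\mathbb D}(\boldsymbol\pi_{\{(k),\dots,(n)\}}(\mathbf x))\,\mathcal X(d\mathbf x)$. Weak subordination. A process $Z=(Z_1,Z_2)$ is called $T$ subordinating $X$ in the weak sense, written $Z\overset{D}{=}(T,X\odot T)$, if $Z$ is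 a Lévy process with $Z\sim L^{2n}(\mathbf m,\Theta,\mathcal Z)$, $\mathbf m=(\mathbf m_1,\mathbf m_2)$, where $\mathbf m_1=\mathbf d+\int_{[0,\infty)^n_*}\mathbf t\,\mathbb P((\mathbf t,X(\mathbf t))\in\mathbb D)\,\mathcal T(d\mathbf t)$, $\mathbf m_2=\mathbf c(\mathbf d,\mathcal X)+\mathbf d\diamond\boldsymbol\mu+\int_{[0,\infty)^n_*}\mathbb E[X(\mathbf t)\mathbf 1_{\mathbb D}(\mathbf t,X(\mathbf t))]\,\mathcal T(d\mathbf t)$, $\Theta=\begin{pmatrix}0&0\\0&\mathbf d\diamond\Sigma\end{pmatrix}$, $\mathcal Z(d\mathbf t,d\mathbf x)=(\boldsymbol\delta_{\mathbf 0}\otimes(\mathbf d\diamond\mathcal X))(d\mathbf t,d\mathbf x)+\mathbf 1_{[0,\infty)^n_*\times\mathbb R^n}(\mathbf t,\mathbf x)\mathbb P(X(\mathbf t)\in d\mathbf x)\mathcal T(d\mathbf t)$. In the claim, the pair $(T,X\odot T)$ denotes such a process $Z$, with $T=Z_1$ and $X\odot T=Z_2$.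
   Formalization: The formula for E[(X⊙T)(t)]/t includes the summand c(d,𝒳), without which it is false; finiteness of ∫E[f(t,X(t))]𝒯(dt) means absolute convergence, including of the double integral over (t,X(t)) outside the unit ball, without which the mean may fail to exist. *)

theory Defs
  imports "HOL-Probability.Probability"
begin

section \<open>Vectors\<close>

text \<open>
  Row vectors of dimension \<open>n\<close> are elements of \<open>real ^ 'n\<close>, and \<open>n = CARD('n)\<close>. Row vectors of
  dimension \<open>2 n\<close> are elements of \<open>real ^ ('n + 'n)\<close>; the left summand indexes the first block.
  The closed unit ball is \<open>cball 0 1\<close> in either space.
\<close>

definition joinv :: "real ^ 'n \<Rightarrow> real ^ 'n \<Rightarrow> real ^ ('n + 'n)" where
  "joinv x y = (\<chi> i. case i of Inl k \<Rightarrow> x $ k | Inr k \<Rightarrow> y $ k)"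

definition fstv :: "real ^ ('n + 'n) \<Rightarrow> real ^ 'n" where
  "fstv z = (\<chi> k. z $ Inl k)"

definition sndv :: "real ^ ('n + 'n) \<Rightarrow> real ^ 'n" where
  "sndv z = (\<chi> k. z $ Inr k)"

text \<open>The matrix \<open>x' y\<close> for row vectors \<open>x\<close> and \<open>y\<close>.\<close>

definition outer :: "real ^ 'n \<Rightarrow> real ^ 'n \<Rightarrow> real ^ 'n ^ 'n" where
  "outer x y = (\<chi> k l. x $ k * y $ l)"

definition coord_proj :: "'n set \<Rightarrow> real ^ 'n \<Rightarrow> real ^ 'n" where
  "coord_proj J x = (\<chi> k. if k \<in> J then x $ k else 0)"

definition orthant :: "(real ^ 'n) set" where
  "orthant = {t. \<forall>k. 0 \<le> t $ k}"

definition orthant_star :: "(real ^ 'n) set" where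
  "orthant_star = orthant - {0}"

definition cov_exists :: "'w measure \<Rightarrow> ('w \<Rightarrow> real ^ 'n::finite) \<Rightarrow> ('w \<Rightarrow> real ^ 'n) \<Rightarrow> bool" where
  "cov_exists M U V \<longleftrightarrow> integrable M U \<and> integrable M V \<and>
     integrable M (\<lambda>w. outer (U w - (LINT v|M. U v)) (V w - (LINT v|M. V v)))"

definition cov :: "'w measure \<Rightarrow> ('w \<Rightarrow> real ^ 'n::finite) \<Rightarrow> ('w \<Rightarrow> real ^ 'n) \<Rightarrow> real ^ 'n ^ 'n" where
  "cov M U V = (LINT w|M. outer (U w - (LINT v|M. U v)) (V w - (LINT v|M. V v)))"


section \<open>Levy processes and subordinators\<close>

text \<open>Processes are families indexed by \<open>real\<close>; only times \<open>t \<ge> 0\<close> are relevant.\<close>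

definition levy_process :: "'w measure \<Rightarrow> (real \<Rightarrow> 'w \<Rightarrow> real ^ 'n::finite) \<Rightarrow> bool" where
  "levy_process M X \<longleftrightarrow>
     prob_space M \<and>
     (\<forall>t\<ge>0. X t \<in> borel_measurable M) \<and>
     (AE w in M. X 0 w = 0) \<and>
     (\<forall>(m::nat) f. 0 \<le> f 0 \<and> mono_on {0..m} f \<longrightarrow>
        prob_space.indep_vars M (\<lambda>_. borel) (\<lambda>i w. X (f (Suc i)) w - X (f i) w) {..<m}) \<and>
     (\<forall>s\<ge>0. \<forall>h\<ge>0. distr M borel (\<lambda>w. X (s + h) w - X s w) = distr M borel (X h)) \<and>
     (AE w in M. \<forall>s\<ge>0. ((\<lambda>r. X r w) \<longlongrightarrow> X s w) (at_right s) \<and>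
        (s > 0 \<longrightarrow> (\<exists>l. ((\<lambda>r. X r w) \<longlongrightarrow> l) (at_left s))))"

text \<open>A measure on \<open>\<real>\<^sup>n - {0}\<close> is represented by its extension to \<open>\<real>\<^sup>n\<close> that does not charge \<open>0\<close>.\<close>

definition levy_measure :: "(real ^ 'n::finite) measure \<Rightarrow> bool" where
  "levy_measure \<X> \<longleftrightarrow> sets \<X> = sets borel \<and> emeasure \<X> {0} = 0 \<and>
     (\<integral>\<^sup>+x. ennreal (min 1 ((norm x)\<^sup>2)) \<partial>\<X>) < \<infinity>"

definition levy_exponent ::
  "real ^ 'n::finite \<Rightarrow> real ^ 'n ^ 'n \<Rightarrow> (real ^ 'n) measure \<Rightarrow> real ^ 'n \<Rightarrow> complex" where
  "levy_exponent \<mu> \<Sigma> \<X> \<theta> =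
     \<i> * of_real (\<mu> \<bullet> \<theta>) - of_real (\<theta> \<bullet> (\<Sigma> *v \<theta>)) / 2 +
     (LINT x:-{0}|\<X>. iexp (\<theta> \<bullet> x) - 1 - \<i> * of_real (\<theta> \<bullet> x) * indicator (cball 0 1) x)"

text \<open>\<open>X \<sim> L\<^sup>n(\<mu>, \<Sigma>, \<X>)\<close>\<close>

definition levy_triplet ::
  "'w measure \<Rightarrow> (real \<Rightarrow> 'w \<Rightarrow> real ^ 'n::finite) \<Rightarrow>
   real ^ 'n \<Rightarrow> real ^ 'n ^ 'n \<Rightarrow> (real ^ 'n) measure \<Rightarrow> bool" where
  "levy_triplet M X \<mu> \<Sigma> \<X> \<longleftrightarrow>
     levy_process M X \<and>
     transpose \<Sigma> = \<Sigma> \<and> (\<forall>\<theta>. 0 \<le> \<theta> \<bullet> (\<Sigma> *v \<theta>)) \<and> levy_measure \<X> \<and>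
     (\<forall>t\<ge>0. \<forall>\<theta>. (LINT w|M. iexp (\<theta> \<bullet> X t w)) = exp (of_real t * levy_exponent \<mu> \<Sigma> \<X> \<theta>))"

text \<open>
  \<open>T \<sim> S\<^sup>n(d, \<T>)\<close>. The drift \<open>d\<close> is the linear coefficient of the exponent when the jumps are not
  compensated, so the location parameter for the truncation at the unit ball is
  \<open>d\<close> plus the integral of \<open>t\<close> over the unit ball.
\<close>

definition subordinator ::
  "'w measure \<Rightarrow> (real \<Rightarrow> 'w \<Rightarrow> real ^ 'n::finite) \<Rightarrow> real ^ 'n \<Rightarrow> (real ^ 'n) measure \<Rightarrow> bool" where
  "subordinator M T d \<T> \<longleftrightarrow>
     d \<in> orthant \<and> emeasure \<T> (- orthant_star) = 0 \<and>
     set_integrable \<T> (cball 0 1) (\<lambda>t. t) \<and>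
     levy_triplet M T (d + (LINT t:cball 0 1|\<T>. t)) 0 \<T> \<and>
     (AE w in M. \<forall>k r s. 0 \<le> r \<and> r \<le> s \<longrightarrow> T r w $ k \<le> T s w $ k)"


section \<open>Multivariate time\<close>

definition at_time :: "(real \<Rightarrow> 'w \<Rightarrow> real ^ 'n) \<Rightarrow> real ^ 'n \<Rightarrow> 'w \<Rightarrow> real ^ 'n" where
  "at_time X t w = (\<chi> k. X (t $ k) w $ k)"

text \<open>
  An enumeration \<open>(1), \<dots>, (n)\<close> of the coordinates that sorts \<open>t\<close>. When \<open>t\<close> has ties the choice
  does not influence the operations below, because the increments it affects vanish.
\<close>

definition sort_index :: "real ^ 'n::finite \<Rightarrow> nat \<Rightarrow> 'n" where
  "sort_index t = (SOME p. bij_betw p {1..CARD('n)} UNIV \<and> mono_on {1..CARD('n)} (\<lambda>k. t $ p k))"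

lemma sort_index:
  fixes t :: "real ^ 'n::finite"
  shows "bij_betw (sort_index t) {1..CARD('n)} UNIV"
    and "mono_on {1..CARD('n)} (\<lambda>k. t $ sort_index t k)"
proof -
  obtain xs :: "'n list" where xs: "set xs = UNIV" "distinct xs"
    using finite_distinct_list[of "UNIV :: 'n set"] by auto
  define ys where "ys = sort_key (\<lambda>k. t $ k) xs"
  have ys: "set ys = UNIV" "distinct ys" "sorted (map (\<lambda>k. t $ k) ys)"
    using xs by (auto simp: ys_def)
  have len: "length ys = CARD('n)"
    using distinct_card[OF ys(2)] ys(1) by simp
  have b1: "bij_betw (\<lambda>k. k - 1) {1..CARD('n)} {..<CARD('n)}"
    by (rule bij_betwI[where g = Suc]) auto
  have "bij_betw ((!) ys) {..<CARD('n)} UNIV"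
    using bij_betw_nth[OF ys(2), of "{..<CARD('n)}"] ys(1) len by simp
  from bij_betw_trans[OF b1 this]
  have "bij_betw (\<lambda>k. ys ! (k - 1)) {1..CARD('n)} UNIV"
    by (simp add: comp_def)
  moreover have "mono_on {1..CARD('n)} (\<lambda>k. t $ (ys ! (k - 1)))"
  proof (rule mono_onI)
    fix r s assume "r \<in> {1..CARD('n)}" "s \<in> {1..CARD('n)}" "r \<le> s"
    then have "r - 1 \<le> s - 1" "s - 1 < length ys" using len by auto
    then show "t $ (ys ! (r - 1)) \<le> t $ (ys ! (s - 1))"
      using sorted_nth_mono[OF ys(3), of "r - 1" "s - 1"] by simp
  qed
  ultimately have "\<exists>p. bij_betw p {1..CARD('n)} (UNIV :: 'n set) \<and>
      mono_on {1..CARD('n)} (\<lambda>k. t $ p k)" by blast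
  from someI_ex[OF this, folded sort_index_def]
  show "bij_betw (sort_index t) {1..CARD('n)} UNIV"
    and "mono_on {1..CARD('n)} (\<lambda>k. t $ sort_index t k)" by simp_all
qed

definition order_stat :: "real ^ 'n::finite \<Rightarrow> nat \<Rightarrow> real" where
  "order_stat t k = (if k = 0 then 0 else t $ sort_index t k)"

definition order_incr :: "real ^ 'n::finite \<Rightarrow> nat \<Rightarrow> real" where
  "order_incr t k = order_stat t k - order_stat t (k - 1)"

text \<open>The index set \<open>{(k), \<dots>, (n)}\<close>.\<close>

definition top_coords :: "real ^ 'n::finite \<Rightarrow> nat \<Rightarrow> 'n set" where
  "top_coords t k = sort_index t ` {k..CARD('n)}"

definition diamond_vec :: "real ^ 'n \<Rightarrow> real ^ 'n \<Rightarrow> real ^ 'n" where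
  "diamond_vec t \<mu> = (\<chi> k. t $ k * \<mu> $ k)"

definition diamond_mat :: "real ^ 'n \<Rightarrow> real ^ 'n ^ 'n \<Rightarrow> real ^ 'n ^ 'n" where
  "diamond_mat t \<Sigma> = (\<chi> k l. \<Sigma> $ k $ l * min (t $ k) (t $ l))"

text \<open>Image of \<open>\<X>\<close> under \<open>coord_proj J\<close>, with the mass at \<open>0\<close> removed.\<close>

definition proj_measure :: "'n set \<Rightarrow> (real ^ 'n::finite) measure \<Rightarrow> (real ^ 'n) measure" where
  "proj_measure J \<X> = density (distr \<X> borel (coord_proj J)) (indicator (- {0}))"

definition diamond_measure ::
  "real ^ 'n::finite \<Rightarrow> (real ^ 'n) measure \<Rightarrow> (real ^ 'n) measure" where
  "diamond_measure t \<X> = measure_of UNIV (sets borel)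
     (\<lambda>A. \<Sum>k=1..CARD('n). ennreal (order_incr t k) * emeasure (proj_measure (top_coords t k) \<X>) A)"

lemma sets_diamond_measure [simp]: "sets (diamond_measure t \<X>) = sets borel"
  by (simp add: diamond_measure_def sets.sets_measure_of_eq[of borel, simplified])

lemma emeasure_diamond_measure:
  fixes t :: "real ^ 'n::finite"
  assumes "A \<in> sets borel"
  shows "emeasure (diamond_measure t \<X>) A =
    (\<Sum>k=1..CARD('n). ennreal (order_incr t k) * emeasure (proj_measure (top_coords t k) \<X>) A)"
proof (rule emeasure_measure_of[OF diamond_measure_def])
  let ?f = "\<lambda>k A. ennreal (order_incr t k) * emeasure (proj_measure (top_coords t k) \<X>) A"
  have s: "sets (diamond_measure t \<X>) = sets borel" by simp
  show "sets borel \<subseteq> Pow (UNIV :: (real ^ 'n) set)" by simp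
  show "A \<in> sets (diamond_measure t \<X>)" using assms by simp
  show "positive (sets (diamond_measure t \<X>)) (\<lambda>A. \<Sum>k=1..CARD('n). ?f k A)"
    by (simp add: positive_def)
  show "countably_additive (sets (diamond_measure t \<X>)) (\<lambda>A. \<Sum>k=1..CARD('n). ?f k A)"
  proof (rule countably_additiveI)
    fix B :: "nat \<Rightarrow> (real ^ 'n) set"
    assume B: "range B \<subseteq> sets (diamond_measure t \<X>)" "disjoint_family B"
    have "(\<Sum>i. \<Sum>k=1..CARD('n). ?f k (B i)) = (\<Sum>k=1..CARD('n). \<Sum>i. ?f k (B i))"
      by (rule suminf_sum) simp
    also have "\<dots> = (\<Sum>k=1..CARD('n). ?f k (\<Union>i. B i))"
      using B by (intro sum.cong refl, subst ennreal_suminf_cmult)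
        (auto simp: proj_measure_def intro!: arg_cong2[where f = times] suminf_emeasure)
    finally show "(\<Sum>i. \<Sum>k=1..CARD('n). ?f k (B i)) = (\<Sum>k=1..CARD('n). ?f k (\<Union>i. B i))" .
  qed
qed

text \<open>
  \<open>c(t, \<X>)\<close>. A jump outside the unit ball may be projected into it, and this vector accounts for such
  jumps: the law of \<open>X(t)\<close> has location \<open>c(t, \<X>) + t \<diamond> \<mu>\<close> and Levy measure \<open>t \<diamond> \<X>\<close>, so its mean is
  the sum of the location and the integral of \<open>x\<close> over the complement of the ball.
  It vanishes when all \<open>t $ k\<close> agree.
\<close>

definition diamond_corr :: "real ^ 'n::finite \<Rightarrow> (real ^ 'n) measure \<Rightarrow> real ^ 'n" where
  "diamond_corr t \<X> = (\<Sum>k=2..CARD('n). order_incr t k *\<^sub>R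
     (LINT x:- cball 0 1|\<X>. indicator (cball 0 1) (coord_proj (top_coords t k) x) *\<^sub>R
        coord_proj (top_coords t k) x))"


section \<open>Weak subordination\<close>

definition weak_loc1 ::
  "'w measure \<Rightarrow> (real \<Rightarrow> 'w \<Rightarrow> real ^ 'n::finite) \<Rightarrow> real ^ 'n \<Rightarrow> (real ^ 'n) measure \<Rightarrow> real ^ 'n" where
  "weak_loc1 M X d \<T> = d +
     (LINT t:orthant_star|\<T>.
        measure M {w \<in> space M. joinv t (at_time X t w) \<in> cball 0 1} *\<^sub>R t)"

definition weak_loc2 ::
  "'w measure \<Rightarrow> (real \<Rightarrow> 'w \<Rightarrow> real ^ 'n::finite) \<Rightarrow> real ^ 'n \<Rightarrow> (real ^ 'n) measure \<Rightarrow>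
   real ^ 'n \<Rightarrow> (real ^ 'n) measure \<Rightarrow> real ^ 'n" where
  "weak_loc2 M X \<mu> \<X> d \<T> = diamond_corr d \<X> + diamond_vec d \<mu> +
     (LINT t:orthant_star|\<T>.
        (LINT w|M. indicator (cball 0 1) (joinv t (at_time X t w)) *\<^sub>R at_time X t w))"

definition weak_cov :: "real ^ 'n \<Rightarrow> real ^ 'n ^ 'n \<Rightarrow> real ^ ('n + 'n) ^ ('n + 'n)" where
  "weak_cov d \<Sigma> = (\<chi> i j. case (i, j) of
     (Inr k, Inr l) \<Rightarrow> diamond_mat d \<Sigma> $ k $ l | _ \<Rightarrow> 0)"

text \<open>The two summands are evaluated on Borel sets \<open>A\<close>; this determines \<open>\<Z>\<close> uniquely.\<close>

definition is_weak_levy_measure ::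
  "'w measure \<Rightarrow> (real \<Rightarrow> 'w \<Rightarrow> real ^ 'n::finite) \<Rightarrow> (real ^ 'n) measure \<Rightarrow>
   real ^ 'n \<Rightarrow> (real ^ 'n) measure \<Rightarrow> (real ^ ('n + 'n)) measure \<Rightarrow> bool" where
  "is_weak_levy_measure M X \<X> d \<T> \<Z> \<longleftrightarrow> sets \<Z> = sets borel \<and>
     (\<forall>A\<in>sets borel. emeasure \<Z> A =
        emeasure (diamond_measure d \<X>) {x. joinv 0 x \<in> A} +
        (\<integral>\<^sup>+t\<in>orthant_star. emeasure (distr M borel (at_time X t)) {x. joinv t x \<in> A} \<partial>\<T>))"

text \<open>
  \<open>Z\<close> on \<open>N\<close> is equal in law to \<open>(T, X \<odot> T)\<close>, where \<open>X \<sim> L\<^sup>n(\<mu>, \<Sigma>, \<X>)\<close> on \<open>M\<close> and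
  \<open>T \<sim> S\<^sup>n(d, \<T>)\<close>.
\<close>

definition weakly_subordinates ::
  "'w measure \<Rightarrow> (real \<Rightarrow> 'w \<Rightarrow> real ^ 'n::finite) \<Rightarrow> real ^ 'n \<Rightarrow> real ^ 'n ^ 'n \<Rightarrow>
   (real ^ 'n) measure \<Rightarrow> real ^ 'n \<Rightarrow> (real ^ 'n) measure \<Rightarrow>
   'v measure \<Rightarrow> (real \<Rightarrow> 'v \<Rightarrow> real ^ ('n + 'n)) \<Rightarrow> bool" where
  "weakly_subordinates M X \<mu> \<Sigma> \<X> d \<T> N Z \<longleftrightarrow>
     (\<exists>\<Z>. is_weak_levy_measure M X \<X> d \<T> \<Z> \<and>
        levy_triplet N Z (joinv (weak_loc1 M X d \<T>) (weak_loc2 M X \<mu> \<X> d \<T>)) (weak_cov d \<Sigma>) \<Z>)"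


section \<open>Finiteness of iterated integrals\<close>

text \<open>
  Finiteness of \<open>\<integral> E[f(t, X(t))] \<T>(dt)\<close>: the expectations and the outer integral converge
  absolutely, and the double integral converges absolutely outside the unit ball of \<open>\<real>\<^sup>2\<^sup>n\<close>.
  The last clause cannot be dropped when \<open>f\<close> changes sign: for a Brownian motion \<open>X\<close> the inner
  expectation of \<open>f(t, x) = x\<close> vanishes, yet the subordinated process has no mean if the square root
  of the subordinator has none. Inside the ball absolute convergence is not asked for, since
  \<open>E|X(t)|\<close> need not be integrable near \<open>0\<close> even when the process is square integrable.
\<close>

definition iterated_finite ::
  "'w measure \<Rightarrow> (real \<Rightarrow> 'w \<Rightarrow> real ^ 'n::finite) \<Rightarrow> (real ^ 'n) measure \<Rightarrow>
   (real ^ 'n \<Rightarrow> real ^ 'n \<Rightarrow> 'b::{banach, second_countable_topology}) \<Rightarrow> bool" where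
  "iterated_finite M X \<T> f \<longleftrightarrow>
     (AE t in \<T>. integrable M (\<lambda>w. f t (at_time X t w))) \<and>
     set_integrable \<T> orthant_star (\<lambda>t. LINT w|M. f t (at_time X t w)) \<and>
     (\<integral>\<^sup>+t\<in>orthant_star. (\<integral>\<^sup>+w. ennreal (norm (f t (at_time X t w))) *
        indicator (- cball 0 1) (joinv t (at_time X t w)) \<partial>M) \<partial>\<T>) < \<infinity>"

end

theory Submission
  imports Defs
begin

text \<open>
  The pair \<open>Z(t) = (T(t), (X \<odot> T)(t))\<close> is infinitely divisible with characteristic function
  \<open>exp (t \<psi>)\<close>, so its moments are read off from \<open>\<psi>\<close> at the origin. Let \<open>U\<close> and \<open>V\<close> be coordinates of
  \<open>Z(t)\<close> and \<open>u\<close>, \<open>v\<close> the same coordinates of a jump, distributed according to the Levy measure \<open>\<nu>\<close> of \<open>Z\<close>.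
  As soon as the jumps outside the unit ball have a mean, they can be compensated as well
  (\<open>levy_exponent_centered\<close>): the integrand becomes \<open>K(a u)\<close> with \<open>K(y) = e\<^bsup>iy\<^esup> - 1 - i y\<close>, and the
  location becomes the mean per unit of time. Differentiation at 0 then gives the mean
  (\<open>infinitely_divisible_mean\<close>). For covariances, \<open>K(x + y) - K(x) - K(y) = (e\<^bsup>ix\<^esup> - 1) (e\<^bsup>iy\<^esup> - 1)\<close>
  shows that the covariance of \<open>e\<^bsup>iaU\<^esup>\<close> and \<open>e\<^bsup>iaV\<^esup>\<close> is \<open>\<phi>\<^sub>U \<phi>\<^sub>V (e\<^bsup>C\<^esup> - 1)\<close>, where \<open>C\<close> is \<open>t\<close> times the sum of
  the Gaussian cross term \<open>- a\<^sup>2 \<sigma>\<close> and of \<open>\<integral> (e\<^bsup>iau\<^esup> - 1) (e\<^bsup>iav\<^esup> - 1) d\<nu>\<close>; dividing by \<open>a\<^sup>2\<close> yields \<open>Cov(U, V)\<close>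
  (\<open>infinitely_divisible_covariance\<close>).

  The formulas presuppose that \<open>U\<close>, \<open>U\<^sup>2\<close> or \<open>U V\<close> is integrable, and this has to be derived from
  the Levy measure. For \<open>U\<^sup>2\<close> the second difference of the characteristic function and Fatou's lemma
  suffice. For \<open>U\<close> the function \<open>\<bar>y\<bar>\<close> is compared with the series \<open>\<Sum>j. 2\<^sup>j (1 - cos (y / 2\<^sup>j))\<close>,
  which is comparable to \<open>\<bar>y\<bar>\<close> for large \<open>y\<close> and bounded by a multiple of \<open>min \<bar>y\<bar> y\<^sup>2\<close>: the
  expectation of the series is a sum of values of the characteristic function, and these are controlled
  by the integral of the same series against \<open>\<nu>\<close>. For the product of \<open>U = (X \<odot> T)\<^sub>k(t)\<close> and
  \<open>V = T\<^sub>l(t)\<close> neither factor needs to be square integrable. Here \<open>V\<close> has the law of a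
  coordinate of the subordinator and is nonnegative, so \<open>V\<close> acts as a density: the derivative in \<open>b\<close> of
  \<open>E e\<^bsup>i(aU + bV)\<^esup>\<close> at \<open>b = 0\<close> expresses \<open>E (V e\<^bsup>iaU\<^esup>)\<close> through \<open>\<phi>\<^sub>U(a)\<close> and \<open>\<integral> v (e\<^bsup>iau\<^esup> - 1) d\<nu>\<close>, and
  the dyadic series in \<open>U\<close> can be summed under the weight \<open>V\<close>
  (\<open>infinitely_divisible_product_integrable\<close>).

  It remains to integrate against \<open>\<nu>\<close>. This measure is the sum of the image of \<open>d \<diamond> \<X>\<close> under
  \<open>x \<mapsto> (0, x)\<close> and of the image of \<open>\<T> \<otimes> P\<close> under \<open>(s, w) \<mapsto> (s, X(s)(w))\<close>; the latter makes sense because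
  right-continuity of the paths provides a jointly measurable version of \<open>X(s)\<close>
  (\<open>at_time_version\<close>). By Fubini, the truncated integrals in the location of \<open>Z\<close> and the integrals of
  the jumps outside the unit ball add up to the iterated integrals in the claim
  (\<open>split_iterated_integral\<close>).
\<close>

section \<open>The compensated exponential\<close>

text \<open>
  The integrand of a fully compensated Levy-Khintchine exponent.
\<close>

definition jump_kernel :: "real \<Rightarrow> complex" where
  "jump_kernel y = iexp y - 1 - \<i> * of_real y"

text \<open>
  The weight that decides whether jumps may be fully compensated: integrability of \<open>y\<^sup>2\<close> for small and
  of \<open>\<bar>y\<bar>\<close> for large jumps.
\<close>

definition mean_weight :: "real \<Rightarrow> real" where
  "mean_weight y = min \<bar>y\<bar> (y\<^sup>2)"

lemma mean_weight_nonneg [simp]: "0 \<le> mean_weight y"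
  by (simp add: mean_weight_def)

lemma jump_kernel_0 [simp]: "jump_kernel 0 = 0"
  by (simp add: jump_kernel_def)

lemma mean_weight_measurable [measurable]: "mean_weight \<in> borel_measurable borel"
  unfolding mean_weight_def by measurable

lemma jump_kernel_measurable [measurable]: "jump_kernel \<in> borel_measurable borel"
  unfolding jump_kernel_def by measurable

lemma Re_jump_kernel: "Re (jump_kernel y) = cos y - 1"
  by (simp add: jump_kernel_def Re_exp)

lemma norm_iexp_minus_1_le: "cmod (iexp y - 1) \<le> \<bar>y\<bar>"
  using iexp_approx1[of y 0] by simp

lemma norm_jump_kernel_le: "cmod (jump_kernel y) \<le> 2 * mean_weight y"
proof -
  have "cmod (jump_kernel y) \<le> y\<^sup>2 / 2"
    using iexp_approx1[of y 1] by (simp add: jump_kernel_def diff_diff_eq power2_eq_square)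
  moreover have "cmod (jump_kernel y) \<le> 2 * \<bar>y\<bar>"
    using iexp_approx2[of y 1] by (simp add: jump_kernel_def diff_diff_eq)
  moreover have "0 \<le> y\<^sup>2" by simp
  ultimately show ?thesis unfolding mean_weight_def by linarith
qed

lemma mean_weight_add: "mean_weight (x + y) \<le> 4 * (mean_weight x + mean_weight y)"
proof -
  have main: "mean_weight (x + y) \<le> 4 * mean_weight x" if "\<bar>y\<bar> \<le> \<bar>x\<bar>" for x y
  proof -
    have a: "\<bar>x + y\<bar> \<le> 2 * \<bar>x\<bar>" using that by linarith
    then have "\<bar>x + y\<bar>\<^sup>2 \<le> (2 * \<bar>x\<bar>)\<^sup>2" by (intro power_mono) auto
    then have b: "(x + y)\<^sup>2 \<le> 4 * x\<^sup>2" by (simp add: power_mult_distrib)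
    show ?thesis using a b unfolding mean_weight_def by linarith
  qed
  show ?thesis
    using main[of y x] main[of x y, folded add.commute[of x y]] mean_weight_nonneg[of x]
      mean_weight_nonneg[of y] by argo
qed

lemma mean_weight_mult: "mean_weight (a * y) \<le> (\<bar>a\<bar> + a\<^sup>2) * mean_weight y"
proof -
  have "\<bar>a\<bar> * \<bar>y\<bar> \<le> (\<bar>a\<bar> + a\<^sup>2) * \<bar>y\<bar>" "a\<^sup>2 * y\<^sup>2 \<le> (\<bar>a\<bar> + a\<^sup>2) * y\<^sup>2"
    by (auto intro!: mult_right_mono)
  then show ?thesis unfolding mean_weight_def
    by (auto simp: min_def abs_mult power_mult_distrib)
qed

lemma mean_weight_mult_le:
  assumes "0 \<le> a" "a \<le> 1"
  shows "mean_weight (a * y) \<le> a * mean_weight y"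
proof -
  have "a\<^sup>2 \<le> a" using assms by (simp add: power2_eq_square mult_left_le)
  then have "a\<^sup>2 * y\<^sup>2 \<le> a * y\<^sup>2" by (intro mult_right_mono) auto
  then show ?thesis using assms unfolding mean_weight_def
    by (auto simp: min_def abs_mult power_mult_distrib)
qed

definition mean_jump :: "'z measure \<Rightarrow> ('z \<Rightarrow> real) \<Rightarrow> bool" where
  "mean_jump \<nu> u \<longleftrightarrow> u \<in> borel_measurable \<nu> \<and> integrable \<nu> (\<lambda>z. mean_weight (u z))"

lemma mean_jump_lin:
  assumes "mean_jump \<nu> u" "mean_jump \<nu> v"
  shows "mean_jump \<nu> (\<lambda>z. a * u z + b * v z)"
  unfolding mean_jump_def
proof (intro conjI)
  have [measurable]: "u \<in> borel_measurable \<nu>" "v \<in> borel_measurable \<nu>"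
    using assms by (auto simp: mean_jump_def)
  show "(\<lambda>z. a * u z + b * v z) \<in> borel_measurable \<nu>" by measurable
  have "integrable \<nu> (\<lambda>z. 4 * ((\<bar>a\<bar> + a\<^sup>2) * mean_weight (u z) + (\<bar>b\<bar> + b\<^sup>2) * mean_weight (v z)))"
    using assms by (auto simp: mean_jump_def)
  then show "integrable \<nu> (\<lambda>z. mean_weight (a * u z + b * v z))"
  proof (rule Bochner_Integration.integrable_bound)
    show "AE z in \<nu>. norm (mean_weight (a * u z + b * v z)) \<le>
        norm (4 * ((\<bar>a\<bar> + a\<^sup>2) * mean_weight (u z) + (\<bar>b\<bar> + b\<^sup>2) * mean_weight (v z)))"
    proof (rule AE_I2)
      fix z
      show "norm (mean_weight (a * u z + b * v z)) \<le>
        norm (4 * ((\<bar>a\<bar> + a\<^sup>2) * mean_weight (u z) + (\<bar>b\<bar> + b\<^sup>2) * mean_weight (v z)))"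
        using mean_weight_add[of "a * u z" "b * v z"] mean_weight_mult[of a "u z"]
          mean_weight_mult[of b "v z"] by simp
    qed
  qed measurable
qed

lemma mean_jump_mult: "mean_jump \<nu> u \<Longrightarrow> mean_jump \<nu> (\<lambda>z. a * u z)"
  using mean_jump_lin[of \<nu> u u a 0] by simp

lemma integrable_jump_kernel:
  assumes "mean_jump \<nu> u"
  shows "integrable \<nu> (\<lambda>z. jump_kernel (u z))"
proof -
  have [measurable]: "u \<in> borel_measurable \<nu>" using assms by (auto simp: mean_jump_def)
  have "integrable \<nu> (\<lambda>z. 2 * mean_weight (u z))" using assms by (simp add: mean_jump_def)
  then show ?thesis
    by (rule Bochner_Integration.integrable_bound) (auto intro: order_trans[OF norm_jump_kernel_le])
qed

lemma integrable_cos_jump: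
  assumes "mean_jump \<nu> u"
  shows "integrable \<nu> (\<lambda>z. 1 - cos (u z))"
  using integrable_minus[OF integrable_Re[OF integrable_jump_kernel[OF assms]]]
  by (simp add: Re_jump_kernel)

text \<open>
  The Levy-Khintchine exponent, evaluated in one direction, of a law with mean \<open>b\<close>, Gaussian variance \<open>s\<close>
  and jumps \<open>u\<close> distributed according to \<open>\<nu>\<close>. For the direction \<open>a U + b V\<close> one takes the jumps
  \<open>a u + b v\<close>, so joint laws need no separate notion.
\<close>

definition centered_exponent :: "real \<Rightarrow> real \<Rightarrow> 'z measure \<Rightarrow> ('z \<Rightarrow> real) \<Rightarrow> complex" where
  "centered_exponent b s \<nu> u = \<i> * of_real b - of_real s / 2 + (LINT z|\<nu>. jump_kernel (u z))"

lemma Re_centered_exponent: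
  assumes "mean_jump \<nu> u"
  shows "Re (centered_exponent b s \<nu> u) = - s / 2 - (LINT z|\<nu>. 1 - cos (u z))"
proof -
  have "Re (LINT z|\<nu>. jump_kernel (u z)) = (LINT z|\<nu>. - (1 - cos (u z)))"
    by (subst integral_Re[OF integrable_jump_kernel[OF assms], symmetric]) (simp add: Re_jump_kernel)
  then show ?thesis by (simp only: Bochner_Integration.integral_minus) (simp add: centered_exponent_def)
qed

section \<open>Dyadic cosine sums and integrability\<close>

text \<open>
  A substitute for \<open>\<bar>y\<bar>\<close> that is a finite combination of cosines, so that its expectation is a finite
  combination of values of a characteristic function. It replaces the classical integral of
  \<open>(1 - cos (a y)) / a\<^sup>2\<close> over \<open>a\<close> by its sum over the points \<open>a = 1 / 2\<^sup>j\<close>.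
\<close>

definition dyadic :: "nat \<Rightarrow> real \<Rightarrow> real" where
  "dyadic n y = (\<Sum>j<n. 2 ^ j * (1 - cos (y / 2 ^ j)))"

lemma dyadic_measurable [measurable]: "dyadic n \<in> borel_measurable borel"
  unfolding dyadic_def by measurable

lemma dyadic_nonneg: "0 \<le> dyadic n y"
  unfolding dyadic_def by (intro sum_nonneg mult_nonneg_nonneg) auto

lemma dyadic_mono: "m \<le> n \<Longrightarrow> dyadic m y \<le> dyadic n y"
  unfolding dyadic_def by (intro sum_mono2) (auto intro!: mult_nonneg_nonneg)

lemma dyadic_Suc: "dyadic (Suc n) y = (1 - cos y) + 2 * dyadic n (y / 2)"
  unfolding dyadic_def by (subst sum.lessThan_Suc_shift)
    (simp add: sum_distrib_left mult.assoc del: sum.lessThan_Suc)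

lemma one_minus_cos_le: "1 - cos y \<le> y\<^sup>2 / 2" for y :: real
proof -
  have "1 - cos y = 2 * (sin (y / 2))\<^sup>2"
    using cos_double_sin[of "y / 2"] by simp
  also have "(sin (y / 2))\<^sup>2 \<le> (y / 2)\<^sup>2"
    using abs_sin_x_le_abs_x[of "y / 2"] by (simp only: abs_le_square_iff)
  finally show ?thesis by (simp add: power_divide)
qed

text \<open>
  Both bounds come from the scaling relation \<open>dyadic_Suc\<close>. The quadratic one is stable because
  \<open>y\<^sup>2 / 2 + 2 (y / 2)\<^sup>2 = y\<^sup>2\<close>. The linear one is stable in the form \<open>4 \<bar>y\<bar> - 2\<close>, where the constant
  absorbs \<open>1 - cos y \<le> 2\<close>; on \<open>1 \<le> \<bar>y\<bar> \<le> 2\<close> it follows from the quadratic one.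
\<close>

lemma dyadic_le:
  "dyadic n y \<le> 4 * mean_weight y"
proof -
  have sq: "dyadic n y \<le> y\<^sup>2" for n y
  proof (induction n arbitrary: y)
    case (Suc n)
    show ?case using Suc[of "y / 2"] one_minus_cos_le[of y] by (simp add: dyadic_Suc power_divide)
  qed (simp add: dyadic_def)
  have lin: "1 \<le> \<bar>y\<bar> \<Longrightarrow> dyadic n y \<le> 4 * \<bar>y\<bar> - 2" for y
  proof (induction n arbitrary: y)
    case (Suc n)
    show ?case
    proof (cases "2 \<le> \<bar>y\<bar>")
      case True
      then show ?thesis using Suc.IH[of "y / 2"] cos_ge_minus_one[of y] unfolding dyadic_Suc by linarith
    next
      case False
      have "(\<bar>y\<bar> - 1) * (\<bar>y\<bar> - 2) \<le> 0"
        using Suc.prems False by (intro mult_nonneg_nonpos) auto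
      then have "y\<^sup>2 - 3 * \<bar>y\<bar> + 2 \<le> 0" by (simp add: algebra_simps power2_eq_square)
      with sq[of "Suc n" y] Suc.prems show ?thesis by linarith
    qed
  qed (simp add: dyadic_def)
  show ?thesis
  proof (cases "1 \<le> \<bar>y\<bar>")
    case True
    then have "\<bar>y\<bar> * 1 \<le> \<bar>y\<bar> * \<bar>y\<bar>" by (intro mult_left_mono) auto
    then have "mean_weight y = \<bar>y\<bar>" by (simp add: mean_weight_def power2_eq_square)
    with lin[OF True] show ?thesis by simp
  next
    case False
    then have "\<bar>y\<bar> * \<bar>y\<bar> \<le> \<bar>y\<bar> * 1" by (intro mult_left_mono) auto
    then have "mean_weight y = y\<^sup>2" by (simp add: mean_weight_def power2_eq_square)
    with sq[of n y] zero_le_power2[of y] show ?thesis by linarith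
  qed
qed

lemma cos_one_lt_one: "cos 1 < (1::real)"
  using cos_monotone_0_pi[of 0 1] pi_gt3 by simp

text \<open>
  A single term suffices: choosing \<open>j\<close> with \<open>1 \<le> \<bar>y\<bar> / 2\<^sup>j \<le> 2\<close> makes the cosine in it at most \<open>cos 1\<close>.
\<close>

lemma dyadic_dominates_abs:
  obtains n where "\<bar>y\<bar> \<le> 1 + 2 / (1 - cos 1) * dyadic n y"
proof (cases "1 \<le> \<bar>y\<bar>")
  case False
  then show thesis using that[of 0] by (simp add: dyadic_def)
next
  case True
  obtain m :: nat where m: "\<bar>y\<bar> < 2 ^ m" using real_arch_pow[of 2 "\<bar>y\<bar>"] by auto
  define k where "k = (LEAST m. \<bar>y\<bar> < 2 ^ m)"
  have k: "\<bar>y\<bar> < 2 ^ k" unfolding k_def by (rule LeastI[of _ m]) (rule m)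
  with True have "k \<noteq> 0" by (auto intro: ccontr)
  then obtain j where j: "k = Suc j" using not0_implies_Suc by blast
  then have "\<not> \<bar>y\<bar> < 2 ^ j" using not_less_Least[of j "\<lambda>m. \<bar>y\<bar> < 2 ^ m"] by (simp add: k_def[symmetric])
  then have a: "1 \<le> \<bar>y\<bar> / 2 ^ j" "\<bar>y\<bar> / 2 ^ j \<le> 2" using k j by (auto simp: field_simps)
  have "cos (\<bar>y\<bar> / 2 ^ j) \<le> cos 1"
    using a pi_gt3 by (intro cos_monotone_0_pi_le) auto
  moreover have "cos (\<bar>y\<bar> / 2 ^ j) = cos (y / 2 ^ j)" by (cases "0 \<le> y") auto
  ultimately have "2 ^ j * (1 - cos 1) \<le> 2 ^ j * (1 - cos (y / 2 ^ j))" by simp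
  also have "\<dots> \<le> dyadic (Suc j) y" unfolding dyadic_def
    by (simp add: sum_nonneg)
  finally have "2 ^ j \<le> dyadic (Suc j) y / (1 - cos 1)"
    using cos_one_lt_one by (simp add: field_simps)
  moreover have "\<bar>y\<bar> \<le> 2 * 2 ^ j" using k j by simp
  ultimately have "\<bar>y\<bar> \<le> 1 + 2 / (1 - cos 1) * dyadic (Suc j) y" by simp
  then show thesis by (rule that)
qed

text \<open>
  Monotone convergence, with a nonnegative weight \<open>V\<close>: the weight 1 serves to prove that \<open>U\<close> has a mean,
  and a nonnegative coordinate \<open>V\<close> serves to prove that \<open>V U\<close> has one.
\<close>

lemma integrable_mult_from_dyadic:
  assumes V: "integrable M V" "AE w in M. 0 \<le> V w" and [measurable]: "U \<in> borel_measurable M"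
    and int: "\<And>n. integrable M (\<lambda>w. V w * dyadic n (U w))"
    and bd: "\<And>n. (LINT w|M. V w * dyadic n (U w)) \<le> B"
  shows "integrable M (\<lambda>w. V w * U w)"
proof -
  define c :: real where "c = 2 / (1 - cos 1)"
  have c: "0 \<le> c" using cos_one_lt_one by (simp add: c_def)
  have [measurable]: "V \<in> borel_measurable M" using V by auto
  have [measurable]: "(\<lambda>w. V w * dyadic n (U w)) \<in> borel_measurable M" for n by measurable
  let ?S = "\<lambda>w. (SUP n. ennreal (V w * dyadic n (U w)))"
  have S: "(\<integral>\<^sup>+w. ?S w \<partial>M) \<le> ennreal B"
  proof -
    have "(\<integral>\<^sup>+w. ?S w \<partial>M) = (SUP n. \<integral>\<^sup>+w. ennreal (V w * dyadic n (U w)) \<partial>M)"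
    proof (rule nn_integral_monotone_convergence_SUP_AE)
      show "AE w in M. ennreal (V w * dyadic n (U w)) \<le> ennreal (V w * dyadic (Suc n) (U w))" for n
        using V(2) by eventually_elim (auto intro!: ennreal_leI mult_left_mono dyadic_mono)
    qed measurable
    also have "\<dots> \<le> ennreal B"
    proof (rule SUP_least)
      fix n
      have "(\<integral>\<^sup>+w. ennreal (V w * dyadic n (U w)) \<partial>M) = ennreal (LINT w|M. V w * dyadic n (U w))"
        using V(2) by (intro nn_integral_eq_integral int) (auto intro!: mult_nonneg_nonneg dyadic_nonneg)
      also have "\<dots> \<le> ennreal B" by (intro ennreal_leI bd)
      finally show "(\<integral>\<^sup>+w. ennreal (V w * dyadic n (U w)) \<partial>M) \<le> ennreal B" .
    qed
    finally show ?thesis .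
  qed
  have pt: "AE w in M. ennreal (norm (V w * U w)) \<le> ennreal (V w) + ennreal c * ?S w"
    using V(2)
  proof eventually_elim
    fix w assume V0: "0 \<le> V w"
    obtain n where n: "\<bar>U w\<bar> \<le> 1 + c * dyadic n (U w)" by (rule dyadic_dominates_abs[of "U w", folded c_def])
    have "norm (V w * U w) \<le> V w * (1 + c * dyadic n (U w))"
      using V0 n by (auto simp: abs_mult intro!: mult_left_mono)
    then have "ennreal (norm (V w * U w)) \<le> ennreal (V w + c * (V w * dyadic n (U w)))"
      by (intro ennreal_leI) (simp add: algebra_simps)
    also have "\<dots> = ennreal (V w) + ennreal c * ennreal (V w * dyadic n (U w))"
      using V0 c dyadic_nonneg[of n "U w"] by (simp add: ennreal_plus ennreal_mult)
    also have "\<dots> \<le> ennreal (V w) + ennreal c * ?S w"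
      by (intro add_left_mono mult_left_mono SUP_upper) auto
    finally show "ennreal (norm (V w * U w)) \<le> ennreal (V w) + ennreal c * ?S w" .
  qed
  have "(\<integral>\<^sup>+w. ennreal (norm (V w * U w)) \<partial>M) \<le> (\<integral>\<^sup>+w. ennreal (V w) + ennreal c * ?S w \<partial>M)"
    by (rule nn_integral_mono_AE[OF pt])
  also have "\<dots> = (\<integral>\<^sup>+w. ennreal (V w) \<partial>M) + ennreal c * (\<integral>\<^sup>+w. ?S w \<partial>M)"
    by (simp add: nn_integral_add nn_integral_cmult)
  also have "\<dots> < \<infinity>"
    using integrableD(2)[OF V(1)] nn_integral_eq_integral[OF V] S
    by (auto simp: ennreal_mult_less_top less_top intro: le_less_trans)
  finally show ?thesis by (intro integrableI_bounded) auto
qed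

section \<open>Moments of infinitely divisible random variables\<close>

text \<open>
  The imaginary part is of first order in \<open>a\<close>, hence its square is harmless in dyadic sums.
\<close>

lemma Im_centered_exponent_le:
  assumes "mean_jump \<nu> u" "0 \<le> a" "a \<le> 1"
  shows "\<bar>Im (centered_exponent (a * b) s \<nu> (\<lambda>z. a * u z))\<bar> \<le> a * (\<bar>b\<bar> + 2 * (LINT z|\<nu>. mean_weight (u z)))"
proof -
  have "cmod (LINT z|\<nu>. jump_kernel (a * u z)) \<le> (LINT z|\<nu>. a * (2 * mean_weight (u z)))"
  proof (rule order_trans[OF integral_norm_bound integral_mono])
    show "integrable \<nu> (\<lambda>z. cmod (jump_kernel (a * u z)))"
      by (intro integrable_norm integrable_jump_kernel mean_jump_mult assms)
    show "integrable \<nu> (\<lambda>z. a * (2 * mean_weight (u z)))" using assms by (simp add: mean_jump_def)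
    fix z
    have "cmod (jump_kernel (a * u z)) \<le> 2 * mean_weight (a * u z)" by (rule norm_jump_kernel_le)
    also have "\<dots> \<le> a * (2 * mean_weight (u z))"
      using mean_weight_mult_le[OF assms(2,3), of "u z"] by simp
    finally show "cmod (jump_kernel (a * u z)) \<le> a * (2 * mean_weight (u z))" .
  qed
  then have "\<bar>Im (LINT z|\<nu>. jump_kernel (a * u z))\<bar> \<le> a * (2 * (LINT z|\<nu>. mean_weight (u z)))"
    using abs_Im_le_cmod order_trans by fastforce
  moreover have "\<bar>a * b\<bar> = a * \<bar>b\<bar>" using assms by (simp add: abs_mult)
  ultimately show ?thesis unfolding centered_exponent_def by (simp add: algebra_simps)
qed

lemma one_minus_Re_exp_le:
  assumes "Re z \<le> 0"
  shows "1 - Re (exp z) \<le> - Re z + (Im z)\<^sup>2 / 2"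
proof -
  have "1 - Re (exp z) = (1 - exp (Re z)) + exp (Re z) * (1 - cos (Im z))"
    by (simp add: Re_exp algebra_simps)
  also have "\<dots> \<le> - Re z + 1 * (Im z)\<^sup>2 / 2"
  proof (rule add_mono)
    show "1 - exp (Re z) \<le> - Re z" using exp_ge_add_one_self[of "Re z"] by linarith
    have "exp (Re z) * (1 - cos (Im z)) \<le> 1 * ((Im z)\<^sup>2 / 2)"
      using assms by (intro mult_mono one_minus_cos_le) auto
    then show "exp (Re z) * (1 - cos (Im z)) \<le> 1 * (Im z)\<^sup>2 / 2" by simp
  qed
  finally show ?thesis by simp
qed

lemma sum_dyadic_weights_le: "(\<Sum>j<n. 2 ^ j * (1 / 2 ^ j)\<^sup>2) \<le> (2::real)"
proof -
  have "(\<Sum>j<n. 2 ^ j * (1 / 2 ^ j)\<^sup>2) = (\<Sum>j<n. (1 / 2 :: real) ^ j)"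
    by (intro sum.cong refl) (simp add: power2_eq_square power_divide)
  also have "\<dots> \<le> 2" by (simp add: geometric_sum)
  finally show ?thesis .
qed

lemma dyadic_integral:
  assumes V: "integrable M V" and [measurable]: "U \<in> borel_measurable M"
  shows "integrable M (\<lambda>w. V w * (1 - cos (a * U w)))"
    and "integrable M (\<lambda>w. V w * dyadic n (U w))"
    and "(LINT w|M. V w * dyadic n (U w)) = (\<Sum>j<n. 2 ^ j * (LINT w|M. V w * (1 - cos (1 / 2 ^ j * U w))))"
proof -
  have [measurable]: "V \<in> borel_measurable M" using V by auto
  show i: "integrable M (\<lambda>w. V w * (1 - cos (a * U w)))" for a
  proof (rule Bochner_Integration.integrable_bound)
    show "integrable M (\<lambda>w. 2 * V w)" using V by simp
    show "AE w in M. norm (V w * (1 - cos (a * U w))) \<le> norm (2 * V w)"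
    proof (rule AE_I2)
      fix w
      have "\<bar>V w\<bar> * \<bar>1 - cos (a * U w)\<bar> \<le> \<bar>V w\<bar> * 2"
        using cos_ge_minus_one[of "a * U w"] cos_le_one[of "a * U w"] by (intro mult_left_mono) linarith+
      then show "norm (V w * (1 - cos (a * U w))) \<le> norm (2 * V w)" by (simp add: abs_mult mult.commute)
    qed
  qed measurable
  have eq: "(\<lambda>w. V w * dyadic n (U w)) = (\<lambda>w. \<Sum>j<n. 2 ^ j * (V w * (1 - cos (1 / 2 ^ j * U w))))"
    by (auto simp: dyadic_def sum_distrib_left algebra_simps intro!: ext sum.cong)
  show "integrable M (\<lambda>w. V w * dyadic n (U w))"
    unfolding eq using i[of "1 / 2 ^ _"] by (intro Bochner_Integration.integrable_sum) auto
  show "(LINT w|M. V w * dyadic n (U w)) = (\<Sum>j<n. 2 ^ j * (LINT w|M. V w * (1 - cos (1 / 2 ^ j * U w))))"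
    unfolding eq by (subst Bochner_Integration.integral_sum) (use i[of "1 / 2 ^ _"] in auto)
qed

text \<open>
  The derivative of \<open>exp\<close> at 0 along a sequence of exponents that vanishes to the order of \<open>a\<close>.
\<close>

lemma LIMSEQ_exp_minus_1_quotient:
  fixes X :: "nat \<Rightarrow> complex" and a :: "nat \<Rightarrow> complex"
  assumes X: "(\<lambda>n. X n / a n) \<longlonglongrightarrow> L" and a: "a \<longlonglongrightarrow> 0" "\<And>n. a n \<noteq> 0"
  shows "(\<lambda>n. (exp (X n) - 1) / a n) \<longlonglongrightarrow> L"
proof -
  define h where "h z = (if z = 0 then 1 else (exp z - 1) / z)" for z :: complex
  have "((\<lambda>z. (exp z - 1) / z) \<longlongrightarrow> 1) (at (0::complex))"
    using DERIV_exp[of "0::complex"] by (simp add: DERIV_def)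
  then have h: "isCont h 0"
    unfolding isCont_def h_def by (simp cong: Lim_cong_within)
  have "(\<lambda>n. X n / a n * a n) \<longlonglongrightarrow> L * 0" by (intro tendsto_mult X a)
  then have "X \<longlonglongrightarrow> 0" using a(2) by simp
  then have "(\<lambda>n. h (X n)) \<longlonglongrightarrow> h 0" by (rule isCont_tendsto_compose[OF h])
  then have "(\<lambda>n. h (X n) * (X n / a n)) \<longlonglongrightarrow> 1 * L" by (intro tendsto_mult X) (simp add: h_def)
  moreover have "h (X n) * (X n / a n) = (exp (X n) - 1) / a n" for n by (simp add: h_def)
  ultimately show ?thesis by (simp only: mult_1)
qed

text \<open>
  The points along which characteristic functions are differentiated at 0.
\<close>

definition step :: "nat \<Rightarrow> real" where
  "step n = inverse (real (Suc n))"

lemma step: "0 < step n" "step n \<le> 1" "step \<longlonglongrightarrow> 0" "step n \<noteq> 0"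
  using LIMSEQ_inverse_real_of_nat by (auto simp: step_def[abs_def] inverse_le_1_iff)

lemma step_complex: "(\<lambda>n. complex_of_real (step n)) \<longlonglongrightarrow> 0" "complex_of_real (step n) \<noteq> 0"
  using tendsto_of_real[OF step(3), where 'a=complex] step(4) by auto

lemma iexp_quotient_LIMSEQ: "(\<lambda>n. (iexp (step n * y) - 1) / step n) \<longlonglongrightarrow> \<i> * y"
  by (rule LIMSEQ_exp_minus_1_quotient[OF _ step_complex]) (use step(4) in simp)

lemma iexp_quotient_le: "cmod ((iexp (step n * y) - 1) / step n) \<le> \<bar>y\<bar>"
  using norm_iexp_minus_1_le[of "step n * y"] step(1)[of n]
  by (simp add: norm_divide abs_mult divide_le_eq mult.commute)

lemma (in prob_space) integrable_iexp_mult: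
  assumes [measurable]: "U \<in> borel_measurable M"
  shows "integrable M (\<lambda>w. iexp (a * U w))"
  by (rule integrable_iexp) auto

lemma (in prob_space) char_quotient_LIMSEQ:
  assumes "integrable M U"
  shows "(\<lambda>n. ((LINT w|M. iexp (step n * U w)) - 1) / step n) \<longlonglongrightarrow> \<i> * (LINT w|M. U w)"
proof -
  have [measurable]: "U \<in> borel_measurable M" using assms by auto
  have "(\<lambda>n. LINT w|M. (iexp (step n * U w) - 1) / step n) \<longlonglongrightarrow> (LINT w|M. \<i> * U w)"
  proof (rule integral_dominated_convergence[where w = "\<lambda>w. \<bar>U w\<bar>"])
    show "integrable M (\<lambda>w. \<bar>U w\<bar>)" using assms by simp
    show "AE w in M. (\<lambda>n. (iexp (step n * U w) - 1) / step n) \<longlonglongrightarrow> \<i> * U w"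
      by (intro AE_I2 iexp_quotient_LIMSEQ)
    show "AE w in M. cmod ((iexp (step n * U w) - 1) / step n) \<le> \<bar>U w\<bar>" for n
      by (intro AE_I2 iexp_quotient_le)
  qed measurable
  moreover have "(LINT w|M. (iexp (step n * U w) - 1) / step n) =
      ((LINT w|M. iexp (step n * U w)) - 1) / step n" for n
    using integrable_iexp_mult[of U "step n"]
    by (subst integral_divide_zero, subst Bochner_Integration.integral_diff) (auto simp: prob_space)
  ultimately show ?thesis
    by (simp only: integral_mult_right_zero integral_complex_of_real)
qed

lemma kernel_quotient_LIMSEQ:
  assumes "mean_jump \<nu> u"
  shows "(\<lambda>n. (LINT z|\<nu>. jump_kernel (step n * u z)) / step n) \<longlonglongrightarrow> 0"
proof -
  have [measurable]: "u \<in> borel_measurable \<nu>" using assms by (simp add: mean_jump_def)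
  have "(\<lambda>n. LINT z|\<nu>. jump_kernel (step n * u z) / step n) \<longlonglongrightarrow> (LINT z|\<nu>. 0)"
  proof (rule integral_dominated_convergence[where w = "\<lambda>z. 2 * mean_weight (u z)"])
    show "integrable \<nu> (\<lambda>z. 2 * mean_weight (u z))" using assms by (simp add: mean_jump_def)
    have "(\<lambda>n. jump_kernel (step n * y) / step n) \<longlonglongrightarrow> 0" for y
    proof -
      have "(\<lambda>n. (iexp (step n * y) - 1) / step n - \<i> * y) \<longlonglongrightarrow> \<i> * y - \<i> * y"
        by (intro tendsto_diff iexp_quotient_LIMSEQ tendsto_const)
      moreover have "(iexp (step n * y) - 1) / step n - \<i> * y = jump_kernel (step n * y) / step n" for n
        using step(4)[of n] by (simp add: jump_kernel_def field_simps)
      ultimately show ?thesis by simp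
    qed
    then show "AE z in \<nu>. (\<lambda>n. jump_kernel (step n * u z) / step n) \<longlonglongrightarrow> 0" by simp
    have "cmod (jump_kernel (step n * y) / step n) \<le> 2 * mean_weight y" for n y
    proof -
      have "cmod (jump_kernel (step n * y)) \<le> 2 * (step n * mean_weight y)"
        using norm_jump_kernel_le[of "step n * y"] mean_weight_mult_le[of "step n" y] step(1,2)[of n] by linarith
      then show ?thesis using step(1)[of n] by (simp add: norm_divide divide_le_eq mult_ac)
    qed
    then show "AE z in \<nu>. cmod (jump_kernel (step n * u z) / step n) \<le> 2 * mean_weight (u z)" for n
      by simp
  qed measurable
  then show ?thesis by (simp add: integral_divide_zero)
qed

text \<open>
  \<open>1 - Re (e\<^sup>z) \<le> - Re z + (Im z)\<^sup>2 / 2\<close> for \<open>Re z \<le> 0\<close>. The real part of the exponent is kept exactly, because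
  bounding the whole exponent by its modulus would cost a logarithm in the dyadic sum; the rest is
  of second order in \<open>a\<close>.
\<close>

lemma (in prob_space) one_minus_cos_bound:
  assumes [measurable]: "U \<in> borel_measurable M" and u: "mean_jump \<nu> u"
    and s: "0 \<le> \<sigma>" and t: "0 \<le> t" and a: "0 \<le> a" "a \<le> 1"
    and char: "(LINT w|M. iexp (a * U w)) =
        exp (of_real t * centered_exponent (a * \<beta>) (a\<^sup>2 * \<sigma>) \<nu> (\<lambda>z. a * u z))"
  shows "(LINT w|M. 1 - cos (a * U w)) \<le> t * (LINT z|\<nu>. 1 - cos (a * u z)) +
    a\<^sup>2 * (t * \<sigma> / 2 + (t * (\<bar>\<beta>\<bar> + 2 * (LINT z|\<nu>. mean_weight (u z))))\<^sup>2 / 2)"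
proof -
  define L where "L = \<bar>\<beta>\<bar> + 2 * (LINT z|\<nu>. mean_weight (u z))"
  define \<psi> where "\<psi> = centered_exponent (a * \<beta>) (a\<^sup>2 * \<sigma>) \<nu> (\<lambda>z. a * u z)"
  have mj: "mean_jump \<nu> (\<lambda>z. a * u z)" by (rule mean_jump_mult[OF u])
  have re: "Re \<psi> = - (a\<^sup>2 * \<sigma>) / 2 - (LINT z|\<nu>. 1 - cos (a * u z))"
    unfolding \<psi>_def by (rule Re_centered_exponent[OF mj])
  have nn: "0 \<le> (LINT z|\<nu>. 1 - cos (a * u z))" by (intro Bochner_Integration.integral_nonneg) simp
  have "0 \<le> a\<^sup>2 * \<sigma>" using s by simp
  then have re0: "Re \<psi> \<le> 0" using re nn by linarith
  have im: "\<bar>Im \<psi>\<bar> \<le> a * L" unfolding \<psi>_def L_def by (rule Im_centered_exponent_le[OF u a])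
  have "(LINT w|M. 1 - cos (a * U w)) = 1 - Re (LINT w|M. iexp (a * U w))"
  proof -
    have i: "integrable M (\<lambda>w. Re (iexp (a * U w)))"
      by (intro integrable_Re integrable_iexp_mult) auto
    have "Re (LINT w|M. iexp (a * U w)) = (LINT w|M. Re (iexp (a * U w)))"
      by (intro integral_Re[symmetric] integrable_iexp_mult) auto
    moreover have "(LINT w|M. 1 - Re (iexp (a * U w))) = (LINT w|M. 1) - (LINT w|M. Re (iexp (a * U w)))"
      by (rule Bochner_Integration.integral_diff[OF _ i]) simp
    ultimately show ?thesis by (simp add: Re_exp prob_space)
  qed
  also have "\<dots> = 1 - Re (exp (of_real t * \<psi>))" using char by (simp add: \<psi>_def)
  also have "\<dots> \<le> - Re (of_real t * \<psi>) + (Im (of_real t * \<psi>))\<^sup>2 / 2"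
    using re0 t by (intro one_minus_Re_exp_le) (simp add: mult_nonneg_nonpos)
  also have "(Im (of_real t * \<psi>))\<^sup>2 \<le> (t * (a * L))\<^sup>2"
  proof -
    have "\<bar>Im (of_real t * \<psi>)\<bar> \<le> t * (a * L)" using im t by (simp add: abs_mult mult_left_mono)
    then have "\<bar>Im (of_real t * \<psi>)\<bar>\<^sup>2 \<le> (t * (a * L))\<^sup>2" by (intro power_mono) auto
    then show ?thesis by simp
  qed
  also have "- Re (of_real t * \<psi>) + (t * (a * L))\<^sup>2 / 2 =
      t * (LINT z|\<nu>. 1 - cos (a * u z)) + a\<^sup>2 * (t * \<sigma> / 2 + (t * L)\<^sup>2 / 2)"
    by (simp add: re field_simps power2_eq_square)
  finally show ?thesis by (simp add: L_def)
qed

text \<open>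
  By \<open>one_minus_cos_bound\<close> the dyadic sums of \<open>U\<close> are bounded by those of the jumps plus a
  geometric series, so \<open>U\<close> is integrable; the value of the mean is the derivative at 0 of both sides
  of the hypothesis on the characteristic function.
\<close>

lemma (in prob_space) infinitely_divisible_mean:
  assumes [measurable]: "U \<in> borel_measurable M" and u: "mean_jump \<nu> u"
    and s: "0 \<le> \<sigma>" and t: "0 \<le> t"
    and char: "\<And>a. (LINT w|M. iexp (a * U w)) =
        exp (of_real t * centered_exponent (a * \<beta>) (a\<^sup>2 * \<sigma>) \<nu> (\<lambda>z. a * u z))"
  shows "integrable M U" "(LINT w|M. U w) = t * \<beta>"
proof -
  have [measurable]: "u \<in> borel_measurable \<nu>" using u by (simp add: mean_jump_def)
  define C where "C = t * \<sigma> / 2 + (t * (\<bar>\<beta>\<bar> + 2 * (LINT z|\<nu>. mean_weight (u z))))\<^sup>2 / 2"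
  have C: "0 \<le> C" using s t by (simp add: C_def)
  have int_u: "integrable \<nu> (\<lambda>z. 1 - cos (a * u z))" for a
    by (intro integrable_cos_jump mean_jump_mult u)
  have "integrable M (\<lambda>w. 1 * U w)"
  proof (rule integrable_mult_from_dyadic)
    show "integrable M (\<lambda>w. 1 * dyadic n (U w))" for n by (rule dyadic_integral) auto
    fix n
    have "(LINT w|M. 1 * dyadic n (U w)) = (\<Sum>j<n. 2 ^ j * (LINT w|M. 1 - cos (1 / 2 ^ j * U w)))"
      using dyadic_integral(3)[of M "\<lambda>_. 1" U n] by simp
    also have "\<dots> \<le> (\<Sum>j<n. 2 ^ j * (t * (LINT z|\<nu>. 1 - cos (1 / 2 ^ j * u z)) + (1 / 2 ^ j)\<^sup>2 * C))"
      unfolding C_def by (intro sum_mono mult_left_mono one_minus_cos_bound u s t char) auto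
    also have "\<dots> = t * (\<Sum>j<n. 2 ^ j * (LINT z|\<nu>. 1 - cos (1 / 2 ^ j * u z))) +
        C * (\<Sum>j<n. 2 ^ j * (1 / 2 ^ j)\<^sup>2)"
      by (simp add: sum_distrib_left sum.distrib algebra_simps)
    also have "(\<Sum>j<n. 2 ^ j * (LINT z|\<nu>. 1 - cos (1 / 2 ^ j * u z))) = (LINT z|\<nu>. dyadic n (u z))"
      unfolding dyadic_def by (subst Bochner_Integration.integral_sum) (use int_u[of "1 / 2 ^ _"] in auto)
    also have "t * (LINT z|\<nu>. dyadic n (u z)) \<le> t * (LINT z|\<nu>. 4 * mean_weight (u z))"
    proof (intro mult_left_mono integral_mono dyadic_le t)
      show "integrable \<nu> (\<lambda>z. dyadic n (u z))"
        unfolding dyadic_def using int_u[of "1 / 2 ^ _"] by (intro Bochner_Integration.integrable_sum) auto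
      show "integrable \<nu> (\<lambda>z. 4 * mean_weight (u z))" using u by (simp add: mean_jump_def)
    qed
    also have "C * (\<Sum>j<n. 2 ^ j * (1 / 2 ^ j)\<^sup>2) \<le> C * 2"
      by (intro mult_left_mono sum_dyadic_weights_le C)
    finally show "(LINT w|M. 1 * dyadic n (U w)) \<le> t * (LINT z|\<nu>. 4 * mean_weight (u z)) + C * 2"
      by simp
  qed auto
  then show U: "integrable M U" by simp
  have "(\<lambda>n. of_real t * (\<i> * of_real \<beta> - of_real (step n) * (of_real \<sigma> / 2) +
        (LINT z|\<nu>. jump_kernel (step n * u z)) / of_real (step n)))
      \<longlonglongrightarrow> of_real t * (\<i> * of_real \<beta> - 0 * (of_real \<sigma> / 2) + 0)"
    by (intro tendsto_mult tendsto_add tendsto_diff tendsto_const kernel_quotient_LIMSEQ u step_complex(1))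
  moreover have "of_real t * (\<i> * of_real \<beta> - of_real (step n) * (of_real \<sigma> / 2) +
        (LINT z|\<nu>. jump_kernel (step n * u z)) / of_real (step n)) =
     of_real t * centered_exponent (step n * \<beta>) ((step n)\<^sup>2 * \<sigma>) \<nu> (\<lambda>z. step n * u z) / step n" for n
    using step(4)[of n] by (simp add: centered_exponent_def field_simps power2_eq_square)
  ultimately have "(\<lambda>n. of_real t * centered_exponent (step n * \<beta>) ((step n)\<^sup>2 * \<sigma>) \<nu> (\<lambda>z. step n * u z) / step n)
      \<longlonglongrightarrow> t * (\<i> * \<beta>)" by simp
  from LIMSEQ_exp_minus_1_quotient[OF this step_complex]
  have "(\<lambda>n. ((LINT w|M. iexp (step n * U w)) - 1) / step n) \<longlonglongrightarrow> t * (\<i> * \<beta>)"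
    by (simp only: char)
  from LIMSEQ_unique[OF char_quotient_LIMSEQ[OF U] this]
  have "\<i> * of_real (LINT w|M. U w) = \<i> * of_real (t * \<beta>)" by simp
  then have "complex_of_real (LINT w|M. U w) = of_real (t * \<beta>)" by simp
  then show "(LINT w|M. U w) = t * \<beta>" by (simp only: of_real_eq_iff)
qed

lemma cos_quotient_LIMSEQ: "(\<lambda>n. 2 * (1 - cos (step n * y)) / (step n)\<^sup>2) \<longlonglongrightarrow> y\<^sup>2"
proof -
  have "(\<lambda>n. (cmod ((iexp (step n * y) - 1) / step n))\<^sup>2) \<longlonglongrightarrow> (cmod (\<i> * y))\<^sup>2"
    by (intro tendsto_power tendsto_norm iexp_quotient_LIMSEQ)
  moreover have "(cmod ((iexp (step n * y) - 1) / step n))\<^sup>2 = 2 * (1 - cos (step n * y)) / (step n)\<^sup>2" for n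
  proof -
    have "(cmod (iexp x - 1))\<^sup>2 = 2 * (1 - cos x)" for x
    proof -
      have "(cmod (iexp x - 1))\<^sup>2 = (cos x - 1)\<^sup>2 + (sin x)\<^sup>2"
        by (simp add: cmod_power2 Re_exp Im_exp)
      then show ?thesis using sin_cos_squared_add[of x] by (simp add: power2_diff)
    qed
    from this[of "step n * y"] show ?thesis by (simp add: norm_divide power_divide)
  qed
  ultimately show ?thesis by (simp add: norm_mult)
qed

text \<open>
  Fatou's lemma for \<open>2 (1 - cos (a U)) / a\<^sup>2 \<longlonglongrightarrow> U\<^sup>2\<close>, whose expectations stay bounded by
  \<open>one_minus_cos_bound\<close> because \<open>1 - cos (a u) \<le> a\<^sup>2 u\<^sup>2 / 2\<close>.
\<close>

lemma (in prob_space) infinitely_divisible_square_integrable: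
  assumes [measurable]: "U \<in> borel_measurable M" and u: "mean_jump \<nu> u"
    and s: "0 \<le> \<sigma>" and t: "0 \<le> t"
    and char: "\<And>a. (LINT w|M. iexp (a * U w)) =
        exp (of_real t * centered_exponent (a * \<beta>) (a\<^sup>2 * \<sigma>) \<nu> (\<lambda>z. a * u z))"
    and u2: "integrable \<nu> (\<lambda>z. (u z)\<^sup>2)"
  shows "integrable M (\<lambda>w. (U w)\<^sup>2)"
proof (rule integrableI_bounded)
  have [measurable]: "u \<in> borel_measurable \<nu>" using u by (simp add: mean_jump_def)
  define C where "C = t * \<sigma> / 2 + (t * (\<bar>\<beta>\<bar> + 2 * (LINT z|\<nu>. mean_weight (u z))))\<^sup>2 / 2"
  define B where "B = t * (LINT z|\<nu>. (u z)\<^sup>2) + 2 * C"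
  let ?f = "\<lambda>n w. 2 * (1 - cos (step n * U w)) / (step n)\<^sup>2"
  have nn: "0 \<le> ?f n w" for n w by (intro divide_nonneg_nonneg) auto
  have "(\<integral>\<^sup>+w. ennreal (?f n w) \<partial>M) \<le> ennreal B" for n
  proof -
    have "(LINT z|\<nu>. 1 - cos (step n * u z)) \<le> (LINT z|\<nu>. (step n)\<^sup>2 / 2 * (u z)\<^sup>2)"
    proof (rule integral_mono)
      show "integrable \<nu> (\<lambda>z. 1 - cos (step n * u z))" by (intro integrable_cos_jump mean_jump_mult u)
      show "integrable \<nu> (\<lambda>z. (step n)\<^sup>2 / 2 * (u z)\<^sup>2)" using u2 by simp
      show "1 - cos (step n * u z) \<le> (step n)\<^sup>2 / 2 * (u z)\<^sup>2" for z
        using one_minus_cos_le[of "step n * u z"] by (simp add: power_mult_distrib)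
    qed
    also have "\<dots> = (step n)\<^sup>2 / 2 * (LINT z|\<nu>. (u z)\<^sup>2)" by (rule integral_mult_right_zero)
    finally have "t * (LINT z|\<nu>. 1 - cos (step n * u z)) \<le> t * ((step n)\<^sup>2 / 2 * (LINT z|\<nu>. (u z)\<^sup>2))"
      by (intro mult_left_mono t)
    moreover have "(LINT w|M. 1 - cos (step n * U w)) \<le> t * (LINT z|\<nu>. 1 - cos (step n * u z)) + (step n)\<^sup>2 * C"
      unfolding C_def using step(1,2)[of n] by (intro one_minus_cos_bound u s t char) auto
    ultimately have "(LINT w|M. 1 - cos (step n * U w)) \<le> (step n)\<^sup>2 / 2 * B"
      by (simp add: B_def algebra_simps)
    then have "2 / (step n)\<^sup>2 * (LINT w|M. 1 - cos (step n * U w)) \<le> 2 / (step n)\<^sup>2 * ((step n)\<^sup>2 / 2 * B)"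
      by (intro mult_left_mono) auto
    then have le: "2 / (step n)\<^sup>2 * (LINT w|M. 1 - cos (step n * U w)) \<le> B"
      using step(4)[of n] by simp
    have i: "integrable M (\<lambda>w. 1 - cos (step n * U w))"
      using dyadic_integral(1)[of M "\<lambda>_. 1" U "step n"] by simp
    have "(\<integral>\<^sup>+w. ennreal (?f n w) \<partial>M) = ennreal (LINT w|M. ?f n w)"
      by (intro nn_integral_eq_integral integrable_divide_zero integrable_mult_right i AE_I2 nn)
    also have "?f n = (\<lambda>w. 2 / (step n)\<^sup>2 * (1 - cos (step n * U w)))" by (simp add: fun_eq_iff)
    also have "(LINT w|M. \<dots> w) = 2 / (step n)\<^sup>2 * (LINT w|M. 1 - cos (step n * U w))"
      by (rule integral_mult_right_zero)
    finally show ?thesis using le by (simp add: ennreal_leI)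
  qed
  note bd = this
  have "(\<integral>\<^sup>+w. ennreal (norm ((U w)\<^sup>2)) \<partial>M) = (\<integral>\<^sup>+w. liminf (\<lambda>n. ennreal (?f n w)) \<partial>M)"
  proof (rule nn_integral_cong)
    fix w
    have "(\<lambda>n. ennreal (?f n w)) \<longlonglongrightarrow> ennreal ((U w)\<^sup>2)"
      by (intro tendsto_ennrealI cos_quotient_LIMSEQ)
    from lim_imp_Liminf[OF _ this]
    show "ennreal (norm ((U w)\<^sup>2)) = liminf (\<lambda>n. ennreal (?f n w))" by simp
  qed
  also have "\<dots> \<le> liminf (\<lambda>n. \<integral>\<^sup>+w. ennreal (?f n w) \<partial>M)"
    by (rule nn_integral_liminf) measurable
  also have "\<dots> \<le> liminf (\<lambda>n. ennreal B)" by (intro Liminf_mono always_eventually allI bd)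
  also have "\<dots> < \<infinity>" by (simp add: Liminf_const)
  finally show "(\<integral>\<^sup>+w. ennreal (norm ((U w)\<^sup>2)) \<partial>M) < \<infinity>" .
qed measurable

lemma jump_kernel_add: "jump_kernel (x + y) - jump_kernel x = iexp x * jump_kernel y + \<i> * y * (iexp x - 1)"
  by (simp add: jump_kernel_def exp_add algebra_simps)

text \<open>
  Integrated against the Levy measure, this is the part of the exponent through which the jumps couple
  two coordinates.
\<close>

lemma jump_kernel_add_product: "jump_kernel (x + y) - jump_kernel x - jump_kernel y = (iexp x - 1) * (iexp y - 1)"
  by (simp add: jump_kernel_def exp_add algebra_simps)

lemma norm_iexp_product_le: "cmod ((iexp (step n * x) - 1) / step n * ((iexp (step n * y) - 1) / step n)) \<le> \<bar>x * y\<bar>"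
  unfolding norm_mult abs_mult by (intro mult_mono iexp_quotient_le) auto

lemma iexp_product_LIMSEQ:
  "(\<lambda>n. (iexp (step n * x) - 1) / step n * ((iexp (step n * y) - 1) / step n)) \<longlonglongrightarrow> - of_real (x * y)"
proof -
  have "(\<lambda>n. (iexp (step n * x) - 1) / step n * ((iexp (step n * y) - 1) / step n)) \<longlonglongrightarrow> (\<i> * x) * (\<i> * y)"
    by (intro tendsto_mult iexp_quotient_LIMSEQ)
  moreover have "(\<i> * x) * (\<i> * y) = - of_real (x * y)" by (simp add: complex_eq_iff)
  ultimately show ?thesis by (simp only:)
qed

lemma integral_iexp_product_LIMSEQ:
  assumes [measurable]: "f \<in> borel_measurable M" "g \<in> borel_measurable M"
    and fg: "integrable M (\<lambda>w. f w * g w)"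
  shows "(\<lambda>n. (LINT w|M. (iexp (step n * f w) - 1) * (iexp (step n * g w) - 1)) / (of_real (step n))\<^sup>2)
    \<longlonglongrightarrow> - of_real (LINT w|M. f w * g w)"
proof -
  have "(\<lambda>n. LINT w|M. (iexp (step n * f w) - 1) / step n * ((iexp (step n * g w) - 1) / step n))
      \<longlonglongrightarrow> (LINT w|M. - of_real (f w * g w))"
  proof (rule integral_dominated_convergence[where w = "\<lambda>w. \<bar>f w * g w\<bar>"])
    show "integrable M (\<lambda>w. \<bar>f w * g w\<bar>)" using fg by (rule integrable_abs)
  qed (auto intro: iexp_product_LIMSEQ norm_iexp_product_le simp del: of_real_mult times_divide_eq_right times_divide_eq_left)
  moreover have "(LINT w|M. - of_real (f w * g w)) = - complex_of_real (LINT w|M. f w * g w)"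
    by (subst Bochner_Integration.integral_minus, subst integral_complex_of_real) simp
  moreover have "(LINT w|M. (iexp (step n * f w) - 1) / step n * ((iexp (step n * g w) - 1) / step n)) =
     (LINT w|M. (iexp (step n * f w) - 1) * (iexp (step n * g w) - 1)) / (of_real (step n))\<^sup>2" for n
    by (subst integral_divide_zero[symmetric]) (simp add: power2_eq_square)
  ultimately show ?thesis by (simp only:)
qed

text \<open>
  The hypothesis is integrability of \<open>U V\<close> rather than of the squares, since a nonnegative \<open>V\<close> may have no
  second moment when \<open>U V\<close> has a mean. The comparison is between two expansions of the covariance of
  \<open>e\<^bsup>iaU\<^esup>\<close> and \<open>e\<^bsup>iaV\<^esup>\<close> for small \<open>a\<close>: dominated convergence on the one hand, the exponent on the other.
\<close>

lemma (in prob_space) infinitely_divisible_covariance: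
  assumes U: "integrable M U" and V: "integrable M V" and UV: "integrable M (\<lambda>w. U w * V w)"
    and u: "mean_jump \<nu> u" and v: "mean_jump \<nu> v" and uv: "integrable \<nu> (\<lambda>z. u z * v z)"
    and char: "\<And>a b. (LINT w|M. iexp (a * U w + b * V w)) =
        exp (of_real t * centered_exponent (a * \<beta> + b * \<gamma>)
          (a\<^sup>2 * s11 + 2 * a * b * s12 + b\<^sup>2 * s22) \<nu> (\<lambda>z. a * u z + b * v z))"
  shows "(LINT w|M. U w * V w) - (LINT w|M. U w) * (LINT w|M. V w) = t * (s12 + (LINT z|\<nu>. u z * v z))"
proof -
  have [measurable]: "U \<in> borel_measurable M" "V \<in> borel_measurable M" using U V by auto
  have [measurable]: "u \<in> borel_measurable \<nu>" "v \<in> borel_measurable \<nu>"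
    using u v by (auto simp: mean_jump_def)
  let ?h = "\<lambda>n. complex_of_real (step n)"
  let ?fU = "\<lambda>n. LINT w|M. iexp (step n * U w)" and ?fV = "\<lambda>n. LINT w|M. iexp (step n * V w)"
  let ?fUV = "\<lambda>n. LINT w|M. iexp (step n * U w + step n * V w)"
  let ?I = "\<lambda>n. LINT z|\<nu>. (iexp (step n * u z) - 1) * (iexp (step n * v z) - 1)"
  have iU: "integrable M (\<lambda>w. iexp (a * U w))" and iV: "integrable M (\<lambda>w. iexp (a * V w))"
    and iUV: "integrable M (\<lambda>w. iexp (a * U w + a * V w))" for a
    by (intro integrable_iexp; measurable)+

  \<comment> \<open>The covariance of the two exponentials is \<open>\<phi>\<^sub>U \<phi>\<^sub>V (e\<^sup>C - 1)\<close>, where \<open>C\<close> is the mixed part of the exponent.\<close>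
  have factor: "?fUV n = ?fU n * ?fV n * exp (of_real t * (- (of_real (step n))\<^sup>2 * of_real s12 + ?I n))" for n
  proof -
    let ?a = "step n"
    have k: "integrable \<nu> (\<lambda>z. jump_kernel (?a * u z))" "integrable \<nu> (\<lambda>z. jump_kernel (?a * v z))"
      "integrable \<nu> (\<lambda>z. jump_kernel (?a * u z + ?a * v z))"
      by (intro integrable_jump_kernel mean_jump_mult mean_jump_lin u v)+
    have "?I n = (LINT z|\<nu>. jump_kernel (?a * u z + ?a * v z) - jump_kernel (?a * u z) - jump_kernel (?a * v z))"
      by (simp only: jump_kernel_add_product)
    also have "\<dots> = (LINT z|\<nu>. jump_kernel (?a * u z + ?a * v z)) - (LINT z|\<nu>. jump_kernel (?a * u z)) -
        (LINT z|\<nu>. jump_kernel (?a * v z))"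
      using k by simp
    finally have I: "(LINT z|\<nu>. jump_kernel (?a * u z + ?a * v z)) =
        (LINT z|\<nu>. jump_kernel (?a * u z)) + (LINT z|\<nu>. jump_kernel (?a * v z)) + ?I n" by simp
    define Ku Kv J where "Ku = (LINT z|\<nu>. jump_kernel (?a * u z))"
      and "Kv = (LINT z|\<nu>. jump_kernel (?a * v z))" and "J = ?I n"
    have fU: "?fU n = exp (of_real t * (\<i> * of_real (?a * \<beta>) - of_real (?a\<^sup>2 * s11) / 2 + Ku))"
      using char[of ?a 0] by (simp add: centered_exponent_def Ku_def)
    have fV: "?fV n = exp (of_real t * (\<i> * of_real (?a * \<gamma>) - of_real (?a\<^sup>2 * s22) / 2 + Kv))"
      using char[of 0 ?a] by (simp add: centered_exponent_def Kv_def)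
    have fUV: "?fUV n = exp (of_real t * (\<i> * of_real (?a * \<beta> + ?a * \<gamma>) -
        of_real (?a\<^sup>2 * s11 + 2 * ?a * ?a * s12 + ?a\<^sup>2 * s22) / 2 + (Ku + Kv + J)))"
      unfolding Ku_def Kv_def J_def I[symmetric]
      by (rule char[of ?a ?a, unfolded centered_exponent_def])
    show ?thesis unfolding fU fV fUV J_def[symmetric] exp_add[symmetric]
      by (rule arg_cong[where f = exp]) (simp add: field_simps power2_eq_square)
  qed
  have "(\<lambda>n. of_real t * (- of_real s12 + ?I n / (?h n)\<^sup>2)) \<longlonglongrightarrow>
      of_real t * (- of_real s12 + - of_real (LINT z|\<nu>. u z * v z))"
    by (intro tendsto_mult tendsto_add tendsto_const integral_iexp_product_LIMSEQ uv) measurable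
  moreover have "of_real t * (- of_real s12 + ?I n / (?h n)\<^sup>2) =
      of_real t * (- (of_real (step n))\<^sup>2 * of_real s12 + ?I n) / (?h n)\<^sup>2" for n
    using step(4)[of n] by (simp add: field_simps)
  ultimately have "(\<lambda>n. of_real t * (- (of_real (step n))\<^sup>2 * of_real s12 + ?I n) / (?h n)\<^sup>2) \<longlonglongrightarrow>
      of_real t * (- of_real s12 + - of_real (LINT z|\<nu>. u z * v z))" by simp
  then have e: "(\<lambda>n. (exp (of_real t * (- (of_real (step n))\<^sup>2 * of_real s12 + ?I n)) - 1) / (?h n)\<^sup>2) \<longlonglongrightarrow>
      of_real t * (- of_real s12 + - of_real (LINT z|\<nu>. u z * v z))"
  proof (rule LIMSEQ_exp_minus_1_quotient)
    show "(\<lambda>n. (?h n)\<^sup>2) \<longlonglongrightarrow> 0" using tendsto_power[OF step_complex(1), of 2] by simp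
    show "(?h n)\<^sup>2 \<noteq> 0" for n using step_complex(2)[of n] by simp
  qed
  have qU: "(\<lambda>n. (?fU n - 1) / ?h n) \<longlonglongrightarrow> \<i> * (LINT w|M. U w)"
    and qV: "(\<lambda>n. (?fV n - 1) / ?h n) \<longlonglongrightarrow> \<i> * (LINT w|M. V w)"
    by (intro char_quotient_LIMSEQ U V)+
  have one: "f \<longlonglongrightarrow> 1" if "(\<lambda>n. (f n - 1) / ?h n) \<longlonglongrightarrow> L" for f L
  proof -
    have "(\<lambda>n. (f n - 1) / ?h n * ?h n + 1) \<longlonglongrightarrow> L * 0 + 1"
      by (intro tendsto_intros that step_complex(1))
    then show ?thesis using step_complex(2) by simp
  qed
  have R: "(\<lambda>n. ?fU n * ?fV n * ((exp (of_real t * (- (of_real (step n))\<^sup>2 * of_real s12 + ?I n)) - 1) / (?h n)\<^sup>2))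
      \<longlonglongrightarrow> 1 * 1 * (of_real t * (- of_real s12 + - of_real (LINT z|\<nu>. u z * v z)))"
    by (intro tendsto_mult e one[OF qU] one[OF qV])
  have L: "(\<lambda>n. (LINT w|M. (iexp (step n * U w) - 1) * (iexp (step n * V w) - 1)) / (?h n)\<^sup>2 -
      (?fU n - 1) / ?h n * ((?fV n - 1) / ?h n))
    \<longlonglongrightarrow> - of_real (LINT w|M. U w * V w) - (\<i> * (LINT w|M. U w)) * (\<i> * (LINT w|M. V w))"
    by (intro tendsto_diff tendsto_mult qU qV integral_iexp_product_LIMSEQ UV) measurable
  have "(LINT w|M. (iexp (step n * U w) - 1) * (iexp (step n * V w) - 1)) / (?h n)\<^sup>2 -
      (?fU n - 1) / ?h n * ((?fV n - 1) / ?h n) =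
      ?fU n * ?fV n * ((exp (of_real t * (- (of_real (step n))\<^sup>2 * of_real s12 + ?I n)) - 1) / (?h n)\<^sup>2)" for n
  proof -
    have "(LINT w|M. (iexp (step n * U w) - 1) * (iexp (step n * V w) - 1)) =
        (LINT w|M. iexp (step n * U w + step n * V w) - iexp (step n * U w) - iexp (step n * V w) + 1)"
      by (intro Bochner_Integration.integral_cong refl) (simp add: exp_add algebra_simps)
    also have "\<dots> = ?fUV n - ?fU n - ?fV n + 1"
      using iU[of "step n"] iV[of "step n"] iUV[of "step n"] by (simp add: prob_space)
    finally have p: "(LINT w|M. (iexp (step n * U w) - 1) * (iexp (step n * V w) - 1)) =
      ?fU n * ?fV n * exp (of_real t * (- (of_real (step n))\<^sup>2 * of_real s12 + ?I n)) - ?fU n - ?fV n + 1"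
      by (simp only: factor)
    have "(x * y * e - x - y + 1) / h\<^sup>2 - (x - 1) / h * ((y - 1) / h) = x * y * ((e - 1) / h\<^sup>2)"
      if "h \<noteq> 0" for x y e h :: complex
      using that by (simp add: field_simps power2_eq_square)
    then show ?thesis unfolding p using step_complex(2) by blast
  qed
  then have "- of_real (LINT w|M. U w * V w) - (\<i> * (LINT w|M. U w)) * (\<i> * (LINT w|M. V w)) =
      1 * 1 * (of_real t * (- of_real s12 + - of_real (LINT z|\<nu>. u z * v z)))"
    using LIMSEQ_unique[OF L] R by simp
  then have "Re (- of_real (LINT w|M. U w * V w) - (\<i> * (LINT w|M. U w)) * (\<i> * (LINT w|M. V w))) =
      Re (1 * 1 * (of_real t * (- of_real s12 + - of_real (LINT z|\<nu>. u z * v z))))" by (rule arg_cong)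
  then show ?thesis by (simp add: algebra_simps)
qed

text \<open>
  The derivative of the joint characteristic function in \<open>b\<close> at \<open>b = 0\<close>. If \<open>V \<ge> 0\<close>, the left side is, up to
  normalization, the characteristic function of \<open>U\<close> under the law with density \<open>V\<close>. No Gaussian cross term
  is present in the exponent, as is automatic for a nonnegative \<open>V\<close>.
\<close>

lemma (in prob_space) infinitely_divisible_size_bias:
  assumes [measurable]: "U \<in> borel_measurable M" and V: "integrable M V"
    and u: "mean_jump \<nu> u" and v: "mean_jump \<nu> v" and uv: "integrable \<nu> (\<lambda>z. u z * v z)"
    and char: "\<And>a b. (LINT w|M. iexp (a * U w + b * V w)) =
        exp (of_real t * centered_exponent (a * \<beta> + b * \<gamma>) (a\<^sup>2 * s11 + b\<^sup>2 * s22) \<nu> (\<lambda>z. a * u z + b * v z))"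
  shows "(LINT w|M. iexp (a * U w) * of_real (V w)) =
    (LINT w|M. iexp (a * U w)) * (of_real t * (of_real \<gamma> + (LINT z|\<nu>. of_real (v z) * (iexp (a * u z) - 1))))"
proof -
  have [measurable]: "V \<in> borel_measurable M" using V by auto
  have [measurable]: "u \<in> borel_measurable \<nu>" "v \<in> borel_measurable \<nu>"
    using u v by (auto simp: mean_jump_def)
  let ?h = "\<lambda>n. complex_of_real (step n)"
  let ?D = "\<lambda>n. LINT z|\<nu>. jump_kernel (a * u z + step n * v z) - jump_kernel (a * u z)"
  let ?E = "\<lambda>n. of_real t * (\<i> * of_real (step n * \<gamma>) - of_real ((step n)\<^sup>2 * s22) / 2 + ?D n)"
  let ?F = "LINT z|\<nu>. \<i> * of_real (v z) * (iexp (a * u z) - 1)"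
  have iU: "integrable M (\<lambda>w. iexp (a * U w))" and iUV: "integrable M (\<lambda>w. iexp (a * U w + b * V w))" for b
    by (intro integrable_iexp; measurable)+
  have factor: "(LINT w|M. iexp (a * U w + step n * V w)) = (LINT w|M. iexp (a * U w)) * exp (?E n)" for n
  proof -
    have k: "integrable \<nu> (\<lambda>z. jump_kernel (a * u z))" "integrable \<nu> (\<lambda>z. jump_kernel (a * u z + step n * v z))"
      by (intro integrable_jump_kernel mean_jump_mult mean_jump_lin u v)+
    have D: "(LINT z|\<nu>. jump_kernel (a * u z + step n * v z)) = (LINT z|\<nu>. jump_kernel (a * u z)) + ?D n"
      using k by simp
    define K J where "K = (LINT z|\<nu>. jump_kernel (a * u z))" and "J = ?D n"
    have f0: "(LINT w|M. iexp (a * U w)) = exp (of_real t * (\<i> * of_real (a * \<beta>) - of_real (a\<^sup>2 * s11) / 2 + K))"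
      using char[of a 0] by (simp add: centered_exponent_def K_def)
    have f1: "(LINT w|M. iexp (a * U w + step n * V w)) = exp (of_real t * (\<i> * of_real (a * \<beta> + step n * \<gamma>) -
        of_real (a\<^sup>2 * s11 + (step n)\<^sup>2 * s22) / 2 + (K + J)))"
      unfolding K_def J_def D[symmetric]
      by (rule char[of a "step n", unfolded centered_exponent_def])
    show ?thesis unfolding f0 f1 J_def[symmetric] exp_add[symmetric]
      by (rule arg_cong[where f = exp]) (simp add: field_simps power2_eq_square)
  qed
  have D: "(\<lambda>n. ?D n / ?h n) \<longlonglongrightarrow> ?F"
  proof -
    have "(\<lambda>n. LINT z|\<nu>. (jump_kernel (a * u z + step n * v z) - jump_kernel (a * u z)) / ?h n) \<longlonglongrightarrow> ?F"
    proof (rule integral_dominated_convergence[where w = "\<lambda>z. 2 * mean_weight (v z) + \<bar>a\<bar> * \<bar>u z * v z\<bar>"])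
      show "integrable \<nu> (\<lambda>z. 2 * mean_weight (v z) + \<bar>a\<bar> * \<bar>u z * v z\<bar>)"
        using v uv by (auto simp: mean_jump_def)
      have eq: "(jump_kernel (x + step n * y) - jump_kernel x) / ?h n =
          iexp x * (jump_kernel (step n * y) / ?h n) + \<i> * of_real y * (iexp x - 1)" for x y n
        using step_complex(2)[of n] by (simp add: jump_kernel_add field_simps)
      have "(\<lambda>n. iexp x * ((iexp (step n * y) - 1) / ?h n - \<i> * of_real y) + \<i> * of_real y * (iexp x - 1))
          \<longlonglongrightarrow> iexp x * (\<i> * of_real y - \<i> * of_real y) + \<i> * of_real y * (iexp x - 1)" for x y
        by (intro tendsto_add tendsto_mult tendsto_diff tendsto_const iexp_quotient_LIMSEQ)
      moreover have "(iexp (step n * y) - 1) / ?h n - \<i> * of_real y = jump_kernel (step n * y) / ?h n" for y n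
        using step_complex(2)[of n] by (simp add: jump_kernel_def field_simps)
      ultimately have "(\<lambda>n. (jump_kernel (x + step n * y) - jump_kernel x) / ?h n)
          \<longlonglongrightarrow> \<i> * of_real y * (iexp x - 1)" for x y
        unfolding eq by simp
      then show "AE z in \<nu>. (\<lambda>n. (jump_kernel (a * u z + step n * v z) - jump_kernel (a * u z)) / ?h n)
          \<longlonglongrightarrow> \<i> * of_real (v z) * (iexp (a * u z) - 1)"
        by (intro AE_I2)
      have "cmod ((jump_kernel (x + step n * y) - jump_kernel x) / ?h n) \<le> 2 * mean_weight y + \<bar>y\<bar> * \<bar>x\<bar>" for x y n
      proof -
        have "cmod (jump_kernel (step n * y)) \<le> 2 * (step n * mean_weight y)"
          using norm_jump_kernel_le[of "step n * y"] mean_weight_mult_le[of "step n" y] step(1,2)[of n] by linarith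
        then have "cmod (jump_kernel (step n * y) / ?h n) \<le> 2 * mean_weight y"
          using step(1)[of n] by (simp add: norm_divide divide_le_eq mult_ac)
        moreover have "cmod (\<i> * of_real y * (iexp x - 1)) \<le> \<bar>y\<bar> * \<bar>x\<bar>"
          using norm_iexp_minus_1_le[of x] by (simp add: norm_mult mult_left_mono)
        moreover have "cmod (iexp x * (jump_kernel (step n * y) / ?h n)) = cmod (jump_kernel (step n * y) / ?h n)"
          by (simp only: norm_mult norm_exp_i_times mult_1)
        ultimately show ?thesis unfolding eq by (intro norm_triangle_le) linarith
      qed
      from this[of "a * u _" _ "v _"]
      show "AE z in \<nu>. cmod ((jump_kernel (a * u z + step n * v z) - jump_kernel (a * u z)) / ?h n)
          \<le> 2 * mean_weight (v z) + \<bar>a\<bar> * \<bar>u z * v z\<bar>" for n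
        by (intro AE_I2) (simp add: abs_mult mult_ac)
    qed measurable
    then show ?thesis by (simp only: integral_divide_zero)
  qed
  have "(\<lambda>n. of_real t * (\<i> * of_real \<gamma> - ?h n * (of_real s22 / 2) + ?D n / ?h n)) \<longlonglongrightarrow>
      of_real t * (\<i> * of_real \<gamma> - 0 * (of_real s22 / 2) + ?F)"
    by (intro tendsto_mult tendsto_add tendsto_diff tendsto_const D step_complex(1))
  moreover have "of_real t * (\<i> * of_real \<gamma> - ?h n * (of_real s22 / 2) + ?D n / ?h n) = ?E n / ?h n" for n
  proof -
    have "of_real t * (\<i> * of_real \<gamma> - h * (of_real s22 / 2) + J / h) =
      of_real t * (\<i> * (h * of_real \<gamma>) - h\<^sup>2 * of_real s22 / 2 + J) / h" if "h \<noteq> 0" for h J :: complex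
      using that by (simp add: field_simps power2_eq_square)
    from this[OF step_complex(2)[of n]] show ?thesis by simp
  qed
  ultimately have "(\<lambda>n. ?E n / ?h n) \<longlonglongrightarrow> of_real t * (\<i> * of_real \<gamma> + ?F)" by simp
  from LIMSEQ_exp_minus_1_quotient[OF this step_complex]
  have R: "(\<lambda>n. (LINT w|M. iexp (a * U w)) * ((exp (?E n) - 1) / ?h n)) \<longlonglongrightarrow>
      (LINT w|M. iexp (a * U w)) * (of_real t * (\<i> * of_real \<gamma> + ?F))"
    by (intro tendsto_mult tendsto_const)
  have L: "(\<lambda>n. LINT w|M. iexp (a * U w) * ((iexp (step n * V w) - 1) / ?h n)) \<longlonglongrightarrow>
      (LINT w|M. iexp (a * U w) * (\<i> * of_real (V w)))"
  proof (rule integral_dominated_convergence[where w = "\<lambda>w. \<bar>V w\<bar>"])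
    show "integrable M (\<lambda>w. \<bar>V w\<bar>)" using V by simp
    show "AE w in M. (\<lambda>n. iexp (a * U w) * ((iexp (step n * V w) - 1) / ?h n)) \<longlonglongrightarrow>
        iexp (a * U w) * (\<i> * of_real (V w))"
      by (intro AE_I2 tendsto_mult tendsto_const iexp_quotient_LIMSEQ)
    show "AE w in M. cmod (iexp (a * U w) * ((iexp (step n * V w) - 1) / ?h n)) \<le> \<bar>V w\<bar>" for n
      using iexp_quotient_le[of n "V _"] by (intro AE_I2) (simp only: norm_mult norm_exp_i_times mult_1)
  qed measurable
  have "(LINT w|M. iexp (a * U w) * ((iexp (step n * V w) - 1) / ?h n)) =
      (LINT w|M. iexp (a * U w)) * ((exp (?E n) - 1) / ?h n)" for n
  proof -
    have "(LINT w|M. iexp (a * U w) * ((iexp (step n * V w) - 1) / ?h n)) =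
        (LINT w|M. (iexp (a * U w + step n * V w) - iexp (a * U w)) / ?h n)"
      by (intro Bochner_Integration.integral_cong refl) (simp add: exp_add algebra_simps)
    also have "\<dots> = ((LINT w|M. iexp (a * U w + step n * V w)) - (LINT w|M. iexp (a * U w))) / ?h n"
      using iU iUV[of "step n"] by (subst integral_divide_zero) simp
    finally show ?thesis unfolding factor by (simp add: algebra_simps)
  qed
  note eq = this
  have "(LINT w|M. iexp (a * U w) * (\<i> * of_real (V w))) =
      (LINT w|M. iexp (a * U w)) * (of_real t * (\<i> * of_real \<gamma> + ?F))"
    by (rule LIMSEQ_unique[OF L[unfolded eq] R])
  moreover have "(LINT w|M. iexp (a * U w) * (\<i> * of_real (V w))) = \<i> * (LINT w|M. iexp (a * U w) * of_real (V w))"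
    by (subst integral_mult_right_zero[symmetric]) (simp add: mult_ac)
  moreover have "?F = \<i> * (LINT z|\<nu>. of_real (v z) * (iexp (a * u z) - 1))"
    by (subst integral_mult_right_zero[symmetric]) (simp only: mult.assoc)
  ultimately have "\<i> * (LINT w|M. iexp (a * U w) * of_real (V w)) = \<i> * ((LINT w|M. iexp (a * U w)) *
      (of_real t * (of_real \<gamma> + (LINT z|\<nu>. of_real (v z) * (iexp (a * u z) - 1)))))"
    by (simp add: algebra_simps)
  then show ?thesis by simp
qed

text \<open>
  With \<open>m = E V\<close> and \<open>G = \<integral> v (e\<^bsup>iau\<^esup> - 1) d\<nu>\<close>, size biasing gives
  \<open>E (V (1 - cos (a U))) = m (1 - Re \<phi>) - t Re \<phi> Re G + t Im \<phi> Im G\<close>. The dyadic sum of the first term is bounded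
  by a multiple of \<open>E \<bar>U\<bar>\<close>, that of the second by a multiple of \<open>\<integral> \<bar>u v\<bar> d\<nu>\<close>, and the third is of second order in
  \<open>a\<close> because \<open>\<bar>Im \<phi>\<bar> \<le> a E \<bar>U\<bar>\<close> and \<open>\<bar>Im G\<bar> \<le> a \<integral> \<bar>u v\<bar> d\<nu>\<close>.
\<close>

lemma (in prob_space) infinitely_divisible_product_integrable:
  assumes U: "integrable M U" and V: "integrable M V" "AE w in M. 0 \<le> V w"
    and u: "mean_jump \<nu> u" and v: "mean_jump \<nu> v" and uv: "integrable \<nu> (\<lambda>z. u z * v z)" and t: "0 \<le> t"
    and char: "\<And>a b. (LINT w|M. iexp (a * U w + b * V w)) =
        exp (of_real t * centered_exponent (a * \<beta> + b * \<gamma>) (a\<^sup>2 * s11 + b\<^sup>2 * s22) \<nu> (\<lambda>z. a * u z + b * v z))"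
  shows "integrable M (\<lambda>w. V w * U w)"
proof -
  have [measurable]: "U \<in> borel_measurable M" "V \<in> borel_measurable M" using U V by auto
  have [measurable]: "u \<in> borel_measurable \<nu>" "v \<in> borel_measurable \<nu>"
    using u v by (auto simp: mean_jump_def)
  define m where "m = (LINT w|M. V w)"
  define EU where "EU = (LINT w|M. \<bar>U w\<bar>)"
  define W where "W = (LINT z|\<nu>. \<bar>u z * v z\<bar>)"
  have m0: "0 \<le> m" unfolding m_def using V(2) by (rule integral_nonneg_AE)
  have EU0: "0 \<le> EU" unfolding EU_def by simp
  have W0: "0 \<le> W" unfolding W_def by simp
  have tg: "of_real m = complex_of_real (t * \<gamma>)"
    using infinitely_divisible_size_bias[OF _ V(1) u v uv char, of 0] by (simp add: m_def prob_space)
  \<comment> \<open>The last term contributes a convergent series, since \<open>\<Sum>j. 2\<^sup>j (1 / 2\<^sup>j)\<^sup>2 = 2\<close>.\<close>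
  have bound: "(LINT w|M. V w * (1 - cos (a * U w))) \<le> m * (LINT w|M. 1 - cos (a * U w)) +
      t * (LINT z|\<nu>. \<bar>v z\<bar> * (1 - cos (a * u z))) + t * EU * W * a\<^sup>2" if a: "0 \<le> a" for a
  proof -
    define \<phi> where "\<phi> = (LINT w|M. iexp (a * U w))"
    define G where "G = (LINT z|\<nu>. of_real (v z) * (iexp (a * u z) - 1))"
    have iU: "integrable M (\<lambda>w. iexp (a * U w))" by (intro integrable_iexp; measurable)
    have ic: "integrable M (\<lambda>w. cos (a * U w))" using integrable_Re[OF iU] by (simp add: Re_exp)
    have isn: "integrable M (\<lambda>w. sin (a * U w))" using integrable_Im[OF iU] by (simp add: Im_exp)
    have iG: "integrable \<nu> (\<lambda>z. of_real (v z) * (iexp (a * u z) - 1))"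
    proof (rule Bochner_Integration.integrable_bound)
      show "integrable \<nu> (\<lambda>z. a * (u z * v z))" using uv by simp
      have "cmod (of_real y * (iexp (a * x) - 1)) \<le> norm (a * (x * y))" for x y
        using norm_iexp_minus_1_le[of "a * x"] mult_left_mono[of _ _ "\<bar>y\<bar>"]
        by (fastforce simp: norm_mult abs_mult mult_ac)
      then show "AE z in \<nu>. cmod (of_real (v z) * (iexp (a * u z) - 1)) \<le> norm (a * (u z * v z))"
        by (intro AE_I2)
    qed measurable
    have Re\<phi>: "Re \<phi> = (LINT w|M. cos (a * U w))"
      unfolding \<phi>_def by (subst integral_Re[OF iU, symmetric]) (simp add: Re_exp)
    have Im\<phi>: "Im \<phi> = (LINT w|M. sin (a * U w))"
      unfolding \<phi>_def by (subst integral_Im[OF iU, symmetric]) (simp add: Im_exp)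
    have ReG: "Re G = - (LINT z|\<nu>. v z * (1 - cos (a * u z)))"
    proof -
      have "Re G = (LINT z|\<nu>. - (v z * (1 - cos (a * u z))))"
        unfolding G_def by (subst integral_Re[OF iG, symmetric]) (simp add: Re_exp algebra_simps)
      then show ?thesis by (simp only: Bochner_Integration.integral_minus)
    qed
    have "\<bar>Re \<phi>\<bar> \<le> 1"
    proof -
      have "cmod \<phi> \<le> (LINT w|M. cmod (iexp (a * U w)))" unfolding \<phi>_def by (rule integral_norm_bound)
      then show ?thesis using abs_Re_le_cmod[of \<phi>] by (simp add: prob_space)
    qed
    have iv: "integrable \<nu> (\<lambda>z. \<bar>v z\<bar> * (1 - cos (a * u z)))"
      using integrable_abs[OF integrable_Re[OF iG]]
      by (rule Bochner_Integration.integrable_bound) (auto simp: abs_mult Re_exp abs_minus_commute)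
    have G1: "- (Re \<phi> * Re G) \<le> (LINT z|\<nu>. \<bar>v z\<bar> * (1 - cos (a * u z)))"
    proof -
      have "\<bar>Re G\<bar> \<le> (LINT z|\<nu>. \<bar>v z * (1 - cos (a * u z))\<bar>)"
        unfolding ReG abs_minus_cancel by (rule integral_abs_bound)
      also have "\<dots> = (LINT z|\<nu>. \<bar>v z\<bar> * (1 - cos (a * u z)))" by (simp add: abs_mult)
      finally have "\<bar>Re \<phi>\<bar> * \<bar>Re G\<bar> \<le> 1 * (LINT z|\<nu>. \<bar>v z\<bar> * (1 - cos (a * u z)))"
        using \<open>\<bar>Re \<phi>\<bar> \<le> 1\<close> by (intro mult_mono) auto
      then show ?thesis unfolding abs_mult[symmetric] by linarith
    qed
    have "\<bar>Im \<phi>\<bar> \<le> a * EU"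
    proof -
      have "\<bar>Im \<phi>\<bar> \<le> (LINT w|M. \<bar>sin (a * U w)\<bar>)" unfolding Im\<phi> by (rule integral_abs_bound)
      also have "\<dots> \<le> (LINT w|M. a * \<bar>U w\<bar>)"
        using U isn a by (intro integral_mono) (auto simp: abs_mult intro: order_trans[OF abs_sin_x_le_abs_x])
      finally show ?thesis by (simp add: EU_def)
    qed
    moreover have "\<bar>Im G\<bar> \<le> a * W"
    proof -
      have "\<bar>Im G\<bar> \<le> cmod G" by (rule abs_Im_le_cmod)
      also have "\<dots> \<le> (LINT z|\<nu>. cmod (of_real (v z) * (iexp (a * u z) - 1)))"
        unfolding G_def by (rule integral_norm_bound)
      also have "\<dots> \<le> (LINT z|\<nu>. a * \<bar>u z * v z\<bar>)"
      proof (rule integral_mono)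
        show "integrable \<nu> (\<lambda>z. cmod (of_real (v z) * (iexp (a * u z) - 1)))" by (rule integrable_norm[OF iG])
        show "integrable \<nu> (\<lambda>z. a * \<bar>u z * v z\<bar>)" using uv by simp
        show "cmod (of_real (v z) * (iexp (a * u z) - 1)) \<le> a * \<bar>u z * v z\<bar>" for z
          using mult_left_mono[OF norm_iexp_minus_1_le[of "a * u z"], of "\<bar>v z\<bar>"] a
          by (simp add: norm_mult abs_mult mult_ac)
      qed
      finally show ?thesis by (simp add: W_def)
    qed
    ultimately have "\<bar>Im \<phi> * Im G\<bar> \<le> (a * EU) * (a * W)"
      unfolding abs_mult using a EU0 by (intro mult_mono) auto
    then have G2: "Im \<phi> * Im G \<le> EU * W * a\<^sup>2" by (simp add: power2_eq_square mult_ac)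
    have iVc: "integrable M (\<lambda>w. iexp (a * U w) * of_real (V w))"
      using V(1) by (rule Bochner_Integration.integrable_bound) (auto simp: norm_mult)
    have ivc: "integrable M (\<lambda>w. V w * cos (a * U w))"
      using integrable_Re[OF iVc] by (simp add: Re_exp mult_ac)
    have "(LINT w|M. V w * (1 - cos (a * U w))) = m - (LINT w|M. V w * cos (a * U w))"
      using V(1) ivc by (simp add: m_def right_diff_distrib)
    also have "(LINT w|M. V w * cos (a * U w)) = Re (LINT w|M. iexp (a * U w) * of_real (V w))"
      by (subst integral_Re[OF iVc, symmetric]) (simp add: Re_exp mult_ac)
    also have "(LINT w|M. iexp (a * U w) * of_real (V w)) = \<phi> * (of_real m + of_real t * G)"
      using infinitely_divisible_size_bias[OF _ V(1) u v uv char, of a]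
      by (simp add: \<phi>_def G_def tg algebra_simps)
    also have "m - Re (\<phi> * (of_real m + of_real t * G)) =
        m * (1 - Re \<phi>) + t * (- (Re \<phi> * Re G)) + t * (Im \<phi> * Im G)"
      by (simp add: algebra_simps)
    also have "\<dots> \<le> m * (1 - Re \<phi>) + t * (LINT z|\<nu>. \<bar>v z\<bar> * (1 - cos (a * u z))) + t * (EU * W * a\<^sup>2)"
      by (intro add_mono mult_left_mono G1 G2 t order_refl)
    also have "1 - Re \<phi> = (LINT w|M. 1 - cos (a * U w))"
      using ic by (simp add: Re\<phi> prob_space)
    finally show ?thesis by (simp add: mult_ac)
  qed
  have iv: "integrable \<nu> (\<lambda>z. \<bar>v z\<bar> * (1 - cos (a * u z)))" for a
  proof (rule Bochner_Integration.integrable_bound)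
    show "integrable \<nu> (\<lambda>z. \<bar>a\<bar> * (u z * v z))" using uv by simp
    have c: "1 - cos x \<le> \<bar>x\<bar>" for x :: real
      using abs_Re_le_cmod[of "iexp x - 1"] norm_iexp_minus_1_le[of x] by (simp add: Re_exp)
    show "AE z in \<nu>. norm (\<bar>v z\<bar> * (1 - cos (a * u z))) \<le> norm (\<bar>a\<bar> * (u z * v z))"
      using mult_left_mono[OF c[of "a * u _"], of "\<bar>v _\<bar>"] by (intro AE_I2) (simp add: abs_mult mult_ac)
  qed measurable
  show ?thesis
  proof (rule integrable_mult_from_dyadic[OF V])
    show "integrable M (\<lambda>w. V w * dyadic n (U w))" for n by (rule dyadic_integral(2)[OF V(1)]) measurable
    fix n
    have "(LINT w|M. V w * dyadic n (U w)) = (\<Sum>j<n. 2 ^ j * (LINT w|M. V w * (1 - cos (1 / 2 ^ j * U w))))"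
      by (rule dyadic_integral(3)[OF V(1)]) measurable
    also have "\<dots> \<le> (\<Sum>j<n. 2 ^ j * (m * (LINT w|M. 1 - cos (1 / 2 ^ j * U w)) +
        t * (LINT z|\<nu>. \<bar>v z\<bar> * (1 - cos (1 / 2 ^ j * u z))) + t * EU * W * (1 / 2 ^ j)\<^sup>2))"
      by (intro sum_mono mult_left_mono bound) auto
    also have "\<dots> = m * (\<Sum>j<n. 2 ^ j * (LINT w|M. 1 - cos (1 / 2 ^ j * U w))) +
        t * (\<Sum>j<n. 2 ^ j * (LINT z|\<nu>. \<bar>v z\<bar> * (1 - cos (1 / 2 ^ j * u z)))) +
        t * EU * W * (\<Sum>j<n. 2 ^ j * (1 / 2 ^ j)\<^sup>2)"
      unfolding sum_distrib_left sum.distrib[symmetric] by (intro sum.cong refl) (simp add: algebra_simps)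
    also have "(\<Sum>j<n. 2 ^ j * (LINT w|M. 1 - cos (1 / 2 ^ j * U w))) = (LINT w|M. dyadic n (U w))"
      using dyadic_integral(3)[of M "\<lambda>_. 1" U n] by simp
    also have "(\<Sum>j<n. 2 ^ j * (LINT z|\<nu>. \<bar>v z\<bar> * (1 - cos (1 / 2 ^ j * u z)))) =
        (LINT z|\<nu>. \<bar>v z\<bar> * dyadic n (u z))"
    proof -
      have "(LINT z|\<nu>. \<bar>v z\<bar> * dyadic n (u z)) =
          (LINT z|\<nu>. (\<Sum>j<n. 2 ^ j * (\<bar>v z\<bar> * (1 - cos (1 / 2 ^ j * u z)))))"
        by (simp add: dyadic_def sum_distrib_left mult_ac)
      also have "\<dots> = (\<Sum>j<n. 2 ^ j * (LINT z|\<nu>. \<bar>v z\<bar> * (1 - cos (1 / 2 ^ j * u z))))"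
        by (subst Bochner_Integration.integral_sum) (use iv[of "1 / 2 ^ _"] in auto)
      finally show ?thesis by simp
    qed
    also have "m * (LINT w|M. dyadic n (U w)) \<le> m * (LINT w|M. 4 * \<bar>U w\<bar>)"
    proof (intro mult_left_mono m0 integral_mono)
      show "integrable M (\<lambda>w. dyadic n (U w))" using dyadic_integral(2)[of M "\<lambda>_. 1" U n] by simp
      show "integrable M (\<lambda>w. 4 * \<bar>U w\<bar>)" using U by simp
      show "dyadic n (U w) \<le> 4 * \<bar>U w\<bar>" for w using dyadic_le[of n "U w"] by (simp add: mean_weight_def)
    qed
    also have "t * (LINT z|\<nu>. \<bar>v z\<bar> * dyadic n (u z)) \<le> t * (LINT z|\<nu>. 4 * \<bar>u z * v z\<bar>)"
    proof (intro mult_left_mono t integral_mono)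
      show "integrable \<nu> (\<lambda>z. 4 * \<bar>u z * v z\<bar>)" using uv by simp
      show le: "\<bar>v z\<bar> * dyadic n (u z) \<le> 4 * \<bar>u z * v z\<bar>" for z
        using mult_left_mono[OF dyadic_le[of n "u z"], of "\<bar>v z\<bar>"]
          mult_left_mono[of "mean_weight (u z)" "\<bar>u z\<bar>" "\<bar>v z\<bar>"]
        by (simp add: mean_weight_def abs_mult mult_ac)
      show "integrable \<nu> (\<lambda>z. \<bar>v z\<bar> * dyadic n (u z))"
      proof (rule Bochner_Integration.integrable_bound)
        show "integrable \<nu> (\<lambda>z. 4 * (u z * v z))" using uv by simp
        show "AE z in \<nu>. norm (\<bar>v z\<bar> * dyadic n (u z)) \<le> norm (4 * (u z * v z))"
          using le dyadic_nonneg[of n] by (intro AE_I2) (simp add: abs_mult)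
      qed measurable
    qed
    also have "t * EU * W * (\<Sum>j<n. 2 ^ j * (1 / 2 ^ j)\<^sup>2) \<le> t * EU * W * 2"
      using t EU0 W0 by (intro mult_left_mono sum_dyadic_weights_le) auto
    finally show "(LINT w|M. V w * dyadic n (U w)) \<le>
        m * (LINT w|M. 4 * \<bar>U w\<bar>) + t * (LINT z|\<nu>. 4 * \<bar>u z * v z\<bar>) + t * EU * W * 2" by simp
  qed measurable
qed

section \<open>Measurability and integration of vectors and matrices\<close>

lemma vec_eq_sum_axis: "x = (\<Sum>k\<in>UNIV. axis k (x $ k))" for x :: "'b::real_normed_vector ^ 'n::finite"
  by (simp add: vec_eq_iff axis_def if_distrib cong: if_cong)

lemma bounded_linear_axis: "bounded_linear (axis k :: 'b::euclidean_space \<Rightarrow> 'b ^ 'n::finite)"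
  by (intro linear_conv_bounded_linear[THEN iffD1] linearI) (auto simp: vec_eq_iff axis_def)

lemma borel_measurable_vec_nth [measurable (raw)]:
  fixes f :: "'a \<Rightarrow> 'b::euclidean_space ^ 'n::finite"
  shows "f \<in> borel_measurable M \<Longrightarrow> (\<lambda>w. f w $ k) \<in> borel_measurable M"
  by (rule borel_measurable_continuous_on[OF _ , of "\<lambda>x. x $ k"])
    (auto intro!: linear_continuous_on bounded_linear_vec_nth)

lemma borel_measurable_vecI:
  fixes f :: "'a \<Rightarrow> 'b::euclidean_space ^ 'n::finite"
  assumes "\<And>k. (\<lambda>w. f w $ k) \<in> borel_measurable M"
  shows "f \<in> borel_measurable M"
proof -
  have "(\<lambda>w. \<Sum>k\<in>UNIV. axis k (f w $ k)) \<in> borel_measurable M"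
    by (intro borel_measurable_sum borel_measurable_continuous_on[OF _ assms]
        linear_continuous_on bounded_linear_axis)
  then show ?thesis using vec_eq_sum_axis[of "f _"] by simp
qed

lemma integrable_vec_iff:
  fixes f :: "'a \<Rightarrow> 'b::euclidean_space ^ 'n::finite"
  shows "integrable M f \<longleftrightarrow> (\<forall>k. integrable M (\<lambda>w. f w $ k))"
proof
  assume "\<forall>k. integrable M (\<lambda>w. f w $ k)"
  then have "integrable M (\<lambda>w. \<Sum>k\<in>UNIV. axis k (f w $ k))"
    by (intro Bochner_Integration.integrable_sum integrable_bounded_linear[OF bounded_linear_axis]) auto
  then show "integrable M f" using vec_eq_sum_axis[of "f _"] by simp
qed (auto intro: integrable_bounded_linear[OF bounded_linear_vec_nth])

lemma integral_vec_nth: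
  fixes f :: "'a \<Rightarrow> 'b::euclidean_space ^ 'n::finite"
  shows "integrable M f \<Longrightarrow> (LINT w|M. f w) $ k = (LINT w|M. f w $ k)"
  by (rule integral_bounded_linear[OF bounded_linear_vec_nth, symmetric])

lemma joinv_nth [simp]: "joinv x y $ Inl k = x $ k" "joinv x y $ Inr k = y $ k"
  by (simp_all add: joinv_def)

lemma fstv_nth [simp]: "fstv z $ k = z $ Inl k"
  by (simp add: fstv_def)

lemma sndv_nth [simp]: "sndv z $ k = z $ Inr k"
  by (simp add: sndv_def)

lemma outer_nth [simp]: "outer x y $ k $ l = x $ k * y $ l"
  by (simp add: outer_def)

lemma joinv_measurable [measurable (raw)]:
  assumes [measurable]: "f \<in> borel_measurable M" "g \<in> borel_measurable M"
  shows "(\<lambda>w. joinv (f w) (g w)) \<in> borel_measurable M"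
proof (rule borel_measurable_vecI)
  fix i :: "'b + 'b"
  show "(\<lambda>w. joinv (f w) (g w) $ i) \<in> borel_measurable M" by (cases i) simp_all
qed

lemma outer_measurable [measurable (raw)]:
  assumes [measurable]: "f \<in> borel_measurable M" "g \<in> borel_measurable M"
  shows "(\<lambda>w. outer (f w) (g w)) \<in> borel_measurable M"
  by (intro borel_measurable_vecI) simp

lemma at_time_measurable:
  assumes "levy_process M X" "s \<in> orthant"
  shows "at_time X s \<in> borel_measurable M"
proof (rule borel_measurable_vecI)
  fix k
  have "X (s $ k) \<in> borel_measurable M" using assms by (auto simp: levy_process_def orthant_def)
  then show "(\<lambda>w. at_time X s w $ k) \<in> borel_measurable M" by (simp add: at_time_def)
qed

section \<open>A jointly measurable version of the process in multivariate time\<close>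

text \<open>
  On the event of right-continuity, \<open>X\<^sub>k(s\<^sub>k)\<close> is the limit of its values at the dyadic times just above
  \<open>s\<^sub>k\<close>. Each approximation is jointly measurable, since the dyadic time takes countably many values.
\<close>

lemma at_time_version:
  fixes X :: "real \<Rightarrow> 'a \<Rightarrow> real ^ 'n::finite"
  assumes X: "levy_process M X"
  obtains Y :: "real ^ 'n \<Rightarrow> 'a \<Rightarrow> real ^ 'n"
  where "(\<lambda>(s, w). Y s w) \<in> borel_measurable (borel \<Otimes>\<^sub>M M)"
    and "\<And>s. s \<in> orthant \<Longrightarrow> AE w in M. Y s w = at_time X s w"
proof -
  have "AE w in M. \<forall>s\<ge>0. ((\<lambda>r. X r w) \<longlongrightarrow> X s w) (at_right s)"
    using X unfolding levy_process_def by (auto elim: eventually_mono)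
  then obtain E where E: "E \<in> null_sets M"
    and rc: "\<And>w s. w \<in> space M - E \<Longrightarrow> 0 \<le> s \<Longrightarrow> ((\<lambda>r. X r w) \<longlongrightarrow> X s w) (at_right s)"
    by (auto elim!: AE_E3)
  have [measurable]: "E \<in> sets M" using E by auto
  have X_meas: "X r \<in> borel_measurable M" if "0 \<le> r" for r
    using X that by (auto simp: levy_process_def)
  \<comment> \<open>Adding 1 makes the dyadic point exceed \<open>r\<close> strictly, as a limit from the right requires;
    negative \<open>r\<close> are treated as 0.\<close>
  define Q where "Q j r = real (nat \<lfloor>2 ^ j * r\<rfloor> + 1) / 2 ^ j" for j :: nat and r :: real
  have Q: "max r 0 < Q j r" "Q j r \<le> max r 0 + 1 / 2 ^ j" for j r
  proof -
    have "2 ^ j * max r 0 < real (nat \<lfloor>2 ^ j * r\<rfloor> + 1)"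
    proof (cases "0 \<le> r")
      case True
      then show ?thesis by (simp add: of_nat_nat) linarith
    qed simp
    from divide_strict_right_mono[OF this, of "2 ^ j"] show "max r 0 < Q j r"
      by (simp add: Q_def del: of_nat_add)
    have "real (nat \<lfloor>2 ^ j * r\<rfloor> + 1) \<le> 2 ^ j * max r 0 + 1"
    proof (cases "0 \<le> r")
      case False
      then have "2 ^ j * r \<le> 0" by (simp add: mult_nonneg_nonpos)
      then have "\<lfloor>2 ^ j * r\<rfloor> \<le> 0" by linarith
      then show ?thesis by simp
    qed (simp add: of_nat_nat)
    then show "Q j r \<le> max r 0 + 1 / 2 ^ j" by (simp add: Q_def field_simps)
  qed
  have Q_lim: "filterlim (\<lambda>j. Q j r) (at_right (max r 0)) sequentially" for r
    unfolding filterlim_at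
  proof (intro conjI always_eventually allI)
    show "Q j r \<in> {max r 0<..}" "Q j r \<noteq> max r 0" for j using Q(1)[of r j] by auto
    have "(\<lambda>j. max r 0 + (1 / 2) ^ j) \<longlonglongrightarrow> max r 0 + 0"
      by (intro tendsto_intros LIMSEQ_power_zero) simp
    then have "(\<lambda>j. max r 0 + 1 / 2 ^ j) \<longlonglongrightarrow> max r 0" by (simp add: power_one_over)
    then show "(\<lambda>j. Q j r) \<longlonglongrightarrow> max r 0"
      by (rule tendsto_sandwich[OF _ _ tendsto_const, rotated 2])
        (use Q in \<open>auto intro!: always_eventually less_imp_le\<close>)
  qed
  define F where "F k = (\<lambda>(s :: real ^ 'n, w). indicator (space M - E) w *\<^sub>R X (max (s $ k) 0) w $ k)" for k
  have F: "F k \<in> borel_measurable (borel \<Otimes>\<^sub>M M)" for k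
  proof (rule borel_measurable_LIMSEQ_metric)
    let ?f = "\<lambda>j p. indicator (space M - E) (snd p) * X (Q j (fst p $ k)) (snd p) $ k"
    show "?f j \<in> borel_measurable (borel \<Otimes>\<^sub>M M)" for j
    proof -
      have "(\<lambda>p. X (real (i + 1) / 2 ^ j) (snd p) $ k) \<in> borel_measurable (borel \<Otimes>\<^sub>M M)" for i :: nat
        by (intro borel_measurable_vec_nth measurable_compose[OF measurable_snd] X_meas) simp
      moreover have "(\<lambda>p :: (real ^ 'n) \<times> 'a. nat \<lfloor>2 ^ j * fst p $ k\<rfloor>) \<in> measurable (borel \<Otimes>\<^sub>M M) (count_space UNIV)"
        by measurable
      ultimately have "(\<lambda>p. X (Q j (fst p $ k)) (snd p) $ k) \<in> borel_measurable (borel \<Otimes>\<^sub>M M)"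
        unfolding Q_def by (rule measurable_compose_countable)
      then show ?thesis by measurable
    qed
    fix p :: "(real ^ 'n) \<times> 'a" assume "p \<in> space (borel \<Otimes>\<^sub>M M)"
    show "(\<lambda>j. ?f j p) \<longlonglongrightarrow> F k p"
    proof (cases "snd p \<in> space M - E")
      case True
      from filterlim_compose[OF rc[OF True] Q_lim[of "fst p $ k"]]
      have "(\<lambda>j. X (Q j (fst p $ k)) (snd p)) \<longlonglongrightarrow> X (max (fst p $ k) 0) (snd p)" by simp
      from tendsto_vec_nth[OF this, of k] True show ?thesis by (simp add: F_def split_beta)
    qed (simp add: F_def split_beta)
  qed
  define Y where "Y s w = (\<chi> k. F k (s, w))" for s w
  show thesis
  proof (rule that[of Y])
    show "(\<lambda>(s, w). Y s w) \<in> borel_measurable (borel \<Otimes>\<^sub>M M)"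
      by (intro borel_measurable_vecI) (simp add: Y_def split_beta F)
    fix s :: "real ^ 'n" assume s: "s \<in> orthant"
    have "AE w in M. w \<in> space M - E" using E AE_not_in[OF E] AE_space by (auto elim: eventually_elim2)
    then show "AE w in M. Y s w = at_time X s w"
    proof eventually_elim
      case (elim w)
      then show ?case using s by (simp add: vec_eq_iff Y_def F_def at_time_def orthant_def max_absorb1)
    qed
  qed
qed

lemma levy_measure_sigma_finite:
  fixes \<nu> :: "(real ^ 'n::finite) measure"
  assumes "levy_measure \<nu>"
  shows "sigma_finite_measure \<nu>"
proof
  have s: "sets \<nu> = sets borel" and z: "emeasure \<nu> {0} = 0"
    and fin: "(\<integral>\<^sup>+x. ennreal (min 1 ((norm x)\<^sup>2)) \<partial>\<nu>) < \<infinity>"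
    using assms by (auto simp: levy_measure_def)
  have [measurable_cong]: "sets \<nu> = sets borel" by (rule s)
  have sp: "space \<nu> = UNIV" using sets_eq_imp_space_eq[OF s] by simp
  define A where "A j = {x :: real ^ 'n. 1 / real (Suc j) \<le> min 1 ((norm x)\<^sup>2)}" for j
  have [measurable]: "A j \<in> sets borel" for j unfolding A_def by measurable
  have fA: "emeasure \<nu> (A j) \<noteq> \<infinity>" for j
  proof -
    have "emeasure \<nu> (A j) = (\<integral>\<^sup>+x. indicator (A j) x \<partial>\<nu>)" by simp
    also have "\<dots> \<le> (\<integral>\<^sup>+x. ennreal (real (Suc j)) * ennreal (min 1 ((norm x)\<^sup>2)) \<partial>\<nu>)"
    proof (rule nn_integral_mono)
      fix x
      show "indicator (A j) x \<le> ennreal (real (Suc j)) * ennreal (min 1 ((norm x)\<^sup>2))"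
      proof (cases "x \<in> A j")
        case True
        then have "1 \<le> real (Suc j) * min 1 ((norm x)\<^sup>2)" by (simp add: A_def field_simps)
        then have "ennreal 1 \<le> ennreal (real (Suc j) * min 1 ((norm x)\<^sup>2))" by (rule ennreal_leI)
        then show ?thesis using True by (subst ennreal_mult[symmetric]) auto
      qed simp
    qed
    also have "\<dots> = ennreal (real (Suc j)) * (\<integral>\<^sup>+x. ennreal (min 1 ((norm x)\<^sup>2)) \<partial>\<nu>)"
      by (rule nn_integral_cmult) measurable
    also have "\<dots> < \<infinity>" using fin by (simp add: ennreal_mult_less_top)
    finally show ?thesis by simp
  qed
  have "x \<in> insert 0 (\<Union>j. A j)" for x :: "real ^ 'n"
  proof (cases "x = 0")
    case False
    then have "0 < min 1 ((norm x)\<^sup>2)" by simp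
    from reals_Archimedean[OF this] show ?thesis by (auto simp: A_def inverse_eq_divide intro: less_imp_le)
  qed simp
  then have "\<Union> (insert {0} (range A)) = space \<nu>" using sp by auto
  then show "\<exists>B. countable B \<and> B \<subseteq> sets \<nu> \<and> \<Union> B = space \<nu> \<and> (\<forall>a\<in>B. emeasure \<nu> a \<noteq> \<infinity>)"
    using fA z by (intro exI[of _ "insert {0} (range A)"]) (auto simp: s)
qed

section \<open>Integration against a sum of two measures\<close>

lemma nn_integral_measure_sum:
  assumes s: "sets M1 = sets M" "sets M2 = sets M"
    and e: "\<And>A. A \<in> sets M \<Longrightarrow> emeasure M A = emeasure M1 A + emeasure M2 A"
    and f: "f \<in> borel_measurable M"
  shows "(\<integral>\<^sup>+x. f x \<partial>M) = (\<integral>\<^sup>+x. f x \<partial>M1) + (\<integral>\<^sup>+x. f x \<partial>M2)"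
  using f
proof (induction rule: borel_measurable_induct)
  case (cong f g)
  have "space M1 = space M" "space M2 = space M" using s by (auto dest: sets_eq_imp_space_eq)
  then show ?case using cong nn_integral_cong[of M f g] nn_integral_cong[of M1 f g] nn_integral_cong[of M2 f g]
    by simp
next
  case (set A)
  then show ?case using e s by simp
next
  case (mult u c)
  then show ?case using s by (simp add: nn_integral_cmult distrib_left cong: measurable_cong_sets)
next
  case (add u v)
  then show ?case using s by (simp add: nn_integral_add add_ac cong: measurable_cong_sets)
next
  case (seq U)
  have m: "U i \<in> borel_measurable M1" "U i \<in> borel_measurable M2" for i
    using seq s by (auto cong: measurable_cong_sets)
  have "incseq (\<lambda>i. \<integral>\<^sup>+x. U i x \<partial>M1)" "incseq (\<lambda>i. \<integral>\<^sup>+x. U i x \<partial>M2)"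
    using \<open>incseq U\<close> by (auto simp: incseq_def le_fun_def intro!: nn_integral_mono)
  then show ?case
    using seq m by (simp add: SUP_apply nn_integral_monotone_convergence_SUP ennreal_SUP_add image_comp)
qed

lemma integrable_measure_sum_iff:
  fixes f :: "'a \<Rightarrow> 'b::{banach, second_countable_topology}"
  assumes s: "sets M1 = sets M" "sets M2 = sets M"
    and e: "\<And>A. A \<in> sets M \<Longrightarrow> emeasure M A = emeasure M1 A + emeasure M2 A"
  shows "integrable M f \<longleftrightarrow> integrable M1 f \<and> integrable M2 f"
proof (cases "f \<in> borel_measurable M")
  case True
  moreover have "f \<in> borel_measurable M1" "f \<in> borel_measurable M2"
    using True s by (auto cong: measurable_cong_sets)
  ultimately show ?thesis
    using nn_integral_measure_sum[OF s e, of "\<lambda>x. ennreal (norm (f x))"]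
    by (simp add: integrable_iff_bounded)
next
  case False
  then have "f \<notin> borel_measurable M1" using s by (auto cong: measurable_cong_sets)
  with False show ?thesis using borel_measurable_integrable by blast
qed

lemma integral_measure_sum:
  fixes f :: "'a \<Rightarrow> 'b::{banach, second_countable_topology}"
  assumes s: "sets M1 = sets M" "sets M2 = sets M"
    and e: "\<And>A. A \<in> sets M \<Longrightarrow> emeasure M A = emeasure M1 A + emeasure M2 A"
    and f: "integrable M f"
  shows "(LINT x|M. f x) = (LINT x|M1. f x) + (LINT x|M2. f x)"
  using f
proof (induction rule: integrable_induct)
  case (base A c)
  have sp: "space M1 = space M" "space M2 = space M" using s by (auto dest: sets_eq_imp_space_eq)
  have "emeasure M1 A < \<infinity>" "emeasure M2 A < \<infinity>" using base e[of A] by auto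
  then have "measure M A = measure M1 A + measure M2 A"
    using e[OF base(1)] by (simp add: measure_def enn2real_plus)
  then show ?case using base s sets.sets_into_space[OF base(1)] sp
    \<open>emeasure M1 A < \<infinity>\<close> \<open>emeasure M2 A < \<infinity>\<close>
    by (simp add: Int_absorb2 scaleR_add_left)
next
  case (add f g)
  then have "integrable M1 f" "integrable M2 f" "integrable M1 g" "integrable M2 g"
    using integrable_measure_sum_iff[OF s e] by auto
  with add show ?case by (simp add: add_ac)
next
  case (lim f s')
  have sp: "space M1 = space M" "space M2 = space M" using s by (auto dest: sets_eq_imp_space_eq)
  have "(\<lambda>i. LINT x|M'. s' i x) \<longlonglongrightarrow> (LINT x|M'. f x)"
    if "integrable M' f" "\<And>i. integrable M' (s' i)" "space M' = space M" for M'
    using that lim.hyps(2,3)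
    by (intro integral_dominated_convergence[where w = "\<lambda>x. 2 * norm (f x)"] AE_I2) auto
  note conv = this
  have i: "integrable M1 f" "integrable M2 f" "integrable M1 (s' i)" "integrable M2 (s' i)" for i
    using lim.hyps(1)[of i] lim.hyps(4) integrable_measure_sum_iff[OF s e] by auto
  have "(\<lambda>i. LINT x|M. s' i x) \<longlonglongrightarrow> (LINT x|M1. f x) + (LINT x|M2. f x)"
    unfolding lim.IH by (intro tendsto_add conv i sp)
  from LIMSEQ_unique[OF conv[OF lim.hyps(4,1) refl] this] show ?case .
qed

section \<open>Integrals over multivariate time\<close>

lemma orthant_star_measurable [measurable]: "orthant_star \<in> sets (borel :: (real ^ 'n::finite) measure)"
proof -
  have "orthant_star = (\<Inter>k. {t :: real ^ 'n. 0 \<le> t $ k}) - {0}" by (auto simp: orthant_star_def orthant_def)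
  also have "\<dots> \<in> sets borel" by measurable
  finally show ?thesis .
qed

text \<open>
  \<open>Y\<close> is a jointly measurable version of \<open>s \<mapsto> X(s)\<close> on the orthant, which carries \<open>\<T>\<close>. Expectations for fixed \<open>s\<close> do
  not distinguish \<open>Y\<close> from \<open>X\<close>, whereas Fubini's theorem applies to \<open>Y\<close> only.
\<close>

locale time_change = prob_space M for M :: "'a measure" +
  fixes X :: "real \<Rightarrow> 'a \<Rightarrow> real ^ 'n::finite" and Y :: "real ^ 'n \<Rightarrow> 'a \<Rightarrow> real ^ 'n"
    and \<T> :: "(real ^ 'n) measure"
  assumes sets_\<T> [measurable_cong]: "sets \<T> = sets borel"
    and sigma_finite_\<T>: "sigma_finite_measure \<T>"
    and AE_orthant: "AE s in \<T>. s \<in> orthant_star"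
    and Y_pair: "(\<lambda>(s, w). Y s w) \<in> borel_measurable (borel \<Otimes>\<^sub>M M)"
    and Y_version: "\<And>s. s \<in> orthant \<Longrightarrow> AE w in M. Y s w = at_time X s w"
    and X_meas: "\<And>s. s \<in> orthant \<Longrightarrow> at_time X s \<in> borel_measurable M"
begin

lemma Y_measurable [measurable (raw)]:
  assumes "f \<in> borel_measurable N" "g \<in> measurable N M"
  shows "(\<lambda>w. Y (f w) (g w)) \<in> borel_measurable N"
  using measurable_compose[OF measurable_Pair[OF assms] Y_pair] by simp

sublocale TM: pair_sigma_finite \<T> M
  by (intro pair_sigma_finite.intro sigma_finite_\<T> sigma_finite_measure_axioms)

lemma space_\<T> [simp]: "space \<T> = UNIV"
  using sets_eq_imp_space_eq[OF sets_\<T>] by simp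

lemma orthant_integral:
  fixes g g' :: "real ^ 'n \<Rightarrow> 'b::{banach, second_countable_topology}"
  assumes g: "\<And>s. s \<in> orthant_star \<Longrightarrow> g s = g' s" and [measurable]: "g' \<in> borel_measurable \<T>"
  shows "set_integrable \<T> orthant_star g \<longleftrightarrow> integrable \<T> g'"
    and "(LINT s:orthant_star|\<T>. g s) = (LINT s|\<T>. g' s)"
proof -
  have eq: "(\<lambda>s. indicator orthant_star s *\<^sub>R g s) = (\<lambda>s. indicator orthant_star s *\<^sub>R g' s)"
    using g by (auto simp: indicator_def fun_eq_iff)
  have ae: "AE s in \<T>. indicator orthant_star s *\<^sub>R g' s = g' s"
    using AE_orthant by eventually_elim simp
  show "set_integrable \<T> orthant_star g \<longleftrightarrow> integrable \<T> g'"
    unfolding set_integrable_def eq by (rule integrable_cong_AE[OF _ _ ae]) measurable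
  show "(LINT s:orthant_star|\<T>. g s) = (LINT s|\<T>. g' s)"
    unfolding set_lebesgue_integral_def eq by (rule integral_cong_AE[OF _ _ ae]) measurable
qed

lemma expectation_version:
  fixes F :: "real ^ 'n \<Rightarrow> 'b::{banach, second_countable_topology}"
  assumes s: "s \<in> orthant_star" and [measurable]: "F \<in> borel_measurable borel"
  shows "integrable M (\<lambda>w. F (at_time X s w)) \<longleftrightarrow> integrable M (\<lambda>w. F (Y s w))"
    and "(LINT w|M. F (at_time X s w)) = (LINT w|M. F (Y s w))"
proof -
  have so: "s \<in> orthant" using s by (simp add: orthant_star_def)
  have [measurable]: "at_time X s \<in> borel_measurable M" by (rule X_meas[OF so])
  have ae: "AE w in M. F (at_time X s w) = F (Y s w)" using Y_version[OF so] by eventually_elim simp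
  show "integrable M (\<lambda>w. F (at_time X s w)) \<longleftrightarrow> integrable M (\<lambda>w. F (Y s w))"
    by (rule integrable_cong_AE[OF _ _ ae]) measurable
  show "(LINT w|M. F (at_time X s w)) = (LINT w|M. F (Y s w))"
    by (rule integral_cong_AE[OF _ _ ae]) measurable
qed

lemma iterated_integral:
  fixes f :: "real ^ 'n \<Rightarrow> real ^ 'n \<Rightarrow> 'b::{banach, second_countable_topology}"
  assumes f: "(\<lambda>(s, x). f s x) \<in> borel_measurable (borel \<Otimes>\<^sub>M borel)"
  shows "set_integrable \<T> orthant_star (\<lambda>s. LINT w|M. f s (at_time X s w)) \<longleftrightarrow>
      integrable \<T> (\<lambda>s. LINT w|M. f s (Y s w))"
    and "(LINT s:orthant_star|\<T>. (LINT w|M. f s (at_time X s w))) = (LINT s|\<T>. (LINT w|M. f s (Y s w)))"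
proof -
  have fsm: "f s \<in> borel_measurable borel" for s
    using measurable_compose[OF measurable_Pair[OF measurable_const[of s borel borel] measurable_ident_sets[OF refl]] f]
    by simp
  have m: "(\<lambda>s. LINT w|M. f s (Y s w)) \<in> borel_measurable \<T>"
  proof (rule borel_measurable_lebesgue_integral)
    show "(\<lambda>(s, w). f s (Y s w)) \<in> borel_measurable (\<T> \<Otimes>\<^sub>M M)"
      using measurable_compose[OF measurable_Pair[of fst "\<T> \<Otimes>\<^sub>M M" borel "\<lambda>p. Y (fst p) (snd p)" borel] f]
      by (simp add: split_beta)
  qed
  have eq: "(LINT w|M. f s (at_time X s w)) = (LINT w|M. f s (Y s w))" if "s \<in> orthant_star" for s
    by (rule expectation_version(2)[OF that fsm])
  show "set_integrable \<T> orthant_star (\<lambda>s. LINT w|M. f s (at_time X s w)) \<longleftrightarrow>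
      integrable \<T> (\<lambda>s. LINT w|M. f s (Y s w))"
    by (rule orthant_integral(1)[OF eq m])
  show "(LINT s:orthant_star|\<T>. (LINT w|M. f s (at_time X s w))) = (LINT s|\<T>. (LINT w|M. f s (Y s w)))"
    by (rule orthant_integral(2)[OF eq m])
qed

lemma iterated_finiteD:
  fixes f :: "real ^ 'n \<Rightarrow> real ^ 'n \<Rightarrow> 'b::{banach, second_countable_topology}"
  assumes f: "(\<lambda>(s, x). f s x) \<in> borel_measurable (borel \<Otimes>\<^sub>M borel)"
    and fin: "iterated_finite M X \<T> f"
  shows "integrable (\<T> \<Otimes>\<^sub>M M) (\<lambda>(s, w). indicator (- cball 0 1) (joinv s (Y s w)) *\<^sub>R f s (Y s w))"
    and "AE s in \<T>. integrable M (\<lambda>w. f s (Y s w))"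
    and "integrable \<T> (\<lambda>s. LINT w|M. f s (Y s w))"
proof -
  have fsm [measurable]: "f s \<in> borel_measurable borel" for s
    using measurable_compose[OF measurable_Pair[OF measurable_const[of s borel borel] measurable_ident_sets[OF refl]] f]
    by simp
  have fYm [measurable]: "(\<lambda>p. f (fst p) (Y (fst p) (snd p))) \<in> borel_measurable (\<T> \<Otimes>\<^sub>M M)"
    using measurable_compose[OF measurable_Pair[of fst "\<T> \<Otimes>\<^sub>M M" borel "\<lambda>p. Y (fst p) (snd p)" borel] f]
    by simp
  show "integrable \<T> (\<lambda>s. LINT w|M. f s (Y s w))"
    using fin iterated_integral(1)[OF f] by (simp add: iterated_finite_def)
  have "AE s in \<T>. integrable M (\<lambda>w. f s (at_time X s w))" using fin by (simp add: iterated_finite_def)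
  with AE_orthant show "AE s in \<T>. integrable M (\<lambda>w. f s (Y s w))"
    by eventually_elim (use expectation_version(1)[OF _ fsm] in blast)
  show "integrable (\<T> \<Otimes>\<^sub>M M) (\<lambda>(s, w). indicator (- cball 0 1) (joinv s (Y s w)) *\<^sub>R f s (Y s w))"
  proof (rule integrableI_bounded)
    show "(\<lambda>(s, w). indicator (- cball 0 1) (joinv s (Y s w)) *\<^sub>R f s (Y s w)) \<in> borel_measurable (\<T> \<Otimes>\<^sub>M M)"
      unfolding split_beta by measurable
    let ?h = "\<lambda>p. ennreal (norm (f (fst p) (Y (fst p) (snd p)))) *
        indicator (- cball 0 1) (joinv (fst p) (Y (fst p) (snd p)))"
    have "(\<integral>\<^sup>+p. ennreal (norm (case p of (s, w) \<Rightarrow> indicator (- cball 0 1) (joinv s (Y s w)) *\<^sub>R f s (Y s w))) \<partial>(\<T> \<Otimes>\<^sub>M M))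
        = (\<integral>\<^sup>+p. ?h p \<partial>(\<T> \<Otimes>\<^sub>M M))"
      by (intro nn_integral_cong) (simp add: split_beta indicator_def)
    also have "\<dots> = (\<integral>\<^sup>+s. (\<integral>\<^sup>+w. ?h (s, w) \<partial>M) \<partial>\<T>)"
      by (rule nn_integral_fst[symmetric]) measurable
    also have "\<dots> = (\<integral>\<^sup>+s\<in>orthant_star. (\<integral>\<^sup>+w. ennreal (norm (f s (at_time X s w))) *
        indicator (- cball 0 1) (joinv s (at_time X s w)) \<partial>M) \<partial>\<T>)"
    proof (rule nn_integral_cong_AE, use AE_orthant in eventually_elim)
      case (elim s)
      then have "s \<in> orthant" by (simp add: orthant_star_def)
      from Y_version[OF this] have "(\<integral>\<^sup>+w. ?h (s, w) \<partial>M) = (\<integral>\<^sup>+w. ennreal (norm (f s (at_time X s w))) *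
          indicator (- cball 0 1) (joinv s (at_time X s w)) \<partial>M)"
        by (intro nn_integral_cong_AE) (auto elim!: eventually_mono)
      with elim show ?case by simp
    qed
    also have "\<dots> < \<infinity>" using fin by (simp add: iterated_finite_def)
    finally show "(\<integral>\<^sup>+p. ennreal (norm (case p of (s, w) \<Rightarrow> indicator (- cball 0 1) (joinv s (Y s w)) *\<^sub>R f s (Y s w))) \<partial>(\<T> \<Otimes>\<^sub>M M)) < \<infinity>" .
  qed
qed

text \<open>
  The second summand of the Levy measure is the image of a product measure, which turns integrals
  against it into iterated integrals over times and paths.
\<close>

lemma weak_levy_measure_emeasure:
  assumes Z: "is_weak_levy_measure M X \<X> d \<T> \<Z>" and A [measurable]: "A \<in> sets borel"
  shows "emeasure \<Z> A = emeasure (distr (diamond_measure d \<X>) borel (joinv 0)) A +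
    emeasure (distr (\<T> \<Otimes>\<^sub>M M) borel (\<lambda>(s, w). joinv s (Y s w))) A"
proof -
  have j [measurable]: "joinv s \<in> borel_measurable borel" for s :: "real ^ 'n" by measurable
  have J [measurable]: "(\<lambda>p. joinv (fst p) (Y (fst p) (snd p))) \<in> borel_measurable (\<T> \<Otimes>\<^sub>M M)" by measurable
  have "emeasure (distr (\<T> \<Otimes>\<^sub>M M) borel (\<lambda>(s, w). joinv s (Y s w))) A =
      (\<integral>\<^sup>+z. indicator A z \<partial>distr (\<T> \<Otimes>\<^sub>M M) borel (\<lambda>(s, w). joinv s (Y s w)))" by simp
  also have "\<dots> = (\<integral>\<^sup>+p. indicator A (joinv (fst p) (Y (fst p) (snd p))) \<partial>(\<T> \<Otimes>\<^sub>M M))"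
    unfolding split_beta by (rule nn_integral_distr[OF J]) measurable
  also have "\<dots> = (\<integral>\<^sup>+s. (\<integral>\<^sup>+w. indicator A (joinv s (Y s w)) \<partial>M) \<partial>\<T>)"
    by (subst nn_integral_fst[symmetric]) auto
  also have "\<dots> = (\<integral>\<^sup>+s\<in>orthant_star. emeasure (distr M borel (at_time X s)) {x. joinv s x \<in> A} \<partial>\<T>)"
  proof (rule nn_integral_cong_AE, use AE_orthant in eventually_elim)
    case (elim s)
    then have so: "s \<in> orthant" by (simp add: orthant_star_def)
    have [measurable]: "at_time X s \<in> borel_measurable M" by (rule X_meas[OF so])
    have [measurable]: "{x. joinv s x \<in> A} \<in> sets borel" by measurable
    have "emeasure (distr M borel (at_time X s)) {x. joinv s x \<in> A} =
        (\<integral>\<^sup>+x. indicator {x. joinv s x \<in> A} x \<partial>distr M borel (at_time X s))" by simp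
    also have "\<dots> = (\<integral>\<^sup>+w. indicator {x. joinv s x \<in> A} (at_time X s w) \<partial>M)"
      by (rule nn_integral_distr) measurable
    also have "\<dots> = (\<integral>\<^sup>+w. indicator A (joinv s (Y s w)) \<partial>M)"
      using Y_version[OF so] by (intro nn_integral_cong_AE) (auto elim!: eventually_mono simp: indicator_def)
    finally show ?case using elim by simp
  qed
  finally have TM: "emeasure (distr (\<T> \<Otimes>\<^sub>M M) borel (\<lambda>(s, w). joinv s (Y s w))) A =
      (\<integral>\<^sup>+s\<in>orthant_star. emeasure (distr M borel (at_time X s)) {x. joinv s x \<in> A} \<partial>\<T>)" .
  have "joinv 0 \<in> measurable (diamond_measure d \<X>) borel" using j[of 0] by (simp cong: measurable_cong_sets)
  then have "emeasure (distr (diamond_measure d \<X>) borel (joinv 0)) A =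
      emeasure (diamond_measure d \<X>) {x. joinv 0 x \<in> A}"
    using A by (simp add: emeasure_distr vimage_def sets_eq_imp_space_eq[OF sets_diamond_measure])
  with TM Z A show ?thesis by (simp add: is_weak_levy_measure_def)
qed

lemma weak_levy_measure_integral:
  fixes f :: "real ^ ('n + 'n) \<Rightarrow> 'b::{banach, second_countable_topology}"
  assumes Z: "is_weak_levy_measure M X \<X> d \<T> \<Z>" and [measurable]: "f \<in> borel_measurable borel"
  shows "integrable \<Z> f \<longleftrightarrow> integrable (diamond_measure d \<X>) (\<lambda>x. f (joinv 0 x)) \<and>
      integrable (\<T> \<Otimes>\<^sub>M M) (\<lambda>(s, w). f (joinv s (Y s w)))"
    and "integrable \<Z> f \<Longrightarrow> (LINT z|\<Z>. f z) = (LINT x|diamond_measure d \<X>. f (joinv 0 x)) +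
      (LINT p|(\<T> \<Otimes>\<^sub>M M). f (joinv (fst p) (Y (fst p) (snd p))))"
proof -
  let ?M1 = "distr (diamond_measure d \<X>) borel (joinv 0)"
  let ?M2 = "distr (\<T> \<Otimes>\<^sub>M M) borel (\<lambda>(s, w). joinv s (Y s w))"
  have s: "sets \<Z> = sets borel" using Z by (simp add: is_weak_levy_measure_def)
  have d: "sets ?M1 = sets \<Z>" "sets ?M2 = sets \<Z>" by (simp_all add: s)
  have e: "emeasure \<Z> A = emeasure ?M1 A + emeasure ?M2 A" if "A \<in> sets \<Z>" for A
    using weak_levy_measure_emeasure[OF Z] that s by simp
  have m1: "joinv 0 \<in> measurable (diamond_measure d \<X>) borel"
  proof -
    have "joinv (0 :: real ^ 'n) \<in> borel_measurable borel" by measurable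
    then show ?thesis by (simp cong: measurable_cong_sets)
  qed
  have m2: "(\<lambda>(s, w). joinv s (Y s w)) \<in> measurable (\<T> \<Otimes>\<^sub>M M) borel"
    unfolding split_beta by measurable
  show "integrable \<Z> f \<longleftrightarrow> integrable (diamond_measure d \<X>) (\<lambda>x. f (joinv 0 x)) \<and>
      integrable (\<T> \<Otimes>\<^sub>M M) (\<lambda>(s, w). f (joinv s (Y s w)))"
    using integrable_measure_sum_iff[OF d e, of f] integrable_distr_eq[OF m1, of f] integrable_distr_eq[OF m2, of f]
    by (simp add: case_prod_beta')
  assume "integrable \<Z> f"
  from integral_measure_sum[OF d e this]
  show "(LINT z|\<Z>. f z) = (LINT x|diamond_measure d \<X>. f (joinv 0 x)) +
      (LINT p|(\<T> \<Otimes>\<^sub>M M). f (joinv (fst p) (Y (fst p) (snd p))))"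
    using integral_distr[OF m1, of f] integral_distr[OF m2, of f] by (simp add: split_beta)
qed

end

section \<open>Moments of Levy processes\<close>

lemma levy_measure_truncated:
  fixes \<nu> :: "(real ^ 'n::finite) measure"
  assumes "levy_measure \<nu>"
  shows "integrable \<nu> (\<lambda>z. min 1 ((norm z)\<^sup>2))"
  using assms by (intro integrableI_bounded) (auto simp: levy_measure_def cong: measurable_cong_sets)

lemma integrable_levy_split:
  fixes \<nu> :: "(real ^ 'n::finite) measure" and f :: "real ^ 'n \<Rightarrow> real"
  assumes \<nu>: "levy_measure \<nu>" and [measurable]: "f \<in> borel_measurable borel"
    and out: "set_integrable \<nu> (- cball 0 1) f" and inn: "\<And>z. norm z \<le> 1 \<Longrightarrow> \<bar>f z\<bar> \<le> c * (norm z)\<^sup>2"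
  shows "integrable \<nu> f"
proof -
  have [measurable_cong]: "sets \<nu> = sets borel" using \<nu> by (simp add: levy_measure_def)
  show ?thesis
  proof (rule Bochner_Integration.integrable_bound)
    show "integrable \<nu> (\<lambda>z. \<bar>c\<bar> * min 1 ((norm z)\<^sup>2) + \<bar>indicator (- cball 0 1) z *\<^sub>R f z\<bar>)"
      using levy_measure_truncated[OF \<nu>] out unfolding set_integrable_def
      by (intro Bochner_Integration.integrable_add integrable_mult_right integrable_abs) auto
    show "AE z in \<nu>. norm (f z) \<le> norm (\<bar>c\<bar> * min 1 ((norm z)\<^sup>2) + \<bar>indicator (- cball 0 1) z *\<^sub>R f z\<bar>)"
    proof (rule AE_I2)
      fix z :: "real ^ 'n"
      show "norm (f z) \<le> norm (\<bar>c\<bar> * min 1 ((norm z)\<^sup>2) + \<bar>indicator (- cball 0 1) z *\<^sub>R f z\<bar>)"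
      proof (cases "norm z \<le> 1")
        case True
        then have "(norm z)\<^sup>2 \<le> 1" by (simp add: power_le_one)
        moreover have "c * (norm z)\<^sup>2 \<le> \<bar>c\<bar> * (norm z)\<^sup>2" by (intro mult_right_mono) auto
        ultimately show ?thesis using inn[OF True] True by (simp add: min_absorb2)
      next
        case False
        have "0 \<le> \<bar>c\<bar> * min 1 ((norm z)\<^sup>2)" by simp
        then show ?thesis using False by (simp add: indicator_def)
      qed
    qed
  qed measurable
qed

lemma mean_jump_inner:
  fixes \<nu> :: "(real ^ 'n::finite) measure"
  assumes \<nu>: "levy_measure \<nu>" and out: "set_integrable \<nu> (- cball 0 1) (\<lambda>z. \<theta> \<bullet> z)"
  shows "mean_jump \<nu> (\<lambda>z. \<theta> \<bullet> z)"
  unfolding mean_jump_def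
proof
  have [measurable_cong]: "sets \<nu> = sets borel" using \<nu> by (simp add: levy_measure_def)
  show "(\<lambda>z. \<theta> \<bullet> z) \<in> borel_measurable \<nu>" by measurable
  show "integrable \<nu> (\<lambda>z. mean_weight (\<theta> \<bullet> z))"
  proof (rule integrable_levy_split[OF \<nu>])
    show "set_integrable \<nu> (- cball 0 1) (\<lambda>z. mean_weight (\<theta> \<bullet> z))"
      by (rule set_integrable_bound[OF out])
        (auto simp: set_borel_measurable_def mean_weight_def intro!: AE_I2)
    fix z :: "real ^ 'n"
    have "(\<theta> \<bullet> z)\<^sup>2 \<le> (norm \<theta> * norm z)\<^sup>2"
      using Cauchy_Schwarz_ineq2[of \<theta> z] by (metis abs_le_square_iff abs_mult abs_norm_cancel)
    then show "\<bar>mean_weight (\<theta> \<bullet> z)\<bar> \<le> (norm \<theta>)\<^sup>2 * (norm z)\<^sup>2"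
      by (simp add: mean_weight_def power_mult_distrib)
  qed measurable
qed

text \<open>
  Compensating also the jumps outside the unit ball changes the exponent by a linear term, which the
  location absorbs.
\<close>

lemma levy_exponent_centered:
  fixes \<nu> :: "(real ^ 'n::finite) measure"
  assumes \<nu>: "levy_measure \<nu>" and out: "set_integrable \<nu> (- cball 0 1) (\<lambda>z. \<theta> \<bullet> z)"
  shows "levy_exponent m \<Theta> \<nu> \<theta> =
    centered_exponent (m \<bullet> \<theta> + (LINT z:- cball 0 1|\<nu>. \<theta> \<bullet> z)) (\<theta> \<bullet> (\<Theta> *v \<theta>)) \<nu> (\<lambda>z. \<theta> \<bullet> z)"
proof -
  have i: "integrable \<nu> (\<lambda>z. \<i> * of_real (indicator (- cball 0 1) z *\<^sub>R (\<theta> \<bullet> z)))"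
    using out unfolding set_integrable_def by (intro integrable_mult_right integrable_of_real)
  have "(LINT z:-{0}|\<nu>. iexp (\<theta> \<bullet> z) - 1 - \<i> * of_real (\<theta> \<bullet> z) * indicator (cball 0 1) z) =
      (LINT z|\<nu>. jump_kernel (\<theta> \<bullet> z) + \<i> * of_real (indicator (- cball 0 1) z *\<^sub>R (\<theta> \<bullet> z)))"
    unfolding set_lebesgue_integral_def
    by (intro Bochner_Integration.integral_cong refl) (auto simp: jump_kernel_def indicator_def)
  also have "\<dots> = (LINT z|\<nu>. jump_kernel (\<theta> \<bullet> z)) + (LINT z|\<nu>. \<i> * of_real (indicator (- cball 0 1) z *\<^sub>R (\<theta> \<bullet> z)))"
    by (intro Bochner_Integration.integral_add integrable_jump_kernel mean_jump_inner assms i)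
  also have "(LINT z|\<nu>. \<i> * of_real (indicator (- cball 0 1) z *\<^sub>R (\<theta> \<bullet> z))) =
      \<i> * of_real (LINT z:- cball 0 1|\<nu>. \<theta> \<bullet> z)"
    unfolding set_lebesgue_integral_def by (simp only: integral_mult_right_zero integral_complex_of_real)
  finally show ?thesis by (simp add: levy_exponent_def centered_exponent_def algebra_simps)
qed

text \<open>
  The mean at time 1 of the coordinate \<open>i\<close> of a Levy process whose large jumps have a mean there.
\<close>

definition levy_mean :: "real ^ 'm::finite \<Rightarrow> (real ^ 'm) measure \<Rightarrow> 'm \<Rightarrow> real" where
  "levy_mean m \<nu> i = m $ i + (LINT z:- cball 0 1|\<nu>. z $ i)"

lemma levy_triplet_char:
  fixes Z :: "real \<Rightarrow> 'c \<Rightarrow> real ^ 'm::finite"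
  assumes Z: "levy_triplet N Z m \<Theta> \<nu>" and t: "0 \<le> t"
    and i: "set_integrable \<nu> (- cball 0 1) (\<lambda>z. z $ i)" and j: "set_integrable \<nu> (- cball 0 1) (\<lambda>z. z $ j)"
  shows "(LINT w|N. iexp (a * Z t w $ i + b * Z t w $ j)) =
    exp (of_real t * centered_exponent (a * levy_mean m \<nu> i + b * levy_mean m \<nu> j)
      (a\<^sup>2 * \<Theta> $ i $ i + 2 * a * b * \<Theta> $ i $ j + b\<^sup>2 * \<Theta> $ j $ j) \<nu> (\<lambda>z. a * z $ i + b * z $ j))"
proof -
  let ?\<theta> = "a *\<^sub>R axis i 1 + b *\<^sub>R axis j 1 :: real ^ 'm"
  have in\<theta>: "?\<theta> \<bullet> z = a * z $ i + b * z $ j" for z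
    by (simp add: inner_add_left inner_axis')
  have \<nu>: "levy_measure \<nu>" and sym: "transpose \<Theta> = \<Theta>"
    and ch: "(LINT w|N. iexp (\<theta> \<bullet> Z t w)) = exp (of_real t * levy_exponent m \<Theta> \<nu> \<theta>)" for \<theta>
    using Z t by (auto simp: levy_triplet_def)
  have sij: "\<Theta> $ j $ i = \<Theta> $ i $ j"
    using arg_cong[OF sym, of "\<lambda>A. A $ i $ j"] by (simp add: transpose_def)
  have ai: "set_integrable \<nu> (- cball 0 1) (\<lambda>z. a * z $ i)" and bj: "set_integrable \<nu> (- cball 0 1) (\<lambda>z. b * z $ j)"
    using i j by auto
  have out: "set_integrable \<nu> (- cball 0 1) (\<lambda>z. ?\<theta> \<bullet> z)"
    unfolding in\<theta> by (rule set_integral_add(1)[OF ai bj])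
  have c1: "(LINT z:- cball 0 1|\<nu>. ?\<theta> \<bullet> z) = a * (LINT z:- cball 0 1|\<nu>. z $ i) + b * (LINT z:- cball 0 1|\<nu>. z $ j)"
    unfolding in\<theta> by (subst set_integral_add(2)[OF ai bj]) simp
  have c2: "m \<bullet> ?\<theta> = a * m $ i + b * m $ j" by (simp add: inner_add_right inner_axis)
  have c3: "?\<theta> \<bullet> (\<Theta> *v ?\<theta>) = a\<^sup>2 * \<Theta> $ i $ i + 2 * a * b * \<Theta> $ i $ j + b\<^sup>2 * \<Theta> $ j $ j"
    unfolding in\<theta>
    by (simp add: matrix_vector_right_distrib matrix_vector_mult_scaleR matrix_vector_mult_basis column_def
        sij power2_eq_square algebra_simps)
  show ?thesis
    using ch[of ?\<theta>] unfolding levy_exponent_centered[OF \<nu> out, of m \<Theta>] c1 c2 c3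
    unfolding in\<theta> levy_mean_def by (simp only: distrib_left add_ac)
qed

context
  fixes N :: "'c measure" and Z :: "real \<Rightarrow> 'c \<Rightarrow> real ^ 'm::finite"
    and m :: "real ^ 'm" and \<Theta> :: "real ^ 'm ^ 'm" and \<nu> :: "(real ^ 'm) measure" and t :: real
  assumes Z: "levy_triplet N Z m \<Theta> \<nu>" and t: "0 \<le> t"
begin

lemma levy_triplet_facts:
  shows "prob_space N" "levy_measure \<nu>" "(\<lambda>w. Z t w $ i) \<in> borel_measurable N" "0 \<le> \<Theta> $ i $ i"
proof -
  show "prob_space N" "levy_measure \<nu>" using Z by (auto simp: levy_triplet_def levy_process_def)
  have "Z t \<in> borel_measurable N" using Z t by (auto simp: levy_triplet_def levy_process_def)
  then show "(\<lambda>w. Z t w $ i) \<in> borel_measurable N" by measurable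
  have "0 \<le> axis i 1 \<bullet> (\<Theta> *v axis i 1)" using Z unfolding levy_triplet_def by blast
  then show "0 \<le> \<Theta> $ i $ i" by (simp add: inner_axis' matrix_vector_mult_basis column_def)
qed

lemma mean_jump_nth:
  assumes "set_integrable \<nu> (- cball 0 1) (\<lambda>z. z $ i)"
  shows "mean_jump \<nu> (\<lambda>z. z $ i)"
  using mean_jump_inner[OF levy_triplet_facts(2), of "axis i 1"] assms by (simp add: inner_axis')

lemma levy_triplet_char1:
  assumes "set_integrable \<nu> (- cball 0 1) (\<lambda>z. z $ i)"
  shows "(LINT w|N. iexp (a * Z t w $ i)) =
    exp (of_real t * centered_exponent (a * levy_mean m \<nu> i) (a\<^sup>2 * \<Theta> $ i $ i) \<nu> (\<lambda>z. a * z $ i))"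
  using levy_triplet_char[OF Z t assms assms, of a 0] by simp

lemma levy_triplet_mean:
  assumes i: "set_integrable \<nu> (- cball 0 1) (\<lambda>z. z $ i)"
  shows "integrable N (\<lambda>w. Z t w $ i)" "(LINT w|N. Z t w $ i) = t * levy_mean m \<nu> i"
  using prob_space.infinitely_divisible_mean[OF levy_triplet_facts(1,3) mean_jump_nth[OF i]
      levy_triplet_facts(4) t levy_triplet_char1[OF i]] by auto

lemma set_integrable_from_square:
  assumes i: "integrable \<nu> (\<lambda>z. (z $ i)\<^sup>2)"
  shows "set_integrable \<nu> (- cball 0 1) (\<lambda>z. z $ i)"
  unfolding set_integrable_def
proof (rule Bochner_Integration.integrable_bound)
  have [measurable_cong]: "sets \<nu> = sets borel" using levy_triplet_facts(2) by (simp add: levy_measure_def)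
  show "(\<lambda>z. indicator (- cball 0 1) z *\<^sub>R z $ i) \<in> borel_measurable \<nu>" by measurable
  show "integrable \<nu> (\<lambda>z. min 1 ((norm z)\<^sup>2) + (z $ i)\<^sup>2)"
    by (intro Bochner_Integration.integrable_add levy_measure_truncated levy_triplet_facts(2) i)
  show "AE z in \<nu>. norm (indicator (- cball 0 1) z *\<^sub>R z $ i) \<le> norm (min 1 ((norm z)\<^sup>2) + (z $ i)\<^sup>2)"
  proof (rule AE_I2)
    fix z :: "real ^ 'm"
    have "\<bar>z $ i\<bar> \<le> 1 + (z $ i)\<^sup>2"
      using zero_le_power2[of "\<bar>z $ i\<bar> - 1"] by (simp add: power2_diff)
    moreover have "1 \<le> (norm z)\<^sup>2" if "\<not> norm z \<le> 1" using that by (simp add: one_le_power)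
    ultimately show "norm (indicator (- cball 0 1) z *\<^sub>R z $ i) \<le> norm (min 1 ((norm z)\<^sup>2) + (z $ i)\<^sup>2)"
      by (auto simp: indicator_def min_absorb1)
  qed
qed

lemma levy_triplet_square_integrable:
  assumes i: "integrable \<nu> (\<lambda>z. (z $ i)\<^sup>2)"
  shows "integrable N (\<lambda>w. (Z t w $ i)\<^sup>2)"
proof -
  note s = set_integrable_from_square[OF i]
  show ?thesis
    by (rule prob_space.infinitely_divisible_square_integrable[OF levy_triplet_facts(1,3) mean_jump_nth[OF s]
        levy_triplet_facts(4) t levy_triplet_char1[OF s] i])
qed

lemma levy_triplet_covariance:
  assumes i: "set_integrable \<nu> (- cball 0 1) (\<lambda>z. z $ i)" and j: "set_integrable \<nu> (- cball 0 1) (\<lambda>z. z $ j)"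
    and ij: "integrable \<nu> (\<lambda>z. z $ i * z $ j)" and Zij: "integrable N (\<lambda>w. Z t w $ i * Z t w $ j)"
  shows "(LINT w|N. Z t w $ i * Z t w $ j) - (LINT w|N. Z t w $ i) * (LINT w|N. Z t w $ j) =
    t * (\<Theta> $ i $ j + (LINT z|\<nu>. z $ i * z $ j))"
  by (rule prob_space.infinitely_divisible_covariance[OF levy_triplet_facts(1) levy_triplet_mean(1)[OF i]
        levy_triplet_mean(1)[OF j] Zij mean_jump_nth[OF i] mean_jump_nth[OF j] ij levy_triplet_char[OF Z t i j]])

lemma levy_triplet_product_integrable:
  assumes i: "set_integrable \<nu> (- cball 0 1) (\<lambda>z. z $ i)" and j: "set_integrable \<nu> (- cball 0 1) (\<lambda>z. z $ j)"
    and ij: "integrable \<nu> (\<lambda>z. z $ i * z $ j)" and nonneg: "AE w in N. 0 \<le> Z t w $ j" and 0: "\<Theta> $ i $ j = 0"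
  shows "integrable N (\<lambda>w. Z t w $ i * Z t w $ j)"
proof -
  have "integrable N (\<lambda>w. Z t w $ j * Z t w $ i)"
    by (rule prob_space.infinitely_divisible_product_integrable[OF levy_triplet_facts(1) levy_triplet_mean(1)[OF i]
          levy_triplet_mean(1)[OF j] nonneg mean_jump_nth[OF i] mean_jump_nth[OF j] ij t
          levy_triplet_char[OF Z t i j, unfolded 0 mult_zero_right add_0_right]])
  then show ?thesis by (simp add: mult.commute)
qed

end

lemma cov_nth:
  fixes U V :: "'c \<Rightarrow> real ^ 'n::finite"
  assumes N: "prob_space N" and U: "\<And>k. integrable N (\<lambda>w. U w $ k)" and V: "\<And>k. integrable N (\<lambda>w. V w $ k)"
    and UV: "\<And>k l. integrable N (\<lambda>w. U w $ k * V w $ l)"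
  shows "cov_exists N U V"
    and "cov N U V $ k $ l = (LINT w|N. U w $ k * V w $ l) - (LINT w|N. U w $ k) * (LINT w|N. V w $ l)"
proof -
  interpret prob_space N by (rule N)
  have iU: "integrable N U" and iV: "integrable N V" using U V by (auto simp: integrable_vec_iff)
  let ?O = "\<lambda>w. outer (U w - (LINT v|N. U v)) (V w - (LINT v|N. V v))"
  have O: "?O w $ k $ l = U w $ k * V w $ l - U w $ k * (LINT w|N. V w $ l) - (LINT w|N. U w $ k) * V w $ l +
      (LINT w|N. U w $ k) * (LINT w|N. V w $ l)" for w k l
    by (simp add: integral_vec_nth iU iV algebra_simps)
  have iO: "integrable N ?O"
    unfolding integrable_vec_iff[of _ ?O] integrable_vec_iff[of _ "\<lambda>w. ?O w $ _"] O
    using U V UV by auto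
  then show "cov_exists N U V" using iU iV by (simp add: cov_exists_def)
  have iOk: "integrable N (\<lambda>w. ?O w $ k)" using iO integrable_vec_iff[of N ?O] by blast
  have "cov N U V $ k $ l = (LINT w|N. ?O w $ k $ l)"
    unfolding cov_def by (simp only: integral_vec_nth[OF iO] integral_vec_nth[OF iOk])
  also have "\<dots> = (LINT w|N. U w $ k * V w $ l) - (LINT w|N. U w $ k) * (LINT w|N. V w $ l)"
    unfolding O using U[of k] V[of l] UV[of k l] by (simp add: prob_space)
  finally show "cov N U V $ k $ l = (LINT w|N. U w $ k * V w $ l) - (LINT w|N. U w $ k) * (LINT w|N. V w $ l)" .
qed

section \<open>The Levy measure of the weakly subordinated process\<close>

lemma norm_joinv: "(norm (joinv x y))\<^sup>2 = (norm x)\<^sup>2 + (norm y)\<^sup>2"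
  by (simp add: power2_norm_eq_inner inner_vec_def UNIV_Plus_UNIV[symmetric] sum.Plus del: UNIV_Plus_UNIV)

lemma norm_joinv_0 [simp]: "norm (joinv 0 x) = norm x"
  using norm_joinv[of 0 x] by simp

context time_change
begin

lemma integral_fst_only:
  fixes g :: "real ^ 'n \<Rightarrow> 'b::{banach, second_countable_topology}"
  assumes g: "integrable \<T> g"
  shows "integrable (\<T> \<Otimes>\<^sub>M M) (\<lambda>(s, w). g s)" and "(LINT p|(\<T> \<Otimes>\<^sub>M M). g (fst p)) = (LINT s|\<T>. g s)"
proof -
  have [measurable]: "g \<in> borel_measurable \<T>" using g by auto
  have i: "integrable (\<T> \<Otimes>\<^sub>M M) (\<lambda>p. g (fst p))"
  proof (rule TM.Fubini_integrable)
    show "integrable \<T> (\<lambda>s. LINT w|M. norm (g (fst (s, w))))" using g by (simp add: prob_space)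
    show "AE s in \<T>. integrable M (\<lambda>w. g (fst (s, w)))" by simp
  qed measurable
  then show "integrable (\<T> \<Otimes>\<^sub>M M) (\<lambda>(s, w). g s)" by (simp add: case_prod_beta')
  show "(LINT p|(\<T> \<Otimes>\<^sub>M M). g (fst p)) = (LINT s|\<T>. g s)"
    using TM.integral_fst'[OF i] by (simp add: prob_space)
qed

lemma expectation_measurable [measurable]: "(\<lambda>s. LINT w|M. Y s w) \<in> borel_measurable borel"
  by (rule borel_measurable_lebesgue_integral[OF Y_pair])

lemma outer_expectation_measurable: "(\<lambda>s. outer (LINT w|M. Y s w) s) \<in> borel_measurable \<T>"
  using outer_measurable[OF expectation_measurable measurable_ident]
  by (simp cong: measurable_cong_sets)

text \<open>
  The location of a weakly subordinated process contains the first summand, and its large jumps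
  contribute the second. The first summand is integrable over time as a difference of two integrable
  functions, because the double integral over the ball may fail to converge absolutely.
\<close>

lemma split_iterated_integral:
  fixes f :: "real ^ 'n \<Rightarrow> real ^ 'n \<Rightarrow> 'b::{banach, second_countable_topology}"
  assumes f: "(\<lambda>(s, x). f s x) \<in> borel_measurable (borel \<Otimes>\<^sub>M borel)" and fin: "iterated_finite M X \<T> f"
  shows "(LINT s:orthant_star|\<T>. (LINT w|M. indicator (cball 0 1) (joinv s (at_time X s w)) *\<^sub>R f s (at_time X s w))) +
      (LINT p|(\<T> \<Otimes>\<^sub>M M). indicator (- cball 0 1) (joinv (fst p) (Y (fst p) (snd p))) *\<^sub>R f (fst p) (Y (fst p) (snd p))) =
      (LINT s:orthant_star|\<T>. (LINT w|M. f s (at_time X s w)))"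
proof -
  note D = iterated_finiteD[OF f fin]
  let ?in = "\<lambda>s w. indicator (cball 0 1) (joinv s (Y s w)) *\<^sub>R f s (Y s w)"
  let ?out = "\<lambda>s w. indicator (- cball 0 1) (joinv s (Y s w)) *\<^sub>R f s (Y s w)"
  have [measurable]: "(\<lambda>p. f (fst p) (snd p)) \<in> borel_measurable (borel \<Otimes>\<^sub>M borel)"
    using f by (simp add: case_prod_beta')
  have fin_m: "(\<lambda>(s, x). indicator (cball 0 1) (joinv s x) *\<^sub>R f s x) \<in> borel_measurable (borel \<Otimes>\<^sub>M borel)"
  proof -
    have j: "(\<lambda>p :: (real ^ 'n) \<times> (real ^ 'n). joinv (fst p) (snd p)) \<in> borel_measurable (borel \<Otimes>\<^sub>M borel)"
      by measurable
    have "(\<lambda>p :: (real ^ 'n) \<times> (real ^ 'n). indicator (cball 0 1) (joinv (fst p) (snd p)) :: real)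
        \<in> borel_measurable (borel \<Otimes>\<^sub>M borel)"
      by (rule measurable_compose[OF j borel_measurable_indicator]) simp
    then show ?thesis using f unfolding case_prod_beta' by (rule borel_measurable_scaleR)
  qed
  have o: "integrable \<T> (\<lambda>s. LINT w|M. ?out s w)"
    using TM.integrable_fst'[OF D(1)] by simp
  have ae: "AE s in \<T>. (LINT w|M. ?in s w) = (LINT w|M. f s (Y s w)) - (LINT w|M. ?out s w)"
    using D(2) TM.AE_integrable_fst'[OF D(1)]
  proof eventually_elim
    case (elim s)
    have "?in s w = f s (Y s w) - ?out s w" for w by (simp add: indicator_def)
    with elim show ?case by simp
  qed
  have m: "(\<lambda>s. LINT w|M. ?in s w) \<in> borel_measurable \<T>"
  proof (rule borel_measurable_lebesgue_integral)
    have "(\<lambda>p. (fst p, Y (fst p) (snd p))) \<in> measurable (\<T> \<Otimes>\<^sub>M M) (borel \<Otimes>\<^sub>M borel)" by measurable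
    from measurable_compose[OF this fin_m]
    show "(\<lambda>(s, w). ?in s w) \<in> borel_measurable (\<T> \<Otimes>\<^sub>M M)" by (simp add: case_prod_beta')
  qed
  have "(LINT s|\<T>. (LINT w|M. ?in s w)) = (LINT s|\<T>. (LINT w|M. f s (Y s w)) - (LINT w|M. ?out s w))"
    using D(3) o by (intro integral_cong_AE ae m) auto
  also have "\<dots> = (LINT s|\<T>. (LINT w|M. f s (Y s w))) - (LINT s|\<T>. (LINT w|M. ?out s w))"
    by (rule Bochner_Integration.integral_diff[OF D(3) o])
  also have "(LINT s|\<T>. (LINT w|M. ?out s w)) = (LINT p|(\<T> \<Otimes>\<^sub>M M). ?out (fst p) (snd p))"
    using TM.integral_fst'[OF D(1)] by (simp add: case_prod_beta')
  finally show ?thesis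
    unfolding iterated_integral(2)[OF fin_m] iterated_integral(2)[OF f] by simp
qed

lemma iterated_finite_time:
  assumes "integrable \<T> (\<lambda>s. s)"
  shows "iterated_finite M X \<T> (\<lambda>s x. s)"
  unfolding iterated_finite_def
proof (intro conjI)
  show "AE s in \<T>. integrable M (\<lambda>w. s)" by simp
  show "set_integrable \<T> orthant_star (\<lambda>s. LINT w|M. s)"
    using orthant_integral(1)[of "\<lambda>s. LINT w|M. s" "\<lambda>s. s"] assms by (simp add: prob_space)
  have "(\<integral>\<^sup>+s\<in>orthant_star. (\<integral>\<^sup>+w. ennreal (norm s) * indicator (- cball 0 1) (joinv s (at_time X s w)) \<partial>M) \<partial>\<T>)
      \<le> (\<integral>\<^sup>+s. ennreal (norm s) \<partial>\<T>)"
  proof (rule nn_integral_mono)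
    fix s :: "real ^ 'n"
    have "(\<integral>\<^sup>+w. ennreal (norm s) * indicator (- cball 0 1) (joinv s (at_time X s w)) \<partial>M) \<le>
        (\<integral>\<^sup>+w. ennreal (norm s) \<partial>M)"
      by (intro nn_integral_mono) (simp add: indicator_def)
    then show "(\<integral>\<^sup>+w. ennreal (norm s) * indicator (- cball 0 1) (joinv s (at_time X s w)) \<partial>M) *
        indicator orthant_star s \<le> ennreal (norm s)"
      by (simp add: emeasure_space_1 indicator_def)
  qed
  also have "\<dots> < \<infinity>" using assms by (simp add: integrable_iff_bounded)
  finally show "(\<integral>\<^sup>+s\<in>orthant_star. (\<integral>\<^sup>+w. ennreal (norm s) * indicator (- cball 0 1) (joinv s (at_time X s w)) \<partial>M) \<partial>\<T>) < \<infinity>" .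
qed

context
  fixes \<X> :: "(real ^ 'n) measure" and d \<mu> :: "real ^ 'n" and \<Z> :: "(real ^ ('n + 'n)) measure"
  assumes Z: "is_weak_levy_measure M X \<X> d \<T> \<Z>"
begin

text \<open>
  Joining with 0 preserves the norm, so the truncation at the unit ball of the joint space
  becomes the truncation at the unit ball for the jumps governed by \<open>d \<diamond> \<X>\<close>.
\<close>

lemma set_integral_weak_levy:
  fixes f :: "real ^ ('n + 'n) \<Rightarrow> real"
  assumes [measurable]: "f \<in> borel_measurable borel"
    and 1: "set_integrable (diamond_measure d \<X>) (- cball 0 1) (\<lambda>x. f (joinv 0 x))"
    and 2: "integrable (\<T> \<Otimes>\<^sub>M M) (\<lambda>(s, w). indicator (- cball 0 1) (joinv s (Y s w)) *\<^sub>R f (joinv s (Y s w)))"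
  shows "set_integrable \<Z> (- cball 0 1) f"
    and "(LINT z:- cball 0 1|\<Z>. f z) = (LINT x:- cball 0 1|diamond_measure d \<X>. f (joinv 0 x)) +
      (LINT p|(\<T> \<Otimes>\<^sub>M M). indicator (- cball 0 1) (joinv (fst p) (Y (fst p) (snd p))) *\<^sub>R
        f (joinv (fst p) (Y (fst p) (snd p))))"
proof -
  have m: "(\<lambda>z. indicator (- cball 0 1) z *\<^sub>R f z) \<in> borel_measurable borel" by measurable
  have ball: "indicator (- cball 0 1) (joinv 0 x) = (indicator (- cball 0 1) x :: real)" for x :: "real ^ 'n"
    by (simp add: indicator_def)
  show i: "set_integrable \<Z> (- cball 0 1) f"
    using weak_levy_measure_integral(1)[OF Z m] 1 2 unfolding set_integrable_def ball by simp
  show "(LINT z:- cball 0 1|\<Z>. f z) = (LINT x:- cball 0 1|diamond_measure d \<X>. f (joinv 0 x)) +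
      (LINT p|(\<T> \<Otimes>\<^sub>M M). indicator (- cball 0 1) (joinv (fst p) (Y (fst p) (snd p))) *\<^sub>R
        f (joinv (fst p) (Y (fst p) (snd p))))"
    using weak_levy_measure_integral(2)[OF Z m] i unfolding set_integrable_def set_lebesgue_integral_def ball
    by simp
qed

lemma time_levy_mean:
  assumes T: "integrable \<T> (\<lambda>s. s)"
  shows "set_integrable \<Z> (- cball 0 1) (\<lambda>z. z $ Inl l)"
    and "levy_mean (joinv (weak_loc1 M X d \<T>) m2) \<Z> (Inl l) = (d + (LINT s|\<T>. s)) $ l"
proof -
  have f: "(\<lambda>(s :: real ^ 'n, x :: real ^ 'n). s) \<in> borel_measurable (borel \<Otimes>\<^sub>M borel)" by measurable
  note fin = iterated_finite_time[OF T]
  note D = iterated_finiteD[OF f fin]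
  have i: "integrable (\<T> \<Otimes>\<^sub>M M) (\<lambda>p. indicator (- cball 0 1) (joinv (fst p) (Y (fst p) (snd p))) *\<^sub>R fst p)"
    using D(1) by (simp add: case_prod_beta')
  from i[unfolded integrable_vec_iff[where 'b=real]]
  have il: "integrable (\<T> \<Otimes>\<^sub>M M) (\<lambda>p. indicator (- cball 0 1) (joinv (fst p) (Y (fst p) (snd p))) *\<^sub>R fst p $ l)"
    by simp
  have S: "set_integrable (diamond_measure d \<X>) (- cball 0 1) (\<lambda>x. joinv 0 x $ Inl l)"
    by (simp add: set_integrable_def)
  show "set_integrable \<Z> (- cball 0 1) (\<lambda>z. z $ Inl l)"
    by (rule set_integral_weak_levy(1)[OF _ S]) (use il in \<open>simp_all add: case_prod_beta'\<close>)
  have "(LINT z:- cball 0 1|\<Z>. z $ Inl l) =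
      (LINT p|(\<T> \<Otimes>\<^sub>M M). indicator (- cball 0 1) (joinv (fst p) (Y (fst p) (snd p))) *\<^sub>R fst p $ l)"
    by (subst set_integral_weak_levy(2)[OF _ S]) (use il in \<open>simp_all add: case_prod_beta'\<close>)
  also have "\<dots> = (LINT p|(\<T> \<Otimes>\<^sub>M M). indicator (- cball 0 1) (joinv (fst p) (Y (fst p) (snd p))) *\<^sub>R fst p) $ l"
    by (subst integral_vec_nth[OF i]) simp
  finally have out: "(LINT z:- cball 0 1|\<Z>. z $ Inl l) =
      (LINT p|(\<T> \<Otimes>\<^sub>M M). indicator (- cball 0 1) (joinv (fst p) (Y (fst p) (snd p))) *\<^sub>R fst p) $ l" .
  have "(LINT s:orthant_star|\<T>. measure M {w \<in> space M. joinv s (at_time X s w) \<in> cball 0 1} *\<^sub>R s) =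
      (LINT s:orthant_star|\<T>. (LINT w|M. indicator (cball 0 1) (joinv s (at_time X s w)) *\<^sub>R s))"
    unfolding set_lebesgue_integral_def
  proof (intro Bochner_Integration.integral_cong refl)
    fix s
    show "indicator orthant_star s *\<^sub>R measure M {w \<in> space M. joinv s (at_time X s w) \<in> cball 0 1} *\<^sub>R s =
        indicator orthant_star s *\<^sub>R (LINT w|M. indicator (cball 0 1) (joinv s (at_time X s w)) *\<^sub>R s)"
    proof (cases "s \<in> orthant_star")
      case True
      then have [measurable]: "at_time X s \<in> borel_measurable M" by (intro X_meas) (simp add: orthant_star_def)
      have "(LINT w|M. indicator (cball 0 1) (joinv s (at_time X s w)) :: real) =
          (LINT w|M. indicator {w \<in> space M. joinv s (at_time X s w) \<in> cball 0 1} w)"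
        by (intro Bochner_Integration.integral_cong refl) (simp add: indicator_def)
      also have "\<dots> = measure M {w \<in> space M. joinv s (at_time X s w) \<in> cball 0 1}"
        by (simp add: Int_absorb2 subset_eq)
      finally have e: "(LINT w|M. indicator (cball 0 1) (joinv s (at_time X s w))) =
          measure M {w \<in> space M. joinv s (at_time X s w) \<in> cball 0 1}" .
      have "integrable M (\<lambda>w. indicator (cball 0 1) (joinv s (at_time X s w)) :: real)"
        by (rule integrable_const_bound[where B = 1]) (auto simp: indicator_def)
      then show ?thesis by (simp add: e)
    qed simp
  qed
  with split_iterated_integral[OF f fin]
  have "(LINT s:orthant_star|\<T>. measure M {w \<in> space M. joinv s (at_time X s w) \<in> cball 0 1} *\<^sub>R s) +
      (LINT p|(\<T> \<Otimes>\<^sub>M M). indicator (- cball 0 1) (joinv (fst p) (Y (fst p) (snd p))) *\<^sub>R fst p) =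
      (LINT s:orthant_star|\<T>. (LINT w|M. s))" by simp
  also have "\<dots> = (LINT s|\<T>. s)"
    by (rule orthant_integral(2)) (simp_all add: prob_space)
  finally show "levy_mean (joinv (weak_loc1 M X d \<T>) m2) \<Z> (Inl l) = (d + (LINT s|\<T>. s)) $ l"
    unfolding levy_mean_def out joinv_nth weak_loc1_def by (simp flip: vector_add_component add: add.assoc)
qed

lemma subordinated_levy_mean:
  assumes D: "set_integrable (diamond_measure d \<X>) (- cball 0 1) (\<lambda>x. x)"
    and fin: "iterated_finite M X \<T> (\<lambda>s x. x)"
  shows "set_integrable \<Z> (- cball 0 1) (\<lambda>z. z $ Inr k)"
    and "levy_mean (joinv m1 (weak_loc2 M X \<mu> \<X> d \<T>)) \<Z> (Inr k) =
      (diamond_corr d \<X> + diamond_vec d \<mu> + (LINT x:- cball 0 1|diamond_measure d \<X>. x) +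
        (LINT s:orthant_star|\<T>. (LINT w|M. at_time X s w))) $ k"
proof -
  have f: "(\<lambda>(s :: real ^ 'n, x :: real ^ 'n). x) \<in> borel_measurable (borel \<Otimes>\<^sub>M borel)" by measurable
  let ?R = "LINT p|(\<T> \<Otimes>\<^sub>M M). indicator (- cball 0 1) (joinv (fst p) (Y (fst p) (snd p))) *\<^sub>R Y (fst p) (snd p)"
  have i: "integrable (\<T> \<Otimes>\<^sub>M M) (\<lambda>p. indicator (- cball 0 1) (joinv (fst p) (Y (fst p) (snd p))) *\<^sub>R Y (fst p) (snd p))"
    using iterated_finiteD(1)[OF f fin] by (simp add: case_prod_beta')
  from i[unfolded integrable_vec_iff[where 'b=real]]
  have ik: "integrable (\<T> \<Otimes>\<^sub>M M) (\<lambda>p. indicator (- cball 0 1) (joinv (fst p) (Y (fst p) (snd p))) *\<^sub>R Y (fst p) (snd p) $ k)"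
    by simp
  have Dk: "set_integrable (diamond_measure d \<X>) (- cball 0 1) (\<lambda>x. joinv 0 x $ Inr k)"
    using D unfolding set_integrable_def integrable_vec_iff[where 'b=real] by simp
  show "set_integrable \<Z> (- cball 0 1) (\<lambda>z. z $ Inr k)"
    by (rule set_integral_weak_levy(1)[OF _ Dk]) (use ik in \<open>simp_all add: case_prod_beta'\<close>)
  have "(LINT z:- cball 0 1|\<Z>. z $ Inr k) = (LINT x:- cball 0 1|diamond_measure d \<X>. x $ k) +
      (LINT p|(\<T> \<Otimes>\<^sub>M M). indicator (- cball 0 1) (joinv (fst p) (Y (fst p) (snd p))) *\<^sub>R Y (fst p) (snd p) $ k)"
    by (subst set_integral_weak_levy(2)[OF _ Dk]) (use ik in \<open>simp_all add: case_prod_beta'\<close>)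
  also have "(LINT p|(\<T> \<Otimes>\<^sub>M M). indicator (- cball 0 1) (joinv (fst p) (Y (fst p) (snd p))) *\<^sub>R Y (fst p) (snd p) $ k) = ?R $ k"
    by (subst integral_vec_nth[OF i]) simp
  also have "(LINT x:- cball 0 1|diamond_measure d \<X>. x $ k) = (LINT x:- cball 0 1|diamond_measure d \<X>. x) $ k"
    unfolding set_lebesgue_integral_def
    by (subst integral_vec_nth[OF D[unfolded set_integrable_def]]) simp
  finally have out: "(LINT z:- cball 0 1|\<Z>. z $ Inr k) = (LINT x:- cball 0 1|diamond_measure d \<X>. x) $ k + ?R $ k" .
  from split_iterated_integral[OF f fin]
  have "(LINT s:orthant_star|\<T>. (LINT w|M. indicator (cball 0 1) (joinv s (at_time X s w)) *\<^sub>R at_time X s w)) + ?R =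
      (LINT s:orthant_star|\<T>. (LINT w|M. at_time X s w))" by simp
  then show "levy_mean (joinv m1 (weak_loc2 M X \<mu> \<X> d \<T>)) \<Z> (Inr k) =
      (diamond_corr d \<X> + diamond_vec d \<mu> + (LINT x:- cball 0 1|diamond_measure d \<X>. x) +
        (LINT s:orthant_star|\<T>. (LINT w|M. at_time X s w))) $ k"
    unfolding levy_mean_def out joinv_nth weak_loc2_def by (simp flip: vector_add_component add: algebra_simps)
qed

lemma time_second_moment:
  assumes T: "set_integrable \<T> orthant_star (\<lambda>s. outer s s)"
  shows "integrable \<Z> (\<lambda>z. z $ Inl k * z $ Inl l)"
    and "(LINT z|\<Z>. z $ Inl k * z $ Inl l) = (LINT s:orthant_star|\<T>. outer s s) $ k $ l"
proof -
  have T': "integrable \<T> (\<lambda>s. outer s s)" "(LINT s:orthant_star|\<T>. outer s s) = (LINT s|\<T>. outer s s)"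
    using T orthant_integral[of "\<lambda>s. outer s s" "\<lambda>s. outer s s"] by auto
  have k: "integrable \<T> (\<lambda>s. outer s s $ k)"
    using T'(1) integrable_vec_iff[of \<T> "\<lambda>s. outer s s"] by blast
  have kl: "integrable \<T> (\<lambda>s. outer s s $ k $ l)"
    using k integrable_vec_iff[of \<T> "\<lambda>s. outer s s $ k"] by blast
  then have kl': "integrable \<T> (\<lambda>s. s $ k * s $ l)" by simp
  have m: "(\<lambda>z. z $ Inl k * z $ Inl l) \<in> borel_measurable (borel :: (real ^ ('n + 'n)) measure)" by measurable
  show i: "integrable \<Z> (\<lambda>z. z $ Inl k * z $ Inl l)"
    using weak_levy_measure_integral(1)[OF Z m] integral_fst_only(1)[OF kl'] by simp
  have "(LINT z|\<Z>. z $ Inl k * z $ Inl l) = (LINT s|\<T>. outer s s $ k $ l)"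
    using weak_levy_measure_integral(2)[OF Z m i] integral_fst_only(2)[OF kl'] by simp
  then show "(LINT z|\<Z>. z $ Inl k * z $ Inl l) = (LINT s:orthant_star|\<T>. outer s s) $ k $ l"
    unfolding T'(2) by (simp only: integral_vec_nth[OF T'(1)] integral_vec_nth[OF k])
qed

lemma subordinated_second_moment:
  assumes D: "set_integrable (diamond_measure d \<X>) (- {0}) (\<lambda>x. outer x x)"
    and fin: "iterated_finite M X \<T> (\<lambda>s x. outer x x)"
  shows "integrable \<Z> (\<lambda>z. z $ Inr k * z $ Inr l)"
    and "(LINT z|\<Z>. z $ Inr k * z $ Inr l) = (LINT x:- {0}|diamond_measure d \<X>. outer x x) $ k $ l +
      (LINT s:orthant_star|\<T>. (LINT w|M. outer (at_time X s w) (at_time X s w))) $ k $ l"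
proof -
  have f: "(\<lambda>(s :: real ^ 'n, x :: real ^ 'n). outer x x) \<in> borel_measurable (borel \<Otimes>\<^sub>M borel)" by measurable
  note I = iterated_finiteD[OF f fin]
  let ?O = "\<lambda>s w. outer (Y s w) (Y s w)"
  have "(\<lambda>x :: real ^ 'n. indicator (- {0}) x *\<^sub>R outer x x) = (\<lambda>x. outer x x)"
    by (auto simp: fun_eq_iff vec_eq_iff indicator_def)
  then have D': "integrable (diamond_measure d \<X>) (\<lambda>x. outer x x)"
    and D'': "(LINT x:- {0}|diamond_measure d \<X>. outer x x) = (LINT x|diamond_measure d \<X>. outer x x)"
    using D by (simp_all add: set_integrable_def set_lebesgue_integral_def)
  have Dk: "integrable (diamond_measure d \<X>) (\<lambda>x. outer x x $ k)"
    using D' integrable_vec_iff[of "diamond_measure d \<X>" "\<lambda>x. outer x x"] by blast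
  have Dkl: "integrable (diamond_measure d \<X>) (\<lambda>x. outer x x $ k $ l)"
    using Dk integrable_vec_iff[of "diamond_measure d \<X>" "\<lambda>x. outer x x $ k"] by blast
  have inner: "AE s in \<T>. integrable M (\<lambda>w. Y s w $ i * Y s w $ j) \<and>
      (LINT w|M. Y s w $ i * Y s w $ j) = (LINT w|M. ?O s w) $ i $ j" for i j
    using I(2)
  proof eventually_elim
    case (elim s)
    have i: "integrable M (\<lambda>w. ?O s w $ i)" using elim integrable_vec_iff[of M "?O s"] by blast
    have "integrable M (\<lambda>w. ?O s w $ i $ j)" using i integrable_vec_iff[of M "\<lambda>w. ?O s w $ i"] by blast
    moreover have "(LINT w|M. ?O s w) $ i $ j = (LINT w|M. ?O s w $ i $ j)"
      by (simp only: integral_vec_nth[OF elim] integral_vec_nth[OF i])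
    ultimately show ?case by simp
  qed
  have outer_int: "integrable \<T> (\<lambda>s. (LINT w|M. ?O s w) $ i $ j)" for i j
    by (intro integrable_bounded_linear[OF bounded_linear_vec_nth] I(3))
  \<comment> \<open>The diagonal entries are nonnegative, so finite iterated integrals are finite double integrals;
    the other entries are dominated by the diagonal ones.\<close>
  have sq: "integrable (\<T> \<Otimes>\<^sub>M M) (\<lambda>p. Y (fst p) (snd p) $ i * Y (fst p) (snd p) $ i)" for i
  proof (rule TM.Fubini_integrable)
    have "integrable \<T> (\<lambda>s. LINT w|M. Y s w $ i * Y s w $ i)"
    proof (rule integrable_cong_AE_imp[OF outer_int[of i i]])
      show "AE s in \<T>. (LINT w|M. ?O s w) $ i $ i = (LINT w|M. Y s w $ i * Y s w $ i)"
        using inner[of i i] by eventually_elim simp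
    qed measurable
    then show "integrable \<T> (\<lambda>s. LINT w|M. norm (Y (fst (s, w)) (snd (s, w)) $ i * Y (fst (s, w)) (snd (s, w)) $ i))"
      by simp
    show "AE s in \<T>. integrable M (\<lambda>w. Y (fst (s, w)) (snd (s, w)) $ i * Y (fst (s, w)) (snd (s, w)) $ i)"
      using inner[of i i] by (auto elim!: eventually_mono)
  qed measurable
  have P: "integrable (\<T> \<Otimes>\<^sub>M M) (\<lambda>p. Y (fst p) (snd p) $ k * Y (fst p) (snd p) $ l)"
  proof (rule Bochner_Integration.integrable_bound[OF Bochner_Integration.integrable_add[OF sq[of k] sq[of l]]])
    have "\<bar>x * y\<bar> \<le> \<bar>x * x + y * y\<bar>" for x y :: real
    proof -
      have "2 * \<bar>x * y\<bar> \<le> x * x + y * y"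
        using sum_squares_bound[of "\<bar>x\<bar>" "\<bar>y\<bar>"] by (simp add: abs_mult power2_eq_square)
      then show ?thesis by linarith
    qed
    then show "AE p in \<T> \<Otimes>\<^sub>M M. norm (Y (fst p) (snd p) $ k * Y (fst p) (snd p) $ l) \<le>
        norm (Y (fst p) (snd p) $ k * Y (fst p) (snd p) $ k + Y (fst p) (snd p) $ l * Y (fst p) (snd p) $ l)"
      by (intro AE_I2) simp
  qed measurable
  have m: "(\<lambda>z. z $ Inr k * z $ Inr l) \<in> borel_measurable (borel :: (real ^ ('n + 'n)) measure)" by measurable
  show i: "integrable \<Z> (\<lambda>z. z $ Inr k * z $ Inr l)"
    using weak_levy_measure_integral(1)[OF Z m] P Dkl by (simp add: case_prod_beta')
  have "(LINT p|(\<T> \<Otimes>\<^sub>M M). Y (fst p) (snd p) $ k * Y (fst p) (snd p) $ l) =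
      (LINT s|\<T>. (LINT w|M. Y s w $ k * Y s w $ l))"
    using TM.integral_fst'[OF P] by simp
  also have "\<dots> = (LINT s|\<T>. (LINT w|M. ?O s w) $ k $ l)"
    by (rule integral_cong_AE) (use inner[of k l] outer_int[of k l] in \<open>auto elim!: eventually_mono\<close>)
  also have "\<dots> = (LINT s|\<T>. (LINT w|M. ?O s w)) $ k $ l"
    using integral_vec_nth[OF I(3), of k]
      integral_vec_nth[OF integrable_bounded_linear[OF bounded_linear_vec_nth I(3)], of k l] by simp
  finally have "(LINT p|(\<T> \<Otimes>\<^sub>M M). Y (fst p) (snd p) $ k * Y (fst p) (snd p) $ l) =
      (LINT s:orthant_star|\<T>. (LINT w|M. outer (at_time X s w) (at_time X s w))) $ k $ l"
    by (simp only: iterated_integral(2)[OF f])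
  moreover have "(LINT x|diamond_measure d \<X>. x $ k * x $ l) = (LINT x:- {0}|diamond_measure d \<X>. outer x x) $ k $ l"
    unfolding D'' by (simp only: integral_vec_nth[OF D'] integral_vec_nth[OF Dk] outer_nth)
  ultimately show "(LINT z|\<Z>. z $ Inr k * z $ Inr l) = (LINT x:- {0}|diamond_measure d \<X>. outer x x) $ k $ l +
      (LINT s:orthant_star|\<T>. (LINT w|M. outer (at_time X s w) (at_time X s w))) $ k $ l"
    using weak_levy_measure_integral(2)[OF Z m i] by simp
qed

text \<open>
  Inside the ball the product of two coordinates is dominated by the squared norm, which every Levy
  measure integrates there; outside it, absolute convergence is part of the hypothesis.
\<close>

lemma mixed_second_moment:
  assumes \<Z>: "levy_measure \<Z>" and mean: "iterated_finite M X \<T> (\<lambda>s x. x)"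
    and fin: "iterated_finite M X \<T> (\<lambda>s x. outer x s)"
  shows "integrable \<Z> (\<lambda>z. z $ Inr k * z $ Inl l)"
    and "(LINT z|\<Z>. z $ Inr k * z $ Inl l) = (LINT s:orthant_star|\<T>. outer (LINT w|M. at_time X s w) s) $ k $ l"
proof -
  have f: "(\<lambda>(s :: real ^ 'n, x :: real ^ 'n). outer x s) \<in> borel_measurable (borel \<Otimes>\<^sub>M borel)"
    unfolding case_prod_beta' by measurable
  have x: "(\<lambda>(s :: real ^ 'n, x :: real ^ 'n). x) \<in> borel_measurable (borel \<Otimes>\<^sub>M borel)" by measurable
  note I = iterated_finiteD[OF f fin]
  have m: "(\<lambda>z. z $ Inr k * z $ Inl l) \<in> borel_measurable (borel :: (real ^ ('n + 'n)) measure)" by measurable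
  have "integrable (\<T> \<Otimes>\<^sub>M M) (\<lambda>p. (indicator (- cball 0 1) (joinv (fst p) (Y (fst p) (snd p))) *\<^sub>R
      outer (Y (fst p) (snd p)) (fst p)) $ k $ l)"
    using I(1) by (intro integrable_bounded_linear[OF bounded_linear_vec_nth]) (simp add: case_prod_beta')
  then have out: "integrable (\<T> \<Otimes>\<^sub>M M) (\<lambda>p. indicator (- cball 0 1) (joinv (fst p) (Y (fst p) (snd p))) *\<^sub>R
      (Y (fst p) (snd p) $ k * fst p $ l))" by simp
  have D: "set_integrable (diamond_measure d \<X>) (- cball 0 1) (\<lambda>x. joinv 0 x $ Inr k * joinv 0 x $ Inl l)"
    by (simp add: set_integrable_def)
  have "set_integrable \<Z> (- cball 0 1) (\<lambda>z. z $ Inr k * z $ Inl l)"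
    by (rule set_integral_weak_levy(1)[OF m D]) (use out in \<open>simp add: case_prod_beta'\<close>)
  then show i: "integrable \<Z> (\<lambda>z. z $ Inr k * z $ Inl l)"
  proof (rule integrable_levy_split[OF \<Z> m])
    fix z :: "real ^ ('n + 'n)"
    show "\<bar>z $ Inr k * z $ Inl l\<bar> \<le> 1 * (norm z)\<^sup>2"
      unfolding abs_mult power2_eq_square mult_1 by (intro mult_mono Finite_Cartesian_Product.component_le_norm_cart) auto
  qed
  have P: "integrable (\<T> \<Otimes>\<^sub>M M) (\<lambda>p. Y (fst p) (snd p) $ k * fst p $ l)"
    using i weak_levy_measure_integral(1)[OF Z m] by (simp add: case_prod_beta')
  have "(LINT z|\<Z>. z $ Inr k * z $ Inl l) = (LINT p|(\<T> \<Otimes>\<^sub>M M). Y (fst p) (snd p) $ k * fst p $ l)"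
    using weak_levy_measure_integral(2)[OF Z m i] by simp
  also have "\<dots> = (LINT s|\<T>. (LINT w|M. Y s w $ k * s $ l))" using TM.integral_fst'[OF P] by simp
  also have "\<dots> = (LINT s|\<T>. outer (LINT w|M. Y s w) s $ k $ l)"
  proof (rule integral_cong_AE)
    show "AE s in \<T>. (LINT w|M. Y s w $ k * s $ l) = outer (LINT w|M. Y s w) s $ k $ l"
      using iterated_finiteD(2)[OF x mean] by eventually_elim (simp add: integral_vec_nth)
  qed measurable
  also have "\<dots> = (LINT s|\<T>. outer (LINT w|M. Y s w) s) $ k $ l"
  proof -
    have ae: "AE s in \<T>. (LINT w|M. outer (Y s w) s) = outer (LINT w|M. Y s w) s"
      using iterated_finiteD(2)[OF x mean] I(2)
    proof eventually_elim
      case (elim s)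
      have i: "integrable M (\<lambda>w. outer (Y s w) s $ i)" for i
        using elim(2) integrable_vec_iff[of M "\<lambda>w. outer (Y s w) s"] by blast
      show ?case
        by (simp only: vec_eq_iff integral_vec_nth[OF elim(2)] integral_vec_nth[OF i] outer_nth integral_vec_nth[OF elim(1)])
          simp
    qed
    have i: "integrable \<T> (\<lambda>s. outer (LINT w|M. Y s w) s)"
      by (rule integrable_cong_AE_imp[OF I(3) outer_expectation_measurable ae])
    show ?thesis
      using integral_vec_nth[OF i, of k]
        integral_vec_nth[OF integrable_bounded_linear[OF bounded_linear_vec_nth i], of k l] by simp
  qed
  also have "(LINT s|\<T>. outer (LINT w|M. Y s w) s) = (LINT s:orthant_star|\<T>. outer (LINT w|M. at_time X s w) s)"
  proof (rule orthant_integral(2)[OF _ outer_expectation_measurable, symmetric])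
    show "outer (LINT w|M. at_time X s w) s = outer (LINT w|M. Y s w) s" if "s \<in> orthant_star" for s
      using expectation_version(2)[OF that, of "\<lambda>x. x"] by simp
  qed
  finally show "(LINT z|\<Z>. z $ Inr k * z $ Inl l) = (LINT s:orthant_star|\<T>. outer (LINT w|M. at_time X s w) s) $ k $ l" .
qed

end

end

section \<open>Moments under weak subordination\<close>

lemma weak_cov_nth [simp]:
  "weak_cov d \<Sigma> $ Inl k $ j = 0" "weak_cov d \<Sigma> $ Inr k $ Inl l = 0"
  "weak_cov d \<Sigma> $ Inr k $ Inr l = diamond_mat d \<Sigma> $ k $ l"
  by (simp_all add: weak_cov_def)

lemma distr_eq_from_char:
  fixes U :: "'a \<Rightarrow> real" and V :: "'b \<Rightarrow> real"
  assumes M: "prob_space M" and N: "prob_space N"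
    and U: "U \<in> borel_measurable M" and V: "V \<in> borel_measurable N"
    and eq: "\<And>a. (LINT w|M. iexp (a * U w)) = (LINT w|N. iexp (a * V w))"
  shows "distr M borel U = distr N borel V"
proof (rule Levy_uniqueness)
  show "real_distribution (distr M borel U)" "real_distribution (distr N borel V)"
    using assms by (auto intro: prob_space.real_distribution_distr)
  show "char (distr M borel U) = char (distr N borel V)"
    unfolding char_def using eq by (auto simp: fun_eq_iff integral_distr[OF U] integral_distr[OF V])
qed

lemma subordinator_mean:
  assumes T: "subordinator M' T d \<T>" and i: "integrable \<T> (\<lambda>s. s)"
  shows "levy_mean (d + (LINT s:cball 0 1|\<T>. s)) \<T> l = (d + (LINT s|\<T>. s)) $ l"
proof -
  have [measurable_cong]: "sets \<T> = sets borel"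
    using T by (auto simp: subordinator_def levy_triplet_def levy_measure_def)
  have il: "integrable \<T> (\<lambda>s. s $ l)" using i by (simp add: integrable_vec_iff)
  have c: "integrable \<T> (\<lambda>s. indicator (cball 0 1) s *\<^sub>R s)"
    by (rule Bochner_Integration.integrable_bound[OF i]) (auto simp: indicator_def)
  have o: "integrable \<T> (\<lambda>s. indicator (- cball 0 1) s *\<^sub>R s $ l)"
    by (rule Bochner_Integration.integrable_bound[OF il]) (auto simp: indicator_def)
  have ck: "integrable \<T> (\<lambda>s. indicator (cball 0 1) s *\<^sub>R s $ l)"
    by (rule Bochner_Integration.integrable_bound[OF il]) (auto simp: indicator_def)
  have "(LINT s|\<T>. indicator (cball 0 1) s *\<^sub>R s $ l) + (LINT s|\<T>. indicator (- cball 0 1) s *\<^sub>R s $ l) =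
      (LINT s|\<T>. indicator (cball 0 1) s *\<^sub>R s $ l + indicator (- cball 0 1) s *\<^sub>R s $ l)"
    by (rule Bochner_Integration.integral_add[OF ck o, symmetric])
  also have "\<dots> = (LINT s|\<T>. s $ l)"
    by (intro Bochner_Integration.integral_cong refl) (simp add: indicator_def)
  finally show ?thesis
    using integral_vec_nth[OF c, of l] integral_vec_nth[OF i, of l]
    by (simp add: levy_mean_def set_lebesgue_integral_def)
qed

text \<open>
  The first block of \<open>Z(t)\<close> is given through its triplet only. Its coordinates have the same centered
  exponents as those of the subordinator \<open>T(t)\<close>, hence the same laws, and \<open>T(t)\<close> is nonnegative because
  it increases from 0.
\<close>

lemma (in time_change) weak_time_nonneg:
  assumes T: "subordinator M' T d \<T>" and i: "integrable \<T> (\<lambda>s. s)" and t: "0 \<le> t"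
    and W: "is_weak_levy_measure M X \<X> d \<T> \<Z>"
    and Z: "levy_triplet N Z (joinv (weak_loc1 M X d \<T>) m2) (weak_cov d \<Sigma>) \<Z>"
  shows "AE w in N. 0 \<le> Z t w $ Inl l"
proof -
  have T3: "levy_triplet M' T (d + (LINT s:cball 0 1|\<T>. s)) 0 \<T>" using T by (simp add: subordinator_def)
  have il: "integrable \<T> (\<lambda>s. s $ l)" using i by (simp add: integrable_vec_iff)
  have out: "set_integrable \<T> (- cball 0 1) (\<lambda>s. s $ l)" unfolding set_integrable_def
    by (rule Bochner_Integration.integrable_bound[OF il]) (auto simp: indicator_def)
  have mj: "mean_jump \<T> (\<lambda>s. a * s $ l)" for a
    by (rule mean_jump_mult[OF mean_jump_nth[OF T3 t out]])
  note Zout = time_levy_mean(1)[OF W i, of l]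
  have mjZ: "mean_jump \<Z> (\<lambda>z. a * z $ Inl l)" for a
    by (rule mean_jump_mult[OF mean_jump_nth[OF Z t Zout]])
  have "(LINT w|N. iexp (a * Z t w $ Inl l)) = (LINT w|M'. iexp (a * T t w $ l))" for a
  proof -
    have m: "(\<lambda>z. jump_kernel (a * z $ Inl l)) \<in> borel_measurable (borel :: (real ^ ('n + 'n)) measure)"
      by measurable
    have "(LINT z|\<Z>. jump_kernel (a * z $ Inl l)) = (LINT s|\<T>. jump_kernel (a * s $ l))"
      using weak_levy_measure_integral(2)[OF W m integrable_jump_kernel[OF mjZ]]
        integral_fst_only(2)[OF integrable_jump_kernel[OF mj]] by simp
    then show ?thesis
      using levy_triplet_char1[OF Z t Zout, of a] levy_triplet_char1[OF T3 t out, of a]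
      by (simp add: centered_exponent_def time_levy_mean(2)[OF W i] subordinator_mean[OF T i])
  qed
  then have eq: "distr N borel (\<lambda>w. Z t w $ Inl l) = distr M' borel (\<lambda>w. T t w $ l)"
    by (intro distr_eq_from_char levy_triplet_facts[OF Z t] levy_triplet_facts[OF T3 t])
  have "AE w in M'. T 0 w = 0" using T3 by (auto simp: levy_triplet_def levy_process_def)
  moreover have "AE w in M'. \<forall>k r s. 0 \<le> r \<and> r \<le> s \<longrightarrow> T r w $ k \<le> T s w $ k"
    using T by (simp add: subordinator_def)
  ultimately have "AE w in M'. 0 \<le> T t w $ l"
  proof eventually_elim
    case (elim w)
    then have "T 0 w $ l \<le> T t w $ l" using t by blast
    with elim show ?case by simp
  qed
  then have "AE x in distr M' borel (\<lambda>w. T t w $ l). 0 \<le> x"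
    by (subst AE_distr_iff[OF levy_triplet_facts(3)[OF T3 t]]) auto
  then show ?thesis unfolding eq[symmetric]
    by (subst (asm) AE_distr_iff[OF levy_triplet_facts(3)[OF Z t]]) auto
qed

lemma scaleR_inverse_eqI: "x /\<^sub>R t = y" if "0 < t" "x = t *\<^sub>R y" for x y :: "'a::real_vector" and t :: real
  using that by simp

theorem proposition3p6:
  fixes M :: "'a measure" and X :: "real \<Rightarrow> 'a \<Rightarrow> real ^ 'n::finite"
    and M' :: "'b measure" and T :: "real \<Rightarrow> 'b \<Rightarrow> real ^ 'n"
    and N :: "'c measure" and Z :: "real \<Rightarrow> 'c \<Rightarrow> real ^ ('n + 'n)"
    and \<mu> d :: "real ^ 'n" and \<Sigma> :: "real ^ 'n ^ 'n"
    and \<X> \<T> :: "(real ^ 'n) measure"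
    and t :: real
  assumes X: "levy_triplet M X \<mu> \<Sigma> \<X>"
    and T: "subordinator M' T d \<T>"
    and Z: "weakly_subordinates M X \<mu> \<Sigma> \<X> d \<T> N Z"
    and t: "t > 0"
  defines "T1 \<equiv> (\<lambda>w. fstv (Z t w))"
    and "XT \<equiv> (\<lambda>w. sndv (Z t w))"
    and "fin_mean_T \<equiv> set_integrable \<T> orthant_star (\<lambda>s. s)"
    and "fin_mean_XT \<equiv> set_integrable (diamond_measure d \<X>) (- cball 0 1) (\<lambda>x. x) \<and>
           iterated_finite M X \<T> (\<lambda>s x. x)"
  shows
    "(fin_mean_T \<longrightarrow>
        integrable N T1 \<and>
        (LINT w|N. T1 w) /\<^sub>R t = d + (LINT s:orthant_star|\<T>. s)) \<and>
     (set_integrable \<T> orthant_star (\<lambda>s. outer s s) \<longrightarrow>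
        cov_exists N T1 T1 \<and>
        cov N T1 T1 /\<^sub>R t = (LINT s:orthant_star|\<T>. outer s s)) \<and>
     (fin_mean_XT \<longrightarrow>
        integrable N XT \<and>
        (LINT w|N. XT w) /\<^sub>R t =
          diamond_corr d \<X> + diamond_vec d \<mu> + (LINT x:- cball 0 1|diamond_measure d \<X>. x) +
          (LINT s:orthant_star|\<T>. (LINT w|M. at_time X s w))) \<and>
     (set_integrable (diamond_measure d \<X>) (- {0}) (\<lambda>x. outer x x) \<and>
      iterated_finite M X \<T> (\<lambda>s x. outer x x) \<longrightarrow>
        cov_exists N XT XT \<and>
        cov N XT XT /\<^sub>R t =
          diamond_mat d \<Sigma> + (LINT x:- {0}|diamond_measure d \<X>. outer x x) +
          (LINT s:orthant_star|\<T>. (LINT w|M. outer (at_time X s w) (at_time X s w)))) \<and>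
     (fin_mean_T \<and> fin_mean_XT \<and> iterated_finite M X \<T> (\<lambda>s x. outer x s) \<longrightarrow>
        cov_exists N XT T1 \<and>
        cov N XT T1 /\<^sub>R t =
          (LINT s:orthant_star|\<T>. outer (LINT w|M. at_time X s w) s))"
proof -
  have XL: "levy_process M X" using X by (simp add: levy_triplet_def)
  obtain Y where Y: "(\<lambda>(s, w). Y s w) \<in> borel_measurable (borel \<Otimes>\<^sub>M M)"
    "\<And>s. s \<in> orthant \<Longrightarrow> AE w in M. Y s w = at_time X s w"
    using at_time_version[OF XL] by blast
  have T3: "levy_triplet M' T (d + (LINT s:cball 0 1|\<T>. s)) 0 \<T>"
    and T0: "emeasure \<T> (- orthant_star) = 0" using T by (auto simp: subordinator_def)
  then have LT: "levy_measure \<T>" by (simp add: levy_triplet_def)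
  then have sT: "sets \<T> = sets borel" by (simp add: levy_measure_def)
  have "- orthant_star \<in> null_sets \<T>" using T0 sT by auto
  from AE_not_in[OF this] have AEo: "AE s in \<T>. s \<in> orthant_star" by simp
  interpret time_change M X Y \<T>
  proof (intro time_change.intro time_change_axioms.intro)
    show "prob_space M" using XL by (simp add: levy_process_def)
  qed (fact sT levy_measure_sigma_finite[OF LT] AEo Y at_time_measurable[OF XL])+
  obtain \<Z> where W: "is_weak_levy_measure M X \<X> d \<T> \<Z>"
    and L: "levy_triplet N Z (joinv (weak_loc1 M X d \<T>) (weak_loc2 M X \<mu> \<X> d \<T>)) (weak_cov d \<Sigma>) \<Z>"
    using Z by (auto simp: weakly_subordinates_def)
  have t0: "0 \<le> t" using t by simp
  note N = levy_triplet_facts(1)[OF L t0]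
  note L\<Z> = levy_triplet_facts(2)[OF L t0]
  note mean = levy_triplet_mean[OF L t0]
  note covariance = levy_triplet_covariance[OF L t0]
  have square: "integrable N (\<lambda>w. Z t w $ i * Z t w $ j)"
    if "integrable \<Z> (\<lambda>z. z $ i * z $ i)" "integrable \<Z> (\<lambda>z. z $ j * z $ j)" for i j
  proof (rule Bochner_Integration.integrable_bound)
    show "integrable N (\<lambda>w. (Z t w $ i)\<^sup>2 + (Z t w $ j)\<^sup>2)"
      using that by (intro Bochner_Integration.integrable_add levy_triplet_square_integrable[OF L t0])
        (simp_all add: power2_eq_square)
    show "(\<lambda>w. Z t w $ i * Z t w $ j) \<in> borel_measurable N"
      by (intro borel_measurable_times levy_triplet_facts(3)[OF L t0])
    have "\<bar>x * y\<bar> \<le> \<bar>x\<^sup>2 + y\<^sup>2\<bar>" for x y :: real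
    proof -
      have "2 * \<bar>x * y\<bar> \<le> x\<^sup>2 + y\<^sup>2" using sum_squares_bound[of "\<bar>x\<bar>" "\<bar>y\<bar>"] by (simp add: abs_mult)
      then show ?thesis by linarith
    qed
    then show "AE w in N. norm (Z t w $ i * Z t w $ j) \<le> norm ((Z t w $ i)\<^sup>2 + (Z t w $ j)\<^sup>2)"
      by (intro AE_I2) simp
  qed
  have out: "set_integrable \<Z> (- cball 0 1) (\<lambda>z. z $ i)" if "integrable \<Z> (\<lambda>z. z $ i * z $ i)" for i
    using set_integrable_from_square[OF L t0, of i] that by (simp add: power2_eq_square)
  have fmT: "fin_mean_T \<longleftrightarrow> integrable \<T> (\<lambda>s. s)" and intT: "(LINT s:orthant_star|\<T>. s) = (LINT s|\<T>. s)"
    unfolding fin_mean_T_def using orthant_integral[of "\<lambda>s. s" "\<lambda>s. s"] by auto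
  have T1n: "T1 w $ k = Z t w $ Inl k" and XTn: "XT w $ k = Z t w $ Inr k" for w k
    by (simp_all add: T1_def XT_def)

  have meanT: "integrable N T1" "(LINT w|N. T1 w) /\<^sub>R t = d + (LINT s:orthant_star|\<T>. s)" if "fin_mean_T"
  proof -
    have i: "integrable \<T> (\<lambda>s. s)" using that fmT by simp
    note m = mean[OF time_levy_mean(1)[OF W i]]
    show I: "integrable N T1" unfolding integrable_vec_iff[of N T1] T1n using m(1) by blast
    show "(LINT w|N. T1 w) /\<^sub>R t = d + (LINT s:orthant_star|\<T>. s)"
      by (rule scaleR_inverse_eqI[OF t])
        (simp add: vec_eq_iff integral_vec_nth[OF I] T1n m(2) time_levy_mean(2)[OF W i] intT)
  qed
  have meanXT: "integrable N XT" "(LINT w|N. XT w) /\<^sub>R t =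
      diamond_corr d \<X> + diamond_vec d \<mu> + (LINT x:- cball 0 1|diamond_measure d \<X>. x) +
      (LINT s:orthant_star|\<T>. (LINT w|M. at_time X s w))" if "fin_mean_XT"
  proof -
    have i: "set_integrable (diamond_measure d \<X>) (- cball 0 1) (\<lambda>x. x)" "iterated_finite M X \<T> (\<lambda>s x. x)"
      using that by (auto simp: fin_mean_XT_def)
    note m = mean[OF subordinated_levy_mean(1)[OF W i]]
    show I: "integrable N XT" unfolding integrable_vec_iff[of N XT] XTn using m(1) by blast
    show "(LINT w|N. XT w) /\<^sub>R t =
      diamond_corr d \<X> + diamond_vec d \<mu> + (LINT x:- cball 0 1|diamond_measure d \<X>. x) +
      (LINT s:orthant_star|\<T>. (LINT w|M. at_time X s w))"
      by (rule scaleR_inverse_eqI[OF t])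
        (simp add: vec_eq_iff integral_vec_nth[OF I] XTn m(2) subordinated_levy_mean(2)[OF W i])
  qed
  have covT: "cov_exists N T1 T1" "cov N T1 T1 /\<^sub>R t = (LINT s:orthant_star|\<T>. outer s s)"
    if s: "set_integrable \<T> orthant_star (\<lambda>s. outer s s)"
  proof -
    note S = time_second_moment[OF W s]
    have U: "integrable N (\<lambda>w. T1 w $ k)" "integrable N (\<lambda>w. T1 w $ k * T1 w $ l)" for k l
      unfolding T1n by (intro mean(1) out square S(1))+
    note c = cov_nth[OF N U(1) U(1) U(2)]
    show "cov_exists N T1 T1" by (rule c(1))
    show "cov N T1 T1 /\<^sub>R t = (LINT s:orthant_star|\<T>. outer s s)"
      by (rule scaleR_inverse_eqI[OF t])
        (simp add: vec_eq_iff c(2) T1n covariance[OF out[OF S(1)] out[OF S(1)] S(1) square[OF S(1) S(1)]] S(2))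
  qed
  have covXT: "cov_exists N XT XT" "cov N XT XT /\<^sub>R t =
      diamond_mat d \<Sigma> + (LINT x:- {0}|diamond_measure d \<X>. outer x x) +
      (LINT s:orthant_star|\<T>. (LINT w|M. outer (at_time X s w) (at_time X s w)))"
    if s: "set_integrable (diamond_measure d \<X>) (- {0}) (\<lambda>x. outer x x)" "iterated_finite M X \<T> (\<lambda>s x. outer x x)"
  proof -
    note S = subordinated_second_moment[OF W s]
    have U: "integrable N (\<lambda>w. XT w $ k)" "integrable N (\<lambda>w. XT w $ k * XT w $ l)" for k l
      unfolding XTn by (intro mean(1) out square S(1))+
    note c = cov_nth[OF N U(1) U(1) U(2)]
    show "cov_exists N XT XT" by (rule c(1))
    show "cov N XT XT /\<^sub>R t =
      diamond_mat d \<Sigma> + (LINT x:- {0}|diamond_measure d \<X>. outer x x) +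
      (LINT s:orthant_star|\<T>. (LINT w|M. outer (at_time X s w) (at_time X s w)))"
      by (rule scaleR_inverse_eqI[OF t])
        (simp add: vec_eq_iff c(2) XTn covariance[OF out[OF S(1)] out[OF S(1)] S(1) square[OF S(1) S(1)]] S(2) add.assoc)
  qed
  have covXTT: "cov_exists N XT T1" "cov N XT T1 /\<^sub>R t = (LINT s:orthant_star|\<T>. outer (LINT w|M. at_time X s w) s)"
    if s: "fin_mean_T" "fin_mean_XT" "iterated_finite M X \<T> (\<lambda>s x. outer x s)"
  proof -
    have i: "integrable \<T> (\<lambda>s. s)" using s fmT by simp
    have x: "set_integrable (diamond_measure d \<X>) (- cball 0 1) (\<lambda>x. x)" "iterated_finite M X \<T> (\<lambda>s x. x)"
      using s by (auto simp: fin_mean_XT_def)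
    note oT = time_levy_mean(1)[OF W i] and oX = subordinated_levy_mean(1)[OF W x]
    note S = mixed_second_moment[OF W L\<Z> x(2) s(3)]
    have P: "integrable N (\<lambda>w. Z t w $ Inr k * Z t w $ Inl l)" for k l
      by (rule levy_triplet_product_integrable[OF L t0 oX oT S(1) weak_time_nonneg[OF T i t0 W L]]) simp
    have U: "integrable N (\<lambda>w. XT w $ k)" "integrable N (\<lambda>w. T1 w $ k)" "integrable N (\<lambda>w. XT w $ k * T1 w $ l)" for k l
      unfolding XTn T1n by (intro mean(1) oX oT P)+
    note c = cov_nth[OF N U]
    show "cov_exists N XT T1" by (rule c(1))
    show "cov N XT T1 /\<^sub>R t = (LINT s:orthant_star|\<T>. outer (LINT w|M. at_time X s w) s)"
      by (rule scaleR_inverse_eqI[OF t])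
        (simp add: vec_eq_iff c(2) XTn T1n covariance[OF oX oT S(1) P] S(2))
  qed
  show ?thesis using meanT meanXT covT covXT covXTT by blast
qed

end
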